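(* Let $(\Omega,\Sigma,P)$ be a probability space, let $\{N_t\}_{t\in\mathbb{R}_+}$ be a counting process on it with interarrival process $\{W_n\}_{n\in\mathbb{N}}$, and let $d\in\mathbb{N}$. Consider the following assertions: (i) There exist a $d$-dimensional random vector $\Theta$ (and a Markov kernel $\theta\mapsto\mathbf{K}(\theta)$ from $(\mathbb{R}^d,\mathfrak{B}(\mathbb{R}^d))$ to $(\mathbb{R},\mathfrak{B}(\mathbb{R}))$) such that $\{N_t\}_{t\in\mathbb{R}_+}$ is a $(P,\mathbf{K}(\Theta))$-mixed renewal process. (ii) There exist a $d$-dimensional random vector $\Theta$, a disintegration $\{P_\theta\}_{\theta\in\mathbb{R}^d}$ of $P$ over $P_\Theta$ consistent with $\Theta$, and a Markov kernel $\{\mathbf{K}(\theta)\}_{\theta\in\mathbb{R}^d}$ from $(\mathbb{R}^d,\mathfrak{B}(\mathbb{R}^d))$ to $(\mathbb{R},\mathfrak{B}(\mathbb{R}))$ such that for $P_\Theta$-almost all $\theta\in\mathbb{R}^d$ the family $\{N_t\}_{t\in\mathbb{R}_+}$ is a $(P_\theta,\mathbf{K}(\theta))$-renewal process. (iii) The process $\{W_n\}_{n\in\mathbb{N}}$ is $P$-exchangeable. (iv) There exist a $\sigma$-subalgebra $\mathcal{F}$ of $\Sigma$ and a Markov kernel $\{Q_\omega\}_{\omega\in\Omega}$ from $(\Omega,\mathcal{F})$ to $(\mathbb{R},\mathfrak{B}(\mathbb{R}))$ such that $$\int_FQ_\omega^{\mathbb{N}}(H)\,R(d\omega)=P(F\cap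 W^{-1}(H))$$ for every $H\in\mathfrak{B}(\mathbb{R}^{\mathbb{N}})$ and $F\in\mathcal{F}$, where $R:=P\mid\mathcal{F}$, $W:=(W_1,\dots,W_n,\dots)$, and $Q_\omega^{\mathbb{N}}$ is the $\mathbb{N}$-fold product probability of copies of $Q_\omega$. (v) There exist a $\sigma$-subalgebra $\mathcal{F}$ of $\Sigma$, a subfield regular conditional probability $\{S_\omega\}_{\omega\in\Omega}$ for $P$ over $R:=P\mid\mathcal{F}$, and a Markov kernel $\{\mathbf{K}(\omega)\}_{\omega\in\Omega}$ from $(\Omega,\mathcal{F})$ to $(\mathbb{R},\mathfrak{B}(\mathbb{R}))$ such that for $R$-almost all $\omega\in\Omega$ the sequence $\{W_n\}_{n\in\mathbb{N}}$ is $S_\omega$-independent and $(S_\omega)_{W_n}=\mathbf{K}(\omega)$ for each $n\in\mathbb{N}$. (vi) There exist a set $\widetilde\Upsilon$, a family $\{S_{\tilde y}\}_{\tilde y\in\widetilde\Upsilon}$ of probability measures on $\Sigma$ and a probability measure $\nu$ on $B(\widetilde\Upsilon):=\sigma(\{S_\bullet(E):E\in\Sigma\})$ such that $\{N_t\}_{t\in\mathbb{R}_+}$ is a $\nu$-mixed renewal process associated with $\{S_{\tilde y}\}_{\tilde y\in\widetilde\Upsilon}$. Then the following implications hold: (ii)$\Rightarrow$(i), (ii)$\Rightarrow$(v), (i)$\Leftrightarrow$(iii), (ii)$\Rightarrow$(iv), (v)$\Rightarrow$(vi), (iii)$\Leftrightarrow$(iv), (vi)$\Rightarrow$(iv). Moreover,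 if $\Sigma$ is countably generated and $P$ is perfect, then (i) to (vi) are all equivalent.
   Context: Counting process: a family $\{N_t\}_{t\in\mathbb{R}_+}$ of $\Sigma$-measurable maps such that every path takes values in $\mathbb{N}_0\cup\{\infty\}$, vanishes at $t=0$, is nondecreasing and right-continuous, has jumps of size at most one ($N_t\le\sup_{s<t}N_s+1$ for $t>0$) and increases to infinity ($\sup_tN_t=\infty$); the exceptional null set is assumed empty. Interarrival times: $W_n:=T_n-T_{n-1}$ with $T_n:=\inf\{t\in\mathbb{R}_+:N_t=n\}$. Conditional independence given $\Theta$ of $\{X_i\}_{i\in I}$: for each $n\ge2$, distinct $i_1,\dots,i_n$ and $E_j\in\sigma(X_{i_j})$, $P(\bigcap_jE_j\mid\sigma(\Theta))=\prod_jP(E_j\mid\sigma(\Theta))$ a.s. $P_{X\mid\Theta}$ is a conditional distribution of $X$ given $\Theta$ (Markov kernel, $\sigma(\Theta)$-measurable in $\omega$, with $P_{X\mid\Theta}(B,\cdot)=P(X^{-1}(B)\mid\sigma(\Theta))$ a.s.). For a Markov kernel $\mathbf{K}$, $\mathbf{K}(\Theta)(B,\omega):=\mathbf{K}(\Theta(\omega))(B)$. Kernels are equal $P\mid\sigma(\Theta)$-a.s. if there is a $P$-null set in $\sigma(\Theta)$ outside of which they agree for all $B$. $\{N_t\}$ is a $(P,\mathbf{K}(\Theta))$-mixed renewal process if $\{W_n\}$ is $P$-conditionally independent given $\Theta$ and $P_{W_n\mid\Theta}=\mathbf{K}(\Theta)$ $P\mid\sigma(\Theta)$-a.s. for all $n$.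 It is a $(P',\mathbf{K})$-renewal process ($P'$ a probability measure on $\Sigma$, $\mathbf{K}$ a distribution on $\mathfrak{B}(\mathbb{R})$) if under $P'$ the $W_n$ are independent and all have distribution $\mathbf{K}$. Disintegration of $P$ over $P_\Theta:=P\circ\Theta^{-1}$ consistent with $\Theta$: a family $\{P_\theta\}$ of probability measures on $\Sigma$ with $\theta\mapsto P_\theta(D)$ measurable and $\int P_\theta(D)\,P_\Theta(d\theta)=P(D)$ for all $D\in\Sigma$, and for each $B\in\mathfrak{B}(\mathbb{R}^d)$, $P_\theta(\Theta^{-1}(B))=1$ for $P_\Theta$-almost every $\theta\in B$. Subfield regular conditional probability for $P$ over $R=P\mid\mathcal{F}$: probability measures $\{S_\omega\}_{\omega\in\Omega}$ on $\Sigma$ with $\omega\mapsto S_\omega(E)$ $\mathcal{F}$-measurable for each $E\in\Sigma$ and $\int_FS_\omega(E)\,R(d\omega)=P(E\cap F)$ for all $F\in\mathcal{F}$, $E\in\Sigma$. $P$-exchangeable: for each $r\in\mathbb{N}$, $P(\bigcap_{k=1}^rW_{i_k}^{-1}(B_k))=P(\bigcap_{k=1}^rW_{j_k}^{-1}(B_k))$ for distinct $i_1,\dots,i_r$, distinct $j_1,\dots,j_r$ and Borel $B_k$. $\nu$-mixed renewal process associated with $\{S_{\tilde y}\}_{\tilde y\in\widetilde\Upsilon}$: $B(\widetilde\Upsilon)$ is the $\sigma$-algebra on $\widetilde\Upsilon$ generated by the functions $\tilde y\mapsto S_{\tilde y}(E)$, $E\in\Sigma$; $\nu$ is a probability measure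 on it; for $\nu$-almost all $\tilde y$ the $W_n$ are identically distributed under $S_{\tilde y}$; and for every $r\in\mathbb{N}$ and $w_1,\dots,w_r\in\mathbb{R}$, $P(\bigcap_{k=1}^r\{W_k\le w_k\})=\int\prod_{k=1}^rS_{\tilde y}(W_k\le w_k)\,\nu(d\tilde y)$. $P$ is perfect if for every random variable $X:\Omega\to\mathbb{R}$ there is a Borel set $B\subseteq X(\Omega)$ with $P(X^{-1}(B))=1$. $\Sigma$ is countably generated if generated by a countable family of sets. *)

theory Defs
  imports "HOL-Probability.Probability"
begin

subsection \<open>Counting processes and interarrival times\<close>

text \<open>Time is real, restricted to \<open>t \<ge> 0\<close>; the type \<^typ>\<open>enat\<close> is the state space
  \<open>{0, 1, \<dots>} \<union> {\<infinity>}\<close> with its order topology.  All path properties hold for every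
  \<open>\<omega> \<in> space M\<close>, i.e. the exceptional null set is empty.\<close>

definition counting_process :: "'a measure \<Rightarrow> (real \<Rightarrow> 'a \<Rightarrow> enat) \<Rightarrow> bool" where
  "counting_process M N \<longleftrightarrow>
     (\<forall>t\<ge>0. N t \<in> M \<rightarrow>\<^sub>M count_space UNIV) \<and>
     (\<forall>\<omega>\<in>space M.
        N 0 \<omega> = 0 \<and>
        mono_on {0..} (\<lambda>t. N t \<omega>) \<and>
        (\<forall>t\<ge>0. continuous (at_right t) (\<lambda>s. N s \<omega>)) \<and>
        (\<forall>t>0. N t \<omega> \<le> (SUP s\<in>{0..<t}. N s \<omega>) + 1) \<and>
        (SUP t\<in>{0..}. N t \<omega>) = \<infinity>)"

definition arrival_time :: "(real \<Rightarrow> 'a \<Rightarrow> enat) \<Rightarrow> nat \<Rightarrow> 'a \<Rightarrow> real" where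
  "arrival_time N n \<omega> = Inf {t. 0 \<le> t \<and> N t \<omega> = enat n}"

text \<open>Sequences of interarrival times are indexed by \<open>n \<ge> 1\<close>, i.e. by the set \<open>{1..}\<close>;
  the value at \<open>n = 0\<close> is never used.\<close>

definition interarrival_time :: "(real \<Rightarrow> 'a \<Rightarrow> enat) \<Rightarrow> nat \<Rightarrow> 'a \<Rightarrow> real" where
  "interarrival_time N n \<omega> = arrival_time N n \<omega> - arrival_time N (n - 1) \<omega>"

definition interarrival_seq :: "(real \<Rightarrow> 'a \<Rightarrow> enat) \<Rightarrow> 'a \<Rightarrow> nat \<Rightarrow> real" where
  "interarrival_seq N \<omega> = (\<lambda>n\<in>{1..}. interarrival_time N n \<omega>)"

subsection \<open>Conditioning\<close>

text \<open>A Markov kernel from \<open>A\<close> to \<open>B\<close> is an element of \<open>A \<rightarrow>\<^sub>M prob_algebra B\<close>.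
  A \<open>\<sigma>\<close>-subalgebra of \<open>M\<close> is represented by a measure \<open>G\<close> with \<^term>\<open>subalgebra M G\<close>, of
  which only space and sets matter; the restriction of \<open>M\<close> to it is \<^term>\<open>restr_to_subalg M G\<close>.\<close>

definition sigma_gen :: "'a measure \<Rightarrow> ('a \<Rightarrow> 'b::topological_space) \<Rightarrow> 'a measure" where
  "sigma_gen M X = vimage_algebra (space M) X borel"

definition cond_prob_given :: "'a measure \<Rightarrow> 'a measure \<Rightarrow> 'a set \<Rightarrow> 'a \<Rightarrow> real" where
  "cond_prob_given M G E = real_cond_exp M G (indicator E)"

definition cond_indep_given ::
  "'a measure \<Rightarrow> 'a measure \<Rightarrow> ('i \<Rightarrow> 'a \<Rightarrow> real) \<Rightarrow> 'i set \<Rightarrow> bool" where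
  "cond_indep_given M G X I \<longleftrightarrow>
     (\<forall>J E. J \<subseteq> I \<longrightarrow> finite J \<longrightarrow> 2 \<le> card J \<longrightarrow> (\<forall>j\<in>J. E j \<in> sets (sigma_gen M (X j))) \<longrightarrow>
        (AE \<omega> in M. cond_prob_given M G (\<Inter>j\<in>J. E j) \<omega> = (\<Prod>j\<in>J. cond_prob_given M G (E j) \<omega>)))"

definition is_cond_distribution ::
  "'a measure \<Rightarrow> 'a measure \<Rightarrow> ('a \<Rightarrow> real) \<Rightarrow> ('a \<Rightarrow> real measure) \<Rightarrow> bool" where
  "is_cond_distribution M G X \<kappa> \<longleftrightarrow>
     \<kappa> \<in> G \<rightarrow>\<^sub>M prob_algebra borel \<and>
     (\<forall>B\<in>sets borel. AE \<omega> in M. measure (\<kappa> \<omega>) B = cond_prob_given M G (X -` B \<inter> space M) \<omega>)"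

definition kernels_eq_as ::
  "'a measure \<Rightarrow> 'a measure \<Rightarrow> ('a \<Rightarrow> real measure) \<Rightarrow> ('a \<Rightarrow> real measure) \<Rightarrow> bool" where
  "kernels_eq_as M G \<kappa> \<kappa>' \<longleftrightarrow>
     (\<exists>Z \<in> null_sets M \<inter> sets G.
        \<forall>\<omega> \<in> space M - Z. \<forall>B\<in>sets borel. measure (\<kappa> \<omega>) B = measure (\<kappa>' \<omega>) B)"

subsection \<open>Renewal processes and their mixtures\<close>

definition renewal_process ::
  "'a measure \<Rightarrow> real measure \<Rightarrow> (real \<Rightarrow> 'a \<Rightarrow> enat) \<Rightarrow> bool" where
  "renewal_process P K N \<longleftrightarrow>
     prob_space.indep_vars P (\<lambda>_. borel) (interarrival_time N) {1..} \<and>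
     (\<forall>n\<ge>1. distr P borel (interarrival_time N n) = K)"

text \<open>The conditional distribution of an interarrival time given \<open>\<Theta>\<close> is determined only up to
  almost sure equality, so equality with the kernel \<open>K(\<Theta>)\<close> is required of some version.\<close>

definition mixed_renewal_process ::
  "'a measure \<Rightarrow> ('t::topological_space \<Rightarrow> real measure) \<Rightarrow> ('a \<Rightarrow> 't) \<Rightarrow> (real \<Rightarrow> 'a \<Rightarrow> enat) \<Rightarrow> bool"
where
  "mixed_renewal_process M K \<Theta> N \<longleftrightarrow>
     cond_indep_given M (sigma_gen M \<Theta>) (interarrival_time N) {1..} \<and>
     (\<forall>n\<ge>1. \<exists>\<kappa>. is_cond_distribution M (sigma_gen M \<Theta>) (interarrival_time N n) \<kappa> \<and>
                 kernels_eq_as M (sigma_gen M \<Theta>) \<kappa> (\<lambda>\<omega>. K (\<Theta> \<omega>)))"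

definition consistent_disintegration ::
  "'a measure \<Rightarrow> ('a \<Rightarrow> 't::topological_space) \<Rightarrow> ('t \<Rightarrow> 'a measure) \<Rightarrow> bool" where
  "consistent_disintegration M \<Theta> Pt \<longleftrightarrow>
     Pt \<in> borel \<rightarrow>\<^sub>M prob_algebra M \<and>
     (\<forall>D\<in>sets M. (\<integral>\<^sup>+\<theta>. emeasure (Pt \<theta>) D \<partial>distr M borel \<Theta>) = emeasure M D) \<and>
     (\<forall>B\<in>sets borel. AE \<theta> in distr M borel \<Theta>.
        \<theta> \<in> B \<longrightarrow> emeasure (Pt \<theta>) (\<Theta> -` B \<inter> space M) = 1)"

definition subfield_rcp :: "'a measure \<Rightarrow> 'a measure \<Rightarrow> ('a \<Rightarrow> 'a measure) \<Rightarrow> bool" where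
  "subfield_rcp M F S \<longleftrightarrow>
     S \<in> F \<rightarrow>\<^sub>M prob_algebra M \<and>
     (\<forall>A\<in>sets F. \<forall>E\<in>sets M.
        (\<integral>\<^sup>+\<omega>\<in>A. emeasure (S \<omega>) E \<partial>restr_to_subalg M F) = emeasure M (E \<inter> A))"

definition exchangeable :: "'a measure \<Rightarrow> (nat \<Rightarrow> 'a \<Rightarrow> real) \<Rightarrow> nat set \<Rightarrow> bool" where
  "exchangeable M X I \<longleftrightarrow>
     (\<forall>r\<ge>1. \<forall>(i :: nat \<Rightarrow> nat) (j :: nat \<Rightarrow> nat) B.
        i ` {1..r} \<subseteq> I \<longrightarrow> inj_on i {1..r} \<longrightarrow>
        j ` {1..r} \<subseteq> I \<longrightarrow> inj_on j {1..r} \<longrightarrow>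
        (\<forall>k\<in>{1..r}. B k \<in> sets borel) \<longrightarrow>
        measure M (\<Inter>k\<in>{1..r}. X (i k) -` B k \<inter> space M) =
        measure M (\<Inter>k\<in>{1..r}. X (j k) -` B k \<inter> space M))"

text \<open>The \<open>\<sigma>\<close>-algebra on \<open>Y\<close> generated by the evaluations \<open>y \<mapsto> S y E\<close>.\<close>

definition eval_algebra :: "'a measure \<Rightarrow> 'y set \<Rightarrow> ('y \<Rightarrow> 'a measure) \<Rightarrow> 'y measure" where
  "eval_algebra M Y S =
     sigma Y {(\<lambda>y. measure (S y) E) -` B \<inter> Y | E B. E \<in> sets M \<and> B \<in> sets borel}"

definition nu_mixed_renewal_process ::
  "'a measure \<Rightarrow> 'y set \<Rightarrow> ('y \<Rightarrow> 'a measure) \<Rightarrow> 'y measure \<Rightarrow> (real \<Rightarrow> 'a \<Rightarrow> enat) \<Rightarrow> bool" where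
  "nu_mixed_renewal_process M Y S \<nu> N \<longleftrightarrow>
     (AE y in \<nu>. \<forall>m\<ge>1. \<forall>n\<ge>1.
        distr (S y) borel (interarrival_time N m) = distr (S y) borel (interarrival_time N n)) \<and>
     (\<forall>r\<ge>1. \<forall>w :: nat \<Rightarrow> real.
        measure M (\<Inter>k\<in>{1..r}. {\<omega> \<in> space M. interarrival_time N k \<omega> \<le> w k}) =
        (\<integral>y. (\<Prod>k\<in>{1..r}. measure (S y) {\<omega> \<in> space M. interarrival_time N k \<omega> \<le> w k}) \<partial>\<nu>))"

definition perfect_measure :: "'a measure \<Rightarrow> bool" where
  "perfect_measure M \<longleftrightarrow>
     (\<forall>X :: 'a \<Rightarrow> real. X \<in> borel_measurable M \<longrightarrow>
        (\<exists>B\<in>sets borel. B \<subseteq> X ` space M \<and> emeasure M (X -` B \<inter> space M) = 1))"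

definition countably_generated :: "'a measure \<Rightarrow> bool" where
  "countably_generated M \<longleftrightarrow>
     (\<exists>\<A>. countable \<A> \<and> \<A> \<subseteq> Pow (space M) \<and> sets M = sigma_sets (space M) \<A>)"

subsection \<open>The six assertions\<close>

text \<open>The index type \<open>'d\<close> supplies the dimension \<open>d = CARD('d) \<ge> 1\<close>.\<close>

definition assertion_i ::
  "'d::finite itself \<Rightarrow> 'a measure \<Rightarrow> (real \<Rightarrow> 'a \<Rightarrow> enat) \<Rightarrow> bool" where
  "assertion_i d M N \<longleftrightarrow>
     (\<exists>(\<Theta> :: 'a \<Rightarrow> real ^ 'd) (K :: real ^ 'd \<Rightarrow> real measure).
        \<Theta> \<in> borel_measurable M \<and>
        K \<in> borel \<rightarrow>\<^sub>M prob_algebra borel \<and>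
        mixed_renewal_process M K \<Theta> N)"

definition assertion_ii ::
  "'d::finite itself \<Rightarrow> 'a measure \<Rightarrow> (real \<Rightarrow> 'a \<Rightarrow> enat) \<Rightarrow> bool" where
  "assertion_ii d M N \<longleftrightarrow>
     (\<exists>(\<Theta> :: 'a \<Rightarrow> real ^ 'd) (Pt :: real ^ 'd \<Rightarrow> 'a measure) (K :: real ^ 'd \<Rightarrow> real measure).
        \<Theta> \<in> borel_measurable M \<and>
        consistent_disintegration M \<Theta> Pt \<and>
        K \<in> borel \<rightarrow>\<^sub>M prob_algebra borel \<and>
        (AE \<theta> in distr M borel \<Theta>. renewal_process (Pt \<theta>) (K \<theta>) N))"

definition assertion_iii :: "'a measure \<Rightarrow> (real \<Rightarrow> 'a \<Rightarrow> enat) \<Rightarrow> bool" where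
  "assertion_iii M N \<longleftrightarrow> exchangeable M (interarrival_time N) {1..}"

definition assertion_iv :: "'a measure \<Rightarrow> (real \<Rightarrow> 'a \<Rightarrow> enat) \<Rightarrow> bool" where
  "assertion_iv M N \<longleftrightarrow>
     (\<exists>(F :: 'a measure) (Q :: 'a \<Rightarrow> real measure).
        subalgebra M F \<and>
        Q \<in> F \<rightarrow>\<^sub>M prob_algebra borel \<and>
        (\<forall>H \<in> sets (Pi\<^sub>M {1..} (\<lambda>_. borel)). \<forall>A \<in> sets F.
           (\<integral>\<^sup>+\<omega>\<in>A. emeasure (Pi\<^sub>M {1..} (\<lambda>_. Q \<omega>)) H \<partial>restr_to_subalg M F) =
           emeasure M (A \<inter> (interarrival_seq N -` H \<inter> space M))))"

definition assertion_v :: "'a measure \<Rightarrow> (real \<Rightarrow> 'a \<Rightarrow> enat) \<Rightarrow> bool" where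
  "assertion_v M N \<longleftrightarrow>
     (\<exists>(F :: 'a measure) (S :: 'a \<Rightarrow> 'a measure) (K :: 'a \<Rightarrow> real measure).
        subalgebra M F \<and>
        subfield_rcp M F S \<and>
        K \<in> F \<rightarrow>\<^sub>M prob_algebra borel \<and>
        (AE \<omega> in restr_to_subalg M F.
           prob_space.indep_vars (S \<omega>) (\<lambda>_. borel) (interarrival_time N) {1..} \<and>
           (\<forall>n\<ge>1. distr (S \<omega>) borel (interarrival_time N n) = K \<omega>)))"

text \<open>HOL cannot quantify existentially over types, so the type \<open>'y\<close> of the members of the index
  set \<open>Y\<close> is a parameter.  The choice \<open>'y = 'a measure\<close> is universal: a family \<open>S\<close> over any
  index set may be replaced by the identity family over its range, with \<open>\<nu>\<close> replaced by
  its image under \<open>S\<close>.\<close>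

definition assertion_vi ::
  "'y itself \<Rightarrow> 'a measure \<Rightarrow> (real \<Rightarrow> 'a \<Rightarrow> enat) \<Rightarrow> bool" where
  "assertion_vi ty M N \<longleftrightarrow>
     (\<exists>(Y :: 'y set) (S :: 'y \<Rightarrow> 'a measure) (\<nu> :: 'y measure).
        (\<forall>y\<in>Y. prob_space (S y) \<and> sets (S y) = sets M) \<and>
        prob_space \<nu> \<and> space \<nu> = Y \<and> sets \<nu> = sets (eval_algebra M Y S) \<and>
        nu_mixed_renewal_process M Y S \<nu> N)"

end

theory Submission
  imports Defs
begin

text \<open>The counting process enters only through the measurability of its interarrival times
  \<open>X n\<close>; the rest concerns a sequence of real random variables.  Each of (i), (ii), (iv) and (vi)
  presents the law of the sequence as a mixture of laws \<open>\<kappa>\<^sup>\<nat>\<close>, whence exchangeability.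

  Conversely, let the sequence be exchangeable.  The averages of the indicators of \<open>X j \<in> B\<close> over the
  first \<open>4 ^ k\<close> indices have summable \<open>L\<^sup>1\<close> increments, hence converge almost surely, and their limit
  \<open>freq B\<close> is tail measurable.  Replacing a factor \<open>freq B\<close> by averages over late indices shows
  that on every tail event a product of indicators of \<open>X j \<in> B j\<close> has the same expectation as the
  corresponding product of limits \<open>freq (B j)\<close>.
  Coding the limits for all rational half lines into one real random variable \<open>\<Theta>\<close> turns this into
  conditional independence given \<open>\<Theta>\<close>, the common kernel being a conditional distribution of \<open>X 1\<close>
  given \<open>\<Theta>\<close>, which gives (i) and (iv).  If moreover \<open>P\<close> is perfect and \<open>\<Sigma>\<close> countably generated,
  \<open>P\<close> itself disintegrates over \<open>\<Theta>\<close>, and comparing the two kernels on countably many boxes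
  yields (ii).\<close>

subsection \<open>Measurability of interarrival times\<close>

text \<open>Three constraints shape the converse direction. Indicators can be traded for frequencies
  only against events that survive every finite relabelling of indices, so \<open>\<Theta>\<close>
  must be measurable with respect to the terms beyond n for each n; this is why the encoding lemma
  quantifies over all \<sigma>-algebras on the space. For the averages at m \<le> n, exchangeability
  gives the squared distance \<open>(p1 - p2) * (1 / m - 1 / n)\<close>. Between consecutive n this
  only bounds the increments by terms of order 1/n, which are not summable; along
  \<open>4 ^ k\<close> the bound becomes \<open>1 / 2 ^ k\<close>. Finally,
  \<open>freq B \<omega>\<close> need not be a measure in \<open>B\<close> for any fixed
  \<open>\<omega>\<close>, since additivity holds only up to null sets depending on the sets
  involved. A genuine kernel is therefore taken from the conditional distribution of a single term,
  and it has to match the frequencies only on rational half lines, which determine a law.\<close>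

lemma arrival_time_le_iff:
  assumes N: "counting_process M N" and \<omega>: "\<omega> \<in> space M" and t: "0 \<le> t"
  shows "arrival_time N n \<omega> \<le> t \<longleftrightarrow> enat n \<le> N t \<omega>"
    and "0 \<le> arrival_time N n \<omega>"
proof -
  define f where "f = (\<lambda>t. N t \<omega>)"
  have f0: "f 0 = 0" and mono: "\<And>s t. 0 \<le> s \<Longrightarrow> s \<le> t \<Longrightarrow> f s \<le> f t"
    and rc: "\<And>t. 0 \<le> t \<Longrightarrow> continuous (at_right t) f"
    and jump: "\<And>t. 0 < t \<Longrightarrow> f t \<le> (SUP s\<in>{0..<t}. f s) + 1"
    and sup: "(SUP t\<in>{0..}. f t) = \<infinity>"
    using N \<omega> by (auto simp: counting_process_def f_def mono_on_def)
  \<comment> \<open>Arrival times are defined through equality with \<open>n\<close>. The set with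
    \<open>\<le>\<close> instead is upward closed, nonempty because the path is unbounded, and
    contains its infimum by right continuity.\<close>
  define S where "S = {t. 0 \<le> t \<and> enat n \<le> f t}"
  have "\<exists>t\<ge>0. enat n < f t"
    using sup less_SUP_iff[of "enat n" f "{0..}"] by auto
  then have S: "S \<noteq> {}" by (auto simp: S_def intro: less_imp_le)
  have bdd: "bdd_below S" by (auto simp: S_def)
  define a where "a = Inf S"
  have a0: "0 \<le> a" unfolding a_def using S by (intro cInf_greatest) (auto simp: S_def)
  have aS: "enat n \<le> f a"
  proof (rule ccontr)
    assume "\<not> ?thesis"
    then have "f a < enat n" by simp
    moreover have "(f \<longlongrightarrow> f a) (at_right a)"
      using rc[OF a0] by (simp add: continuous_within)
    ultimately have "eventually (\<lambda>t. f t < enat n) (at_right a)"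
      by (rule order_tendstoD[rotated])
    then obtain b where b: "b > a" "\<And>t. a < t \<Longrightarrow> t < b \<Longrightarrow> f t < enat n"
      by (auto simp: eventually_at_right_field)
    have "\<exists>s\<in>S. s < b" using b(1) S bdd cInf_less_iff[of S b] by (auto simp: a_def)
    then obtain s where s: "s \<in> S" "s < b" by auto
    have "a \<le> s" using s bdd by (auto simp: a_def intro: cInf_lower)
    then have "f s < enat n"
      using b(2)[of s] s(2) \<open>f a < enat n\<close> by (cases "a = s") auto
    with s show False by (auto simp: S_def)
  qed
  have below: "f t < enat n" if "0 \<le> t" "t < a" for t
    using that bdd cInf_lower[of t S] unfolding a_def[symmetric] by (force simp: S_def not_le[symmetric])
  \<comment> \<open>Before \<open>a > 0\<close> the path is at most \<open>n - 1\<close>, so the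
    jump bound allows at most \<open>n\<close> at \<open>a\<close>: no level is skipped, and both
    sets have the same minimum. For \<open>a = 0\<close> the initial value decides.\<close>
  have fa: "f a = enat n"
  proof (cases "a = 0")
    case True
    then show ?thesis using aS f0 by (simp add: enat_0_iff zero_enat_def)
  next
    case False
    then have "0 < a" using a0 by simp
    then have n: "0 < n" using below[of 0] f0 by (simp add: zero_enat_def)
    have "(SUP s\<in>{0..<a}. f s) \<le> enat (n - 1)"
    proof (intro SUP_least)
      fix s assume "s \<in> {0..<a}"
      then show "f s \<le> enat (n - 1)" using below[of s] n by (cases "f s") auto
    qed
    then have "f a \<le> enat (n - 1) + 1"
      using jump[OF \<open>0 < a\<close>] by (metis add_right_mono order_trans)
    then show ?thesis using aS n by (simp add: one_enat_def)
  qed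
  have arr: "arrival_time N n \<omega> = a"
    unfolding arrival_time_def
  proof (rule cInf_eq_minimum)
    show "a \<in> {t. 0 \<le> t \<and> N t \<omega> = enat n}" using a0 fa by (simp add: f_def)
  next
    fix x assume "x \<in> {t. 0 \<le> t \<and> N t \<omega> = enat n}"
    then show "a \<le> x" unfolding a_def using bdd by (intro cInf_lower) (auto simp: S_def f_def)
  qed
  show "0 \<le> arrival_time N n \<omega>" using a0 arr by simp
  show "arrival_time N n \<omega> \<le> t \<longleftrightarrow> enat n \<le> N t \<omega>"
    using below[OF t] mono[OF a0, of t] fa arr by (fastforce simp: f_def not_le)
qed

lemma borel_measurable_arrival_time:
  assumes N: "counting_process M N"
  shows "arrival_time N n \<in> borel_measurable M"
proof (rule borel_measurableI_le)
  fix a :: real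
  show "{\<omega> \<in> space M. arrival_time N n \<omega> \<le> a} \<in> sets M"
  proof (cases "0 \<le> a")
    case True
    then have [measurable]: "N a \<in> M \<rightarrow>\<^sub>M count_space UNIV"
      using N by (simp add: counting_process_def)
    have "{\<omega> \<in> space M. arrival_time N n \<omega> \<le> a} = {\<omega> \<in> space M. enat n \<le> N a \<omega>}"
      using arrival_time_le_iff(1)[OF N _ True] by auto
    then show ?thesis by simp
  next
    case False
    have "0 \<le> arrival_time N n \<omega>" if "\<omega> \<in> space M" for \<omega>
      using arrival_time_le_iff(2)[OF N that order_refl] .
    then have "{\<omega> \<in> space M. arrival_time N n \<omega> \<le> a} = {}" using False by force
    then show ?thesis by (simp only: sets.empty_sets)
  qed
qed

lemma borel_measurable_interarrival_time:
  "counting_process M N \<Longrightarrow> interarrival_time N n \<in> borel_measurable M"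
  unfolding interarrival_time_def[abs_def]
  by (intro borel_measurable_diff borel_measurable_arrival_time)

subsection \<open>Coding countably many real functions into one\<close>

text \<open>Only the digits 0 and 1 occur in base 3. All later digits together amount to at most
  half a unit of a given place, so there is no carry ambiguity as with binary expansions.\<close>

definition ternary_code :: "(nat \<Rightarrow> bool) \<Rightarrow> real" where
  "ternary_code b = (\<Sum>i. of_bool (b i) / 3 ^ Suc i)"

lemma summable_ternary: "summable (\<lambda>i. of_bool (b i) / 3 ^ Suc i :: real)"
proof (rule summable_comparison_test')
  show "summable (\<lambda>i. (1 / 3) ^ i :: real)" by (intro summable_geometric) simp
  show "norm (of_bool (b i) / 3 ^ Suc i :: real) \<le> (1 / 3) ^ i" if "0 \<le> i" for i
    by (simp add: power_divide field_simps)
qed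

lemma ternary_code_bounds: "0 \<le> ternary_code b" "ternary_code b \<le> 1 / 2"
proof -
  show "0 \<le> ternary_code b"
    unfolding ternary_code_def by (intro suminf_nonneg summable_ternary) simp
  have g: "(\<lambda>i. (1 / 3) * (1 / 3) ^ i :: real) sums (1 / 3 * (1 / (1 - 1 / 3)))"
    by (intro sums_mult geometric_sums) simp
  have "ternary_code b \<le> (\<Sum>i. (1 / 3) * (1 / 3) ^ i)"
    unfolding ternary_code_def
    by (intro suminf_le summable_ternary sums_summable[OF g]) (simp add: power_divide)
  then show "ternary_code b \<le> 1 / 2" using sums_unique[OF g] by simp
qed

lemma ternary_code_step: "3 * ternary_code b = of_bool (b 0) + ternary_code (\<lambda>i. b (Suc i))"
proof -
  have "ternary_code b = of_bool (b 0) / 3 + (\<Sum>i. of_bool (b (Suc i)) / 3 ^ Suc (Suc i))"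
    unfolding ternary_code_def using suminf_split_head[OF summable_ternary[of b]] by simp
  also have "(\<Sum>i. of_bool (b (Suc i)) / 3 ^ Suc (Suc i) :: real) =
      (\<Sum>i. (of_bool (b (Suc i)) / 3 ^ Suc i) / 3)" by (intro suminf_cong) simp
  also have "\<dots> = ternary_code (\<lambda>i. b (Suc i)) / 3"
    unfolding ternary_code_def by (intro suminf_divide summable_ternary)
  finally show ?thesis by simp
qed


text \<open>Multiplication by \<open>3 ^ Suc n\<close> moves the digits up to \<open>n\<close> into
  an integer that is congruent to digit \<open>n\<close> modulo 3. What remains is again a code,
  hence in [0, 1/2], and the floor removes it. Digits are thus Borel functions of the code.\<close>

lemma ternary_code_digit:
  "b n \<longleftrightarrow> \<lfloor>3 ^ Suc n * ternary_code b\<rfloor> mod 3 = 1"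
proof -
  have "\<exists>k::int. 3 ^ n * ternary_code b = of_int k + ternary_code (\<lambda>i. b (i + n))"
  proof (induction n)
    case (Suc n)
    then obtain k :: int where k: "3 ^ n * ternary_code b = of_int k + ternary_code (\<lambda>i. b (i + n))" by auto
    have "3 ^ Suc n * ternary_code b = 3 * of_int k + 3 * ternary_code (\<lambda>i. b (i + n))"
      using k by (simp add: algebra_simps)
    also have "\<dots> = of_int (3 * k + of_bool (b n)) + ternary_code (\<lambda>i. b (i + Suc n))"
      using ternary_code_step[of "\<lambda>i. b (i + n)"] by simp
    finally show ?case by blast
  qed (auto intro: exI[of _ 0])
  then obtain k :: int where k: "3 ^ n * ternary_code b = of_int k + ternary_code (\<lambda>i. b (i + n))" by auto
  have "3 ^ Suc n * ternary_code b = 3 * of_int k + 3 * ternary_code (\<lambda>i. b (i + n))"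
    using k by (simp add: algebra_simps)
  also have "\<dots> = of_int (3 * k + of_bool (b n)) + ternary_code (\<lambda>i. b (i + Suc n))"
    using ternary_code_step[of "\<lambda>i. b (i + n)"] by simp
  finally have "\<lfloor>3 ^ Suc n * ternary_code b\<rfloor> = 3 * k + of_bool (b n)"
    using ternary_code_bounds[of "\<lambda>i. b (i + Suc n)"] by (intro floor_unique) linarith+
  then show ?thesis by (cases "b n") auto
qed

text \<open>Countably many real random variables generate the same information as a single one:
  store the truth values of all \<open>f i > q\<close>, \<open>q\<close> rational, as ternary digits.\<close>

lemma ex_real_encoding:
  fixes f :: "nat \<Rightarrow> 'a \<Rightarrow> real"
  shows "\<exists>\<Phi> :: 'a \<Rightarrow> real.
    (\<forall>F. space F = \<Omega> \<longrightarrow> (\<forall>i. f i \<in> borel_measurable F) \<longrightarrow> \<Phi> \<in> borel_measurable F) \<and>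
    (\<forall>i. f i \<in> borel_measurable (vimage_algebra \<Omega> \<Phi> borel))"
proof (intro exI conjI allI impI)
  define b where "b \<omega> n = (case prod_decode n of (i, j) \<Rightarrow> real_of_rat (from_nat j) < f i \<omega>)" for \<omega> n
  define \<Phi> where "\<Phi> = (\<lambda>\<omega>. ternary_code (b \<omega>))"
  show "\<Phi> \<in> borel_measurable F" if "space F = \<Omega>" and f: "\<forall>i. f i \<in> borel_measurable F" for F
  proof -
    have [measurable]: "f i \<in> borel_measurable F" for i using f by blast
    have [measurable]: "Measurable.pred F (\<lambda>\<omega>. b \<omega> n)" for n
      unfolding b_def by (cases "prod_decode n") simp
    show ?thesis unfolding \<Phi>_def ternary_code_def by measurable
  qed
  fix i
  show "f i \<in> borel_measurable (vimage_algebra \<Omega> \<Phi> borel)" (is "_ \<in> borel_measurable ?V")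
  proof (rule borel_measurableI_greater)
    fix a :: real
    have [measurable]: "\<Phi> \<in> borel_measurable ?V" by (rule measurable_vimage_algebra1) simp
    have digit: "{\<omega> \<in> space ?V. real_of_rat q < f i \<omega>} \<in> sets ?V" for q
    proof -
      let ?n = "prod_encode (i, to_nat q)"
      have "real_of_rat q < f i \<omega> \<longleftrightarrow> \<lfloor>3 ^ Suc ?n * \<Phi> \<omega>\<rfloor> mod 3 = 1" for \<omega>
        using ternary_code_digit[of "b \<omega>" ?n] by (simp add: b_def \<Phi>_def)
      moreover have "{\<omega> \<in> space ?V. \<lfloor>3 ^ Suc ?n * \<Phi> \<omega>\<rfloor> mod 3 = 1} \<in> sets ?V" by measurable
      ultimately show ?thesis by (simp only:)
    qed
    have "{\<omega> \<in> space ?V. a < f i \<omega>} = (\<Union>q\<in>{q. a < real_of_rat q}. {\<omega> \<in> space ?V. real_of_rat q < f i \<omega>})"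
      using of_rat_dense[of a] by (auto intro: less_trans)
    also have "\<dots> \<in> sets ?V" by (intro sets.countable_UN'' digit) (simp only: countable_Collect countableI_type)
    finally show "{\<omega> \<in> space ?V. a < f i \<omega>} \<in> sets ?V" .
  qed
qed

subsection \<open>Regular conditional distributions\<close>

text \<open>Testing on the set where \<open>g < f\<close> leaves a nonnegative difference with
  integral zero. Finiteness of the integral of \<open>f\<close> bounds that of \<open>g\<close> on
  this set, which makes the subtraction in \<open>ennreal\<close> legitimate.\<close>

lemma AE_le_if_set_nn_integral_le:
  fixes f g :: "'a \<Rightarrow> ennreal"
  assumes [measurable]: "f \<in> borel_measurable M" "g \<in> borel_measurable M"
    and le: "\<And>A. A \<in> sets M \<Longrightarrow> (\<integral>\<^sup>+x\<in>A. f x \<partial>M) \<le> (\<integral>\<^sup>+x\<in>A. g x \<partial>M)"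
    and fin: "(\<integral>\<^sup>+x. f x \<partial>M) < \<infinity>"
  shows "AE x in M. f x \<le> g x"
proof -
  define S where "S = {x \<in> space M. g x < f x}"
  have [measurable]: "S \<in> sets M" unfolding S_def by measurable
  have gf: "g x * indicator S x \<le> f x * indicator S x" for x
    by (auto simp: S_def indicator_def intro: less_imp_le)
  have "(\<integral>\<^sup>+x\<in>S. g x \<partial>M) \<le> (\<integral>\<^sup>+x. f x \<partial>M)"
    using gf by (intro nn_integral_mono) (auto simp: indicator_def S_def intro: less_imp_le)
  then have g: "(\<integral>\<^sup>+x\<in>S. g x \<partial>M) \<noteq> \<infinity>" using fin by (simp add: less_top top_unique)
  have "(\<integral>\<^sup>+x. (f x * indicator S x - g x * indicator S x) \<partial>M) =
      (\<integral>\<^sup>+x\<in>S. f x \<partial>M) - (\<integral>\<^sup>+x\<in>S. g x \<partial>M)"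
    using g gf by (intro nn_integral_diff) auto
  also have "\<dots> = 0"
  proof (rule diff_eq_0_ennreal)
    show fg: "(\<integral>\<^sup>+x\<in>S. f x \<partial>M) \<le> (\<integral>\<^sup>+x\<in>S. g x \<partial>M)" by (rule le) measurable
    show "(\<integral>\<^sup>+x\<in>S. f x \<partial>M) < top" using le_less_trans[OF fg] g by (simp add: less_top)
  qed
  finally have "AE x in M. f x * indicator S x - g x * indicator S x = 0"
    by (subst (asm) nn_integral_0_iff_AE) auto
  moreover have "AE x in M. x \<in> space M" by (rule AE_space)
  ultimately show ?thesis
  proof eventually_elim
    case (elim x)
    then show ?case by (cases "x \<in> S") (auto simp: diff_eq_0_iff_ennreal S_def)
  qed
qed

lemma AE_eq_if_set_nn_integral_eq:
  fixes f g :: "'a \<Rightarrow> ennreal"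
  assumes f: "f \<in> borel_measurable M" "g \<in> borel_measurable M"
    and eq: "\<And>A. A \<in> sets M \<Longrightarrow> (\<integral>\<^sup>+x\<in>A. f x \<partial>M) = (\<integral>\<^sup>+x\<in>A. g x \<partial>M)"
    and fin: "(\<integral>\<^sup>+x. f x \<partial>M) < \<infinity>" "(\<integral>\<^sup>+x. g x \<partial>M) < \<infinity>"
  shows "AE x in M. f x = g x"
proof -
  have "AE x in M. f x \<le> g x" by (rule AE_le_if_set_nn_integral_le[OF f _ fin(1)]) (simp add: eq)
  moreover have "AE x in M. g x \<le> f x" by (rule AE_le_if_set_nn_integral_le[OF f(2,1) _ fin(2)]) (simp add: eq)
  ultimately show ?thesis by eventually_elim (rule antisym)
qed

text \<open>Thresholds strictly above \<open>x\<close> make \<open>{x<..}\<close> an increasing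
  union of rational half lines, so that continuity from below carries identities from rational to
  real thresholds.\<close>

lemma ex_decseq_rat:
  fixes x :: real
  obtains q :: "nat \<Rightarrow> rat" where "decseq q" "\<And>n. x < real_of_rat (q n)"
    "\<And>y. x < y \<Longrightarrow> \<exists>n. real_of_rat (q n) < y"
proof -
  have "\<exists>q. \<forall>n. (x < real_of_rat (q n) \<and> real_of_rat (q n) < x + 1 / real (Suc n)) \<and> q (Suc n) \<le> q n"
  proof (rule dependent_nat_choice)
    show "\<exists>q. x < real_of_rat q \<and> real_of_rat q < x + 1 / real (Suc 0)"
      using of_rat_dense[of x "x + 1"] by auto
    fix q n assume q: "x < real_of_rat q \<and> real_of_rat q < x + 1 / real (Suc n)"
    have "x < min (real_of_rat q) (x + 1 / real (Suc (Suc n)))" using q by simp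
    then obtain p where "x < real_of_rat p" "real_of_rat p < min (real_of_rat q) (x + 1 / real (Suc (Suc n)))"
      using of_rat_dense by blast
    then show "\<exists>p. (x < real_of_rat p \<and> real_of_rat p < x + 1 / real (Suc (Suc n))) \<and> p \<le> q"
      by (intro exI[of _ p]) (auto simp: of_rat_less intro: less_imp_le)
  qed
  then obtain q where q: "\<And>n. x < real_of_rat (q n)" "\<And>n. real_of_rat (q n) < x + 1 / real (Suc n)"
      "\<And>n. q (Suc n) \<le> q n" by blast
  show ?thesis
  proof
    show "decseq q" using q(3) by (rule decseq_SucI)
    show "\<exists>n. real_of_rat (q n) < y" if "x < y" for y
    proof -
      have "0 < y - x" using that by simp
      then obtain n where "1 / real (Suc n) < y - x"
        using reals_Archimedean[of "y - x"] unfolding inverse_eq_divide by blast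
      then show ?thesis using q(2)[of n] by (intro exI[of _ n]) linarith
    qed
  qed (fact q(1))
qed

text \<open>Inverse transform sampling at a single threshold: it turns a conditional tail
  probability \<open>c\<close> into the measure of a set of \<open>u\<close>.\<close>

lemma emeasure_unit_interval_less:
  assumes "c \<le> 1"
  shows "emeasure (uniform_measure lborel {0..1}) {u::real. ennreal u < c} = c"
proof -
  obtain r where r: "c = ennreal r" "0 \<le> r" "r \<le> 1"
    using assms by (cases c) (auto simp: top_unique)
  have "{0..1} \<inter> {u::real. ennreal u < c} = {0..<r}"
    using r by (auto simp: ennreal_less_iff)
  moreover have "{u::real. ennreal u < c} \<in> sets borel" by measurable
  moreover have "ennreal r / 1 = ennreal r" by (simp add: divide_ennreal_def)
  ultimately show ?thesis using r by simp
qed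

text \<open>Radon-Nikodym derivatives \<open>f q\<close> serve as conditional probabilities of
  \<open>q < X\<close>, each determined up to a null set. Rather than repairing them into
  distribution functions, a generalised quantile \<open>g \<theta>\<close> is formed and
  \<open>\<kappa> \<theta>\<close> is its law under the uniform measure. This is a probability
  measure for every \<open>\<theta>\<close>, while the tails have to be right only almost
  everywhere. Boundedness of \<open>X\<close> keeps the quantile real.\<close>

lemma ex_conditional_distribution_bounded:
  fixes X :: "'a \<Rightarrow> real"
  assumes "prob_space M" and \<Theta>[measurable]: "\<Theta> \<in> M \<rightarrow>\<^sub>M T" and X[measurable]: "X \<in> borel_measurable M"
    and bnd: "\<And>\<omega>. \<omega> \<in> space M \<Longrightarrow> a \<le> X \<omega> \<and> X \<omega> \<le> b"
  shows "\<exists>\<kappa> \<in> T \<rightarrow>\<^sub>M prob_algebra borel. \<forall>C\<in>sets T. \<forall>B\<in>sets borel.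
      (\<integral>\<^sup>+\<theta>\<in>C. emeasure (\<kappa> \<theta>) B \<partial>distr M T \<Theta>) = emeasure M {\<omega> \<in> space M. \<Theta> \<omega> \<in> C \<and> X \<omega> \<in> B}"
proof -
  interpret prob_space M by fact
  define \<nu> where "\<nu> = distr M T \<Theta>"
  interpret \<nu>: prob_space \<nu> unfolding \<nu>_def by (rule prob_space_distr) simp
  have s\<nu>[measurable_cong, simp]: "sets \<nu> = sets T" and sp\<nu>: "space \<nu> = space T" by (simp_all add: \<nu>_def)
  have ab: "a \<le> b" using bnd not_empty by force
  have ex: "\<exists>f \<in> borel_measurable \<nu>. \<forall>C\<in>sets T. (\<integral>\<^sup>+\<theta>\<in>C. f \<theta> \<partial>\<nu>) = emeasure M {\<omega> \<in> space M. \<Theta> \<omega> \<in> C \<and> q < X \<omega>}"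
    for q :: real
  proof -
    define D where "D = density M (indicator {\<omega> \<in> space M. q < X \<omega>})"
    have [measurable_cong]: "sets D = sets M" and spD: "space D = space M" by (simp_all add: D_def)
    have DT: "emeasure (distr D T \<Theta>) C = emeasure M {\<omega> \<in> space M. \<Theta> \<omega> \<in> C \<and> q < X \<omega>}"
      if C[measurable]: "C \<in> sets T" for C
    proof -
      have "emeasure (distr D T \<Theta>) C = emeasure D (\<Theta> -` C \<inter> space M)"
        using spD by (subst emeasure_distr) auto
      also have "\<dots> = emeasure M ({\<omega> \<in> space M. q < X \<omega>} \<inter> (\<Theta> -` C \<inter> space M))"
        unfolding D_def by (rule emeasure_restricted) measurable
      also have "{\<omega> \<in> space M. q < X \<omega>} \<inter> (\<Theta> -` C \<inter> space M) = {\<omega> \<in> space M. \<Theta> \<omega> \<in> C \<and> q < X \<omega>}"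
        by auto
      finally show ?thesis .
    qed
    have "absolutely_continuous \<nu> (distr D T \<Theta>)"
      unfolding absolutely_continuous_def
    proof
      fix C assume "C \<in> null_sets \<nu>"
      then have [measurable]: "C \<in> sets T" and 0: "emeasure M (\<Theta> -` C \<inter> space M) = 0"
        by (auto simp: null_sets_def \<nu>_def emeasure_distr)
      have "emeasure M {\<omega> \<in> space M. \<Theta> \<omega> \<in> C \<and> q < X \<omega>} \<le> emeasure M (\<Theta> -` C \<inter> space M)"
        by (intro emeasure_mono) auto
      then show "C \<in> null_sets (distr D T \<Theta>)"
        using 0 by (intro null_setsI) (simp_all add: DT)
    qed
    from \<nu>.Radon_Nikodym[OF this] obtain f where f: "f \<in> borel_measurable \<nu>" "density \<nu> f = distr D T \<Theta>"
      by auto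
    have "(\<integral>\<^sup>+\<theta>\<in>C. f \<theta> \<partial>\<nu>) = emeasure M {\<omega> \<in> space M. \<Theta> \<omega> \<in> C \<and> q < X \<omega>}" if "C \<in> sets T" for C
      using emeasure_density[OF f(1), of C] that by (simp add: f(2) DT)
    then show ?thesis using f by auto
  qed
  have "\<exists>f. \<forall>q::rat. f q \<in> borel_measurable \<nu> \<and> (\<forall>C\<in>sets T. (\<integral>\<^sup>+\<theta>\<in>C. f q \<theta> \<partial>\<nu>) =
      emeasure M {\<omega> \<in> space M. \<Theta> \<omega> \<in> C \<and> real_of_rat q < X \<omega>})"
    using ex by (intro choice) blast
  then obtain f where fm: "\<And>q::rat. f q \<in> borel_measurable \<nu>"
    and f: "\<And>q C. C \<in> sets T \<Longrightarrow> (\<integral>\<^sup>+\<theta>\<in>C. f q \<theta> \<partial>\<nu>) =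
      emeasure M {\<omega> \<in> space M. \<Theta> \<omega> \<in> C \<and> real_of_rat q < X \<omega>}" by blast
  have fT[measurable]: "f q \<in> borel_measurable T" for q using fm[of q] by simp
  have fin: "(\<integral>\<^sup>+\<theta>. f q \<theta> \<partial>\<nu>) < \<infinity>" for q
    using f[OF sets.top, of q] by (simp add: sp\<nu>[symmetric] nn_set_integral_space less_top[symmetric])
  have "AE \<theta> in \<nu>. f q \<theta> \<le> f p \<theta>" if "p \<le> q" for p q
  proof (rule AE_le_if_set_nn_integral_le[OF fm fm _ fin])
    fix C assume "C \<in> sets \<nu>"
    then have [measurable]: "C \<in> sets T" by simp
    have "real_of_rat p \<le> real_of_rat q" using that by (simp add: of_rat_less_eq)
    then show "(\<integral>\<^sup>+\<theta>\<in>C. f q \<theta> \<partial>\<nu>) \<le> (\<integral>\<^sup>+\<theta>\<in>C. f p \<theta> \<partial>\<nu>)"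
      by (auto simp: f intro!: emeasure_mono)
  qed
  then have mono: "AE \<theta> in \<nu>. \<forall>p q. p \<le> q \<longrightarrow> f q \<theta> \<le> f p \<theta>"
    unfolding AE_all_countable by (intro allI AE_impI)
  have "AE \<theta> in \<nu>. f q \<theta> \<le> 1" for q
  proof (rule AE_le_if_set_nn_integral_le[OF fm _ _ fin])
    fix C assume "C \<in> sets \<nu>"
    then have [measurable]: "C \<in> sets T" by simp
    have "(\<integral>\<^sup>+\<theta>\<in>C. 1 \<partial>\<nu>) = emeasure M (\<Theta> -` C \<inter> space M)"
      by (simp add: \<nu>_def emeasure_distr)
    then show "(\<integral>\<^sup>+\<theta>\<in>C. f q \<theta> \<partial>\<nu>) \<le> (\<integral>\<^sup>+\<theta>\<in>C. 1 \<partial>\<nu>)"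
      by (auto simp: f intro!: emeasure_mono)
  qed simp
  then have le1: "AE \<theta> in \<nu>. \<forall>q. f q \<theta> \<le> 1" by (simp add: AE_all_countable)
  \<comment> \<open>Clamped thresholds keep the supremum in \<open>g\<close> bounded for every
    \<open>\<theta>\<close>, also on the null set where \<open>f\<close> is not monotone or exceeds
    1. The value \<open>a\<close> stands in for thresholds whose tail probability does not exceed
    \<open>u\<close>.\<close>
  define v where "v q = max a (min b (real_of_rat q))" for q
  have v: "a \<le> v q" "v q \<le> b" for q using ab by (auto simp: v_def)
  define g where "g \<theta> u = (SUP q. if ennreal u < f q \<theta> then v q else a)" for \<theta> u
  have bdd: "bdd_above (range (\<lambda>q. if ennreal u < f q \<theta> then v q else a))" for \<theta> u
    using v ab by (intro bdd_aboveI[of _ b]) auto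
  \<comment> \<open>A supremum exceeds \<open>x\<close> iff some term does, so the superlevel sets
    are countable unions over rational thresholds; joint measurability in
    \<open>(\<theta>, u)\<close> follows.\<close>
  have g_less: "x < g \<theta> u \<longleftrightarrow> x < a \<or> (\<exists>q. ennreal u < f q \<theta> \<and> x < v q)" for x \<theta> u
    unfolding g_def less_cSUP_iff[OF UNIV_not_empty bdd] using v(1) by (auto split: if_splits intro: less_le_trans)
  have gm: "(\<lambda>(\<theta>, u). g \<theta> u) \<in> borel_measurable (T \<Otimes>\<^sub>M borel)"
    unfolding borel_measurable_iff_greater split_beta' g_less by measurable
  let ?U = "uniform_measure lborel {0..1::real}"
  have U: "prob_space ?U" by (intro prob_space_uniform_measure) auto
  define \<kappa> where "\<kappa> \<theta> = distr ?U borel (g \<theta>)" for \<theta>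
  have \<kappa>: "\<kappa> \<in> T \<rightarrow>\<^sub>M prob_algebra borel"
    unfolding \<kappa>_def
  proof (rule measurable_distr_prob_space2)
    show "(\<lambda>_. ?U) \<in> T \<rightarrow>\<^sub>M prob_algebra borel"
      using U by (intro measurable_const) (simp add: space_prob_algebra)
  qed (fact gm)
  have g1: "g \<theta> \<in> borel_measurable borel" if "\<theta> \<in> space T" for \<theta>
    using measurable_compose[OF measurable_Pair1'[OF that] gm] by simp
  have \<kappa>_greater: "emeasure (\<kappa> \<theta>) {x<..} = emeasure ?U {u. x < g \<theta> u}" if "\<theta> \<in> space T" for \<theta> x
    using g1[OF that] by (simp add: \<kappa>_def emeasure_distr vimage_def)
  have main: "(\<integral>\<^sup>+\<theta>\<in>C. emeasure (\<kappa> \<theta>) {x<..} \<partial>\<nu>) = emeasure M {\<omega> \<in> space M. \<Theta> \<omega> \<in> C \<and> x < X \<omega>}"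
    if C[measurable]: "C \<in> sets T" for C x
  proof -
    \<comment> \<open>Outside [a, b) both sides are immediate; inside, \<open>x < v q\<close> is
      equivalent to \<open>x < real_of_rat q\<close>, so clamping is harmless.\<close>
    consider "x < a" | "b \<le> x" | "a \<le> x" "x < b" by linarith
    then show ?thesis
    proof cases
      case 1
      interpret U: prob_space ?U by (rule U)
      have "(\<integral>\<^sup>+\<theta>\<in>C. emeasure (\<kappa> \<theta>) {x<..} \<partial>\<nu>) = (\<integral>\<^sup>+\<theta>\<in>C. 1 \<partial>\<nu>)"
        using 1 U.emeasure_space_1 by (intro nn_integral_cong) (simp add: sp\<nu> \<kappa>_greater g_less)
      also have "\<dots> = emeasure M (\<Theta> -` C \<inter> space M)" by (simp add: \<nu>_def emeasure_distr)
      also have "\<Theta> -` C \<inter> space M = {\<omega> \<in> space M. \<Theta> \<omega> \<in> C \<and> x < X \<omega>}"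
        using bnd 1 by force
      finally show ?thesis .
    next
      case 2
      have *: "(\<integral>\<^sup>+\<theta>\<in>C. emeasure (\<kappa> \<theta>) {x<..} \<partial>\<nu>) = (\<integral>\<^sup>+\<theta>. 0 \<partial>\<nu>)"
      proof (intro nn_integral_cong)
        fix \<theta> assume "\<theta> \<in> space \<nu>"
        moreover have "\<not> x < v q" for q using 2 v(2)[of q] by linarith
        then have "{u. x < g \<theta> u} = {}" using 2 ab by (auto simp: g_less)
        ultimately show "emeasure (\<kappa> \<theta>) {x<..} * indicator C \<theta> = 0" by (simp add: sp\<nu> \<kappa>_greater)
      qed
      have "{\<omega> \<in> space M. \<Theta> \<omega> \<in> C \<and> x < X \<omega>} = {}" using bnd 2 by force
      then show ?thesis unfolding * by (simp only: emeasure_empty nn_integral_const mult_zero_left)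
    next
      case 3
      obtain q where q: "decseq q" "\<And>n. x < real_of_rat (q n)" "\<And>y. x < y \<Longrightarrow> \<exists>n. real_of_rat (q n) < y"
        using ex_decseq_rat[of x] by blast
      have "AE \<theta> in \<nu>. emeasure (\<kappa> \<theta>) {x<..} * indicator C \<theta> = (SUP n. f (q n) \<theta> * indicator C \<theta>)"
        using mono le1 AE_space
      proof eventually_elim
        case (elim \<theta>)
        have inc: "incseq (\<lambda>n. {u. ennreal u < f (q n) \<theta>})"
          using q(1) elim(1) by (auto simp: incseq_def decseq_def intro: less_le_trans)
        \<comment> \<open>Monotonicity of \<open>f\<close> in the threshold reduces all rationals
          above \<open>x\<close> to the sequence \<open>q n\<close>, which gives an increasing
          union.\<close>
        have "{u. x < g \<theta> u} = (\<Union>n. {u. ennreal u < f (q n) \<theta>})"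
        proof (intro set_eqI iffI)
          fix u assume "u \<in> {u. x < g \<theta> u}"
          then obtain p where p: "ennreal u < f p \<theta>" "x < v p" using 3 by (auto simp: g_less)
          then have "x < real_of_rat p" using 3 by (auto simp: v_def max_def min_def split: if_splits)
          then obtain n where "real_of_rat (q n) < real_of_rat p" using q(3) by blast
          then have "f p \<theta> \<le> f (q n) \<theta>" using elim(1) by (simp add: of_rat_less)
          then show "u \<in> (\<Union>n. {u. ennreal u < f (q n) \<theta>})" using p(1) by (auto intro: less_le_trans)
        next
          fix u assume "u \<in> (\<Union>n. {u. ennreal u < f (q n) \<theta>})"
          then obtain n where "ennreal u < f (q n) \<theta>" by auto
          moreover have "x < v (q n)" using q(2)[of n] 3 by (auto simp: v_def)
          ultimately show "u \<in> {u. x < g \<theta> u}" by (auto simp: g_less)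
        qed
        then have "emeasure (\<kappa> \<theta>) {x<..} = (SUP n. emeasure ?U {u. ennreal u < f (q n) \<theta>})"
          using elim(3) SUP_emeasure_incseq[OF _ inc, of ?U] by (simp add: \<kappa>_greater sp\<nu> image_subset_iff)
        also have "\<dots> = (SUP n. f (q n) \<theta>)"
          using elim(2) by (intro SUP_cong refl emeasure_unit_interval_less) auto
        finally show ?case by (cases "\<theta> \<in> C") auto
      qed
      then have "(\<integral>\<^sup>+\<theta>\<in>C. emeasure (\<kappa> \<theta>) {x<..} \<partial>\<nu>) = (\<integral>\<^sup>+\<theta>. (SUP n. f (q n) \<theta> * indicator C \<theta>) \<partial>\<nu>)"
        by (rule nn_integral_cong_AE)
      also have "\<dots> = (SUP n. \<integral>\<^sup>+\<theta>\<in>C. f (q n) \<theta> \<partial>\<nu>)"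
      proof (rule nn_integral_monotone_convergence_SUP_AE)
        fix n
        show "AE \<theta> in \<nu>. f (q n) \<theta> * indicator C \<theta> \<le> f (q (Suc n)) \<theta> * indicator C \<theta>"
          using mono by eventually_elim (use q(1) in \<open>auto simp: decseq_Suc_iff intro!: mult_right_mono\<close>)
      qed measurable
      also have "\<dots> = (SUP n. emeasure M {\<omega> \<in> space M. \<Theta> \<omega> \<in> C \<and> real_of_rat (q n) < X \<omega>})"
        by (simp add: f)
      also have "\<dots> = emeasure M (\<Union>n. {\<omega> \<in> space M. \<Theta> \<omega> \<in> C \<and> real_of_rat (q n) < X \<omega>})"
      proof (rule SUP_emeasure_incseq)
        have "real_of_rat (q n) \<le> real_of_rat (q m)" if "m \<le> n" for m n
          using q(1) that by (simp add: decseq_def of_rat_less_eq)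
        then show "incseq (\<lambda>n. {\<omega> \<in> space M. \<Theta> \<omega> \<in> C \<and> real_of_rat (q n) < X \<omega>})"
          by (auto simp: incseq_def intro: le_less_trans)
      qed auto
      also have "(\<Union>n. {\<omega> \<in> space M. \<Theta> \<omega> \<in> C \<and> real_of_rat (q n) < X \<omega>}) = {\<omega> \<in> space M. \<Theta> \<omega> \<in> C \<and> x < X \<omega>}"
        using q(2,3) by (auto intro: less_trans)
      finally show ?thesis .
    qed
  qed
  have "(\<integral>\<^sup>+\<theta>\<in>C. emeasure (\<kappa> \<theta>) B \<partial>\<nu>) = emeasure M {\<omega> \<in> space M. \<Theta> \<omega> \<in> C \<and> X \<omega> \<in> B}"
    if C[measurable]: "C \<in> sets T" and B[measurable]: "B \<in> sets borel" for C B
  proof -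
    \<comment> \<open>With the restriction to \<open>C\<close> absorbed, both sides become finite
      measures in \<open>B\<close>, and half lines determine them.\<close>
    define \<mu>1 where "\<mu>1 = density \<nu> (indicator C) \<bind> \<kappa>"
    define \<mu>2 where "\<mu>2 = distr (density M (indicator {\<omega> \<in> space M. \<Theta> \<omega> \<in> C})) borel X"
    have \<kappa>': "\<kappa> \<in> density \<nu> (indicator C) \<rightarrow>\<^sub>M subprob_algebra borel"
      using measurable_prob_algebraD[OF \<kappa>]
      by (subst measurable_cong_sets[of _ T _ "subprob_algebra borel"]) (simp_all only: sets_density s\<nu>)
    have \<mu>1: "emeasure \<mu>1 A = (\<integral>\<^sup>+\<theta>\<in>C. emeasure (\<kappa> \<theta>) A \<partial>\<nu>)" if [measurable]: "A \<in> sets borel" for A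
    proof -
      have [measurable]: "(\<lambda>\<theta>. emeasure (\<kappa> \<theta>) A) \<in> borel_measurable T"
        using measurable_emeasure_kernel[OF measurable_prob_algebraD[OF \<kappa>] that] .
      have "emeasure \<mu>1 A = (\<integral>\<^sup>+\<theta>. emeasure (\<kappa> \<theta>) A \<partial>density \<nu> (indicator C))"
        unfolding \<mu>1_def using \<nu>.not_empty by (intro emeasure_bind[OF _ \<kappa>' that]) simp
      also have "\<dots> = (\<integral>\<^sup>+\<theta>\<in>C. emeasure (\<kappa> \<theta>) A \<partial>\<nu>)"
        by (subst nn_integral_density) (auto simp: mult.commute)
      finally show ?thesis .
    qed
    have \<mu>2: "emeasure \<mu>2 A = emeasure M {\<omega> \<in> space M. \<Theta> \<omega> \<in> C \<and> X \<omega> \<in> A}" if [measurable]: "A \<in> sets borel" for A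
    proof -
      have "emeasure \<mu>2 A = emeasure (density M (indicator {\<omega> \<in> space M. \<Theta> \<omega> \<in> C})) (X -` A \<inter> space M)"
        unfolding \<mu>2_def by (subst emeasure_distr) auto
      also have "\<dots> = emeasure M ({\<omega> \<in> space M. \<Theta> \<omega> \<in> C} \<inter> (X -` A \<inter> space M))"
        by (rule emeasure_restricted) measurable
      also have "{\<omega> \<in> space M. \<Theta> \<omega> \<in> C} \<inter> (X -` A \<inter> space M) = {\<omega> \<in> space M. \<Theta> \<omega> \<in> C \<and> X \<omega> \<in> A}"
        by auto
      finally show ?thesis .
    qed
    have "\<mu>1 = \<mu>2"
    proof (rule measure_eqI_lessThan)
      show "sets \<mu>1 = sets borel"
        unfolding \<mu>1_def by (rule sets_bind) (use sets_kernel[OF \<kappa>'] \<nu>.not_empty in auto)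
      show "sets \<mu>2 = sets borel" by (simp add: \<mu>2_def)
      show "emeasure \<mu>1 {x<..} < \<infinity>" for x
        by (subst \<mu>1) (auto simp: main less_top[symmetric])
      show "emeasure \<mu>1 {x<..} = emeasure \<mu>2 {x<..}" for x
        by (subst \<mu>1, simp, subst \<mu>2, simp, subst main) auto
    qed
    then show ?thesis using \<mu>1[OF B] \<mu>2[OF B] by simp
  qed
  then show ?thesis using \<kappa> unfolding \<nu>_def by blast
qed

text \<open>Reduction to the bounded case by \<open>arctan\<close>. Pushing the kernel forward along
  \<open>tan\<close> undoes it because \<open>tan (arctan x) = x\<close> for every real
  \<open>x\<close>, whatever value \<open>tan\<close> has at its poles.\<close>

lemma ex_conditional_distribution:
  fixes X :: "'a \<Rightarrow> real"
  assumes M: "prob_space M" and \<Theta>: "\<Theta> \<in> M \<rightarrow>\<^sub>M T" and X[measurable]: "X \<in> borel_measurable M"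
  shows "\<exists>\<kappa> \<in> T \<rightarrow>\<^sub>M prob_algebra borel. \<forall>C\<in>sets T. \<forall>B\<in>sets borel.
      (\<integral>\<^sup>+\<theta>\<in>C. emeasure (\<kappa> \<theta>) B \<partial>distr M T \<Theta>) = emeasure M {\<omega> \<in> space M. \<Theta> \<omega> \<in> C \<and> X \<omega> \<in> B}"
proof -
  have X': "(\<lambda>\<omega>. arctan (X \<omega>)) \<in> borel_measurable M" by measurable
  have bnd: "- (pi / 2) \<le> arctan (X \<omega>) \<and> arctan (X \<omega>) \<le> pi / 2" for \<omega>
    using arctan_lbound[of "X \<omega>"] arctan_ubound[of "X \<omega>"] by simp
  obtain \<kappa> where \<kappa>: "\<kappa> \<in> T \<rightarrow>\<^sub>M prob_algebra borel"
    and eq: "\<And>C B. C \<in> sets T \<Longrightarrow> B \<in> sets borel \<Longrightarrow>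
      (\<integral>\<^sup>+\<theta>\<in>C. emeasure (\<kappa> \<theta>) B \<partial>distr M T \<Theta>) = emeasure M {\<omega> \<in> space M. \<Theta> \<omega> \<in> C \<and> arctan (X \<omega>) \<in> B}"
    using ex_conditional_distribution_bounded[OF M \<Theta> X' bnd] by blast
  have tan[measurable]: "(tan :: real \<Rightarrow> real) \<in> borel_measurable borel" 
    by (subst tan_def[abs_def]) (intro borel_measurable_divide borel_measurable_sin borel_measurable_cos measurable_ident)
  show ?thesis
  proof (intro bexI ballI)
    show "(\<lambda>\<theta>. distr (\<kappa> \<theta>) borel tan) \<in> T \<rightarrow>\<^sub>M prob_algebra borel"
      using measurable_compose[OF \<kappa> measurable_distr_prob_space[OF tan]] .
    fix C B assume C: "C \<in> sets T" and B[measurable]: "B \<in> sets (borel :: real measure)"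
    have "emeasure (distr (\<kappa> \<theta>) borel tan) B = emeasure (\<kappa> \<theta>) (tan -` B)" if "\<theta> \<in> space T" for \<theta>
    proof -
      have s: "sets (\<kappa> \<theta>) = sets borel" using measurable_space[OF \<kappa> that] by (simp add: space_prob_algebra)
      have "tan \<in> \<kappa> \<theta> \<rightarrow>\<^sub>M borel" using tan by (simp only: measurable_cong_sets[OF s refl])
      then show ?thesis using sets_eq_imp_space_eq[OF s] by (simp add: emeasure_distr)
    qed
    then have "(\<integral>\<^sup>+\<theta>\<in>C. emeasure (distr (\<kappa> \<theta>) borel tan) B \<partial>distr M T \<Theta>) =
        (\<integral>\<^sup>+\<theta>\<in>C. emeasure (\<kappa> \<theta>) (tan -` B) \<partial>distr M T \<Theta>)"
      by (intro nn_integral_cong) simp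
    also have "\<dots> = emeasure M {\<omega> \<in> space M. \<Theta> \<omega> \<in> C \<and> X \<omega> \<in> B}"
      using measurable_sets[OF tan B] by (subst eq[OF C]) (simp_all add: tan_arctan)
    finally show "(\<integral>\<^sup>+\<theta>\<in>C. emeasure (distr (\<kappa> \<theta>) borel tan) B \<partial>distr M T \<Theta>) =
        emeasure M {\<omega> \<in> space M. \<Theta> \<omega> \<in> C \<and> X \<omega> \<in> B}" .
  qed
qed

subsection \<open>Limiting frequencies of exchangeable sequences\<close>

locale exchangeable_seq = prob_space M for M :: "'a measure" +
  fixes X :: "nat \<Rightarrow> 'a \<Rightarrow> real"
  assumes X [measurable]: "\<And>n. X n \<in> borel_measurable M"
    and exch: "exchangeable M X {1..}"
begin

text \<open>Exchangeability in terms of a finite index set and an injective relabelling, the form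
  used from here on. An enumeration of \<open>J\<close> leads back to the definition; the empty set
  is the case that \<open>r \<ge> 1\<close> leaves out.\<close>

lemma prob_reindex:
  assumes J: "finite J" "J \<subseteq> {1..}" and h: "inj_on h J" "h ` J \<subseteq> {1..}"
    and B: "\<And>j. j \<in> J \<Longrightarrow> B j \<in> sets borel"
  shows "prob {\<omega> \<in> space M. \<forall>j\<in>J. X (h j) \<omega> \<in> B j} = prob {\<omega> \<in> space M. \<forall>j\<in>J. X j \<omega> \<in> B j}"
proof (cases "J = {}")
  case False
  then have r: "1 \<le> card J" using J by (simp add: Suc_leI card_gt_0_iff)
  obtain e where e: "bij_betw e {1..card J} J" using ex_bij_betw_nat_finite_1[OF J(1)] by auto
  then have eJ: "e ` {1..card J} = J" and inj: "inj_on e {1..card J}" by (auto simp: bij_betw_def)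
  have "inj_on (h \<circ> e) {1..card J}" using h(1) eJ inj by (simp add: comp_inj_on)
  moreover have "(h \<circ> e) ` {1..card J} \<subseteq> {1..}" using h(2) eJ by (auto simp: image_comp[symmetric])
  ultimately have "measure M (\<Inter>k\<in>{1..card J}. X ((h \<circ> e) k) -` B (e k) \<inter> space M) =
        measure M (\<Inter>k\<in>{1..card J}. X (e k) -` B (e k) \<inter> space M)"
    using exch[unfolded exchangeable_def, rule_format, OF r, of "h \<circ> e" e "\<lambda>k. B (e k)"] eJ inj J(2) B
    by blast
  moreover have "(\<Inter>k\<in>{1..card J}. X (g (e k)) -` B (e k) \<inter> space M) =
      {\<omega> \<in> space M. \<forall>j\<in>J. X (g j) \<omega> \<in> B j}" for g :: "nat \<Rightarrow> nat"
    using r by (subst (2) eJ[symmetric]) auto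
  from this[of h] this[of "\<lambda>x. x"] show ?thesis using calculation by (simp add: comp_def)
qed simp

text \<open>Being in \<open>sets (future n)\<close> for all \<open>n\<close> means being a tail
  event. The pullback form presents each such event as a preimage from the space of sequences
  indexed beyond \<open>n\<close>, where measures can be compared on cylinders.\<close>

definition future :: "nat \<Rightarrow> 'a measure" where
  "future n = vimage_algebra (space M) (\<lambda>\<omega>. \<lambda>k\<in>{n<..}. X k \<omega>) (Pi\<^sub>M {n<..} (\<lambda>_. borel))"

lemma space_future [simp]: "space (future n) = space M"
  by (simp add: future_def)

lemma measurable_future: "n < k \<Longrightarrow> X k \<in> borel_measurable (future n)"
proof -
  assume k: "n < k"
  have "(\<lambda>\<omega>. \<lambda>k\<in>{n<..}. X k \<omega>) \<in> future n \<rightarrow>\<^sub>M Pi\<^sub>M {n<..} (\<lambda>_. borel)"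
    unfolding future_def by (rule measurable_vimage_algebra1) (auto simp: space_PiM)
  from measurable_compose[OF this measurable_component_singleton[of k]] k show ?thesis by simp
qed

text \<open>A relabelling of finitely many indices does not touch the terms beyond some
  \<open>n\<close>, and \<open>A\<close> is an event about those terms. For cylinders in place of
  \<open>A\<close> this is \<open>prob_reindex\<close> on the joint index set; uniqueness of finite
  measures on the coordinates beyond \<open>n\<close> extends it to \<open>A\<close>.\<close>

lemma future_reindex:
  assumes A: "\<And>n. A \<in> sets (future n)"
    and J: "finite J" "J \<subseteq> {1..}" and h: "inj_on h J" "h ` J \<subseteq> {1..}"
    and B: "\<And>j. j \<in> J \<Longrightarrow> B j \<in> sets borel"
  shows "prob {\<omega> \<in> A. \<forall>j\<in>J. X (h j) \<omega> \<in> B j} = prob {\<omega> \<in> A. \<forall>j\<in>J. X j \<omega> \<in> B j}"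
proof -
  obtain n where n: "J \<union> h ` J \<subseteq> {..n}"
    using J(1) finite_nat_iff_bounded_le[of "J \<union> h ` J"] by auto
  let ?Y = "\<lambda>\<omega>. \<lambda>k\<in>{n<..}. X k \<omega>" and ?P = "Pi\<^sub>M {n<..} (\<lambda>_. borel) :: (nat \<Rightarrow> real) measure"
  let ?E = "\<lambda>h. {\<omega> \<in> space M. \<forall>j\<in>J. X (h j) \<omega> \<in> B j}"
  have E [measurable]: "?E g \<in> sets M" for g :: "nat \<Rightarrow> nat"
    using J(1) B by (intro sets.sets_Collect_finite_All) auto
  have Y [measurable]: "?Y \<in> M \<rightarrow>\<^sub>M ?P" by (intro measurable_restrict X)
  obtain H where H: "H \<in> sets ?P" "A = ?Y -` H \<inter> space M"
    using A[of n] by (auto simp: future_def sets_vimage_algebra2 space_PiM)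
  define \<mu> where "\<mu> g = distr (density M (indicator (?E g))) ?P ?Y" for g :: "nat \<Rightarrow> nat"
  have \<mu>: "emeasure (\<mu> g) S = emeasure M (?E g \<inter> (?Y -` S \<inter> space M))" if S: "S \<in> sets ?P" for S g
  proof -
    have "emeasure (\<mu> g) S = emeasure (density M (indicator (?E g))) (?Y -` S \<inter> space M)"
      unfolding \<mu>_def using S Y by (subst emeasure_distr) (simp_all cong: measurable_cong_sets)
    also have "\<dots> = emeasure M (?E g \<inter> (?Y -` S \<inter> space M))"
      by (rule emeasure_restricted[OF E]) (rule measurable_sets[OF Y S])
    finally show ?thesis .
  qed
  have "\<mu> h = \<mu> (\<lambda>x. x)"
  proof (rule measure_eqI_PiM_infinite)
    show "sets (\<mu> h) = sets ?P" "sets (\<mu> (\<lambda>x. x)) = sets ?P" by (simp_all add: \<mu>_def)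
    show "finite_measure (\<mu> h)"
      by (rule finite_measureI) (simp add: \<mu>[OF sets.top[of ?P]] \<mu>_def[THEN arg_cong[where f=space]])
    fix C K assume K: "finite K" "K \<subseteq> {n<..}" and C: "\<And>i. i \<in> K \<Longrightarrow> C i \<in> sets (borel :: real measure)"
    let ?S = "prod_emb {n<..} (\<lambda>_. borel) K (Pi\<^sub>E K C)"
    have S: "?S \<in> sets ?P" using K C by (intro sets_PiM_I) auto
    have vim: "?Y -` ?S \<inter> space M = {\<omega> \<in> space M. \<forall>k\<in>K. X k \<omega> \<in> C k}"
      using K(2) by (auto simp: prod_emb_def space_PiM PiE_iff restrict_def extensional_def; force)
    have disj: "J \<inter> K = {}" "h ` J \<inter> K = {}" using n K(2) by force+
    \<comment> \<open>The indices in \<open>K\<close> exceed those in \<open>J\<close> and in its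
      image, so \<open>h\<close> extended by the identity stays injective.\<close>
    let ?D = "\<lambda>j. if j \<in> J then B j else C j" and ?h = "\<lambda>j. if j \<in> J then h j else j"
    have eq: "?E g \<inter> (?Y -` ?S \<inter> space M) = {\<omega> \<in> space M. \<forall>j\<in>J \<union> K. X (if j \<in> J then g j else j) \<omega> \<in> ?D j}" for g
      unfolding vim using disj by (auto split: if_splits)
    have "prob {\<omega> \<in> space M. \<forall>j\<in>J \<union> K. X (?h j) \<omega> \<in> ?D j} = prob {\<omega> \<in> space M. \<forall>j\<in>J \<union> K. X j \<omega> \<in> ?D j}"
    proof (rule prob_reindex)
      show "inj_on ?h (J \<union> K)" using h(1) disj by (auto simp: inj_on_def) 
      show "?h ` (J \<union> K) \<subseteq> {1..}" using h(2) K(2) by (auto split: if_splits)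
    qed (use J K B C in auto)
    then show "emeasure (\<mu> h) ?S = emeasure (\<mu> (\<lambda>x. x)) ?S"
      unfolding \<mu>[OF S] eq by (simp add: emeasure_eq_measure)
  qed
  then have "emeasure M (?E h \<inter> A) = emeasure M (?E (\<lambda>x. x) \<inter> A)"
    using \<mu>[OF H(1), of h] \<mu>[OF H(1), of "\<lambda>x. x"] by (simp only: H(2))
  moreover have "?E g \<inter> A = {\<omega> \<in> A. \<forall>j\<in>J. X (g j) \<omega> \<in> B j}" for g using H(2) by auto
  ultimately show ?thesis by (simp add: emeasure_eq_measure)
qed

section \<open>Averages along powers of four and their limits\<close>

definition avg :: "real set \<Rightarrow> nat \<Rightarrow> 'a \<Rightarrow> real" where
  "avg B n \<omega> = (\<Sum>k\<in>{1..n}. indicator B (X k \<omega>)) / real n"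

lemma avg_bounds: "0 \<le> avg B n \<omega>" "avg B n \<omega> \<le> 1"
proof -
  show "0 \<le> avg B n \<omega>" by (auto simp: avg_def intro!: divide_nonneg_nonneg sum_nonneg)
  have "(\<Sum>k\<in>{1..n}. indicator B (X k \<omega>)) \<le> (\<Sum>k\<in>{1..n}. 1 :: real)"
    by (intro sum_mono) (auto simp: indicator_def)
  then show "avg B n \<omega> \<le> 1" by (auto simp: avg_def divide_simps)
qed

lemma measurable_avg [measurable]:
  assumes [measurable]: "B \<in> sets borel"
  shows "avg B n \<in> borel_measurable M"
  unfolding avg_def[abs_def] by measurable

text \<open>Each of the \<open>m * n\<close> pairs of indices contributes \<open>p2\<close>; the
  \<open>m\<close> pairs on the diagonal contribute \<open>p1 - p2\<close> more, and
  \<open>m / (m * n) = 1 / n\<close>.\<close>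

lemma expectation_avg_mult:
  assumes [measurable]: "B \<in> sets borel" and mn: "1 \<le> m" "m \<le> n"
  defines "p1 \<equiv> prob {\<omega> \<in> space M. X 1 \<omega> \<in> B}" and "p2 \<equiv> prob {\<omega> \<in> space M. X 1 \<omega> \<in> B \<and> X 2 \<omega> \<in> B}"
  shows "expectation (\<lambda>\<omega>. avg B m \<omega> * avg B n \<omega>) = p2 + (p1 - p2) / real n"
proof -
  have pair: "expectation (\<lambda>\<omega>. indicator B (X k \<omega>) * indicator B (X l \<omega>)) = p2 + (if k = l then p1 - p2 else 0)"
    if "1 \<le> k" "1 \<le> l" for k l
  proof -
    have "expectation (\<lambda>\<omega>. indicator B (X k \<omega>) * indicator B (X l \<omega>) :: real) =
        expectation (indicator {\<omega> \<in> space M. X k \<omega> \<in> B \<and> X l \<omega> \<in> B})"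
      by (intro Bochner_Integration.integral_cong) (auto simp: indicator_def)
    also have "\<dots> = prob {\<omega> \<in> space M. X k \<omega> \<in> B \<and> X l \<omega> \<in> B}" by simp
    also have "\<dots> = p2 + (if k = l then p1 - p2 else 0)"
    proof (cases "k = l")
      case True
      then show ?thesis
        using prob_reindex[of "{1}" "\<lambda>_. k" "\<lambda>_. B"] that by (simp add: p1_def)
    next
      case False
      then show ?thesis
        using prob_reindex[of "{1, 2}" "\<lambda>j. if j = 1 then k else l" "\<lambda>_. B"] that
        by (simp add: p2_def)
    qed
    finally show ?thesis .
  qed
  have "expectation (\<lambda>\<omega>. avg B m \<omega> * avg B n \<omega>) =
      expectation (\<lambda>\<omega>. (\<Sum>k\<in>{1..m}. \<Sum>l\<in>{1..n}. indicator B (X k \<omega>) * indicator B (X l \<omega>)) / (real m * real n))"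
    by (simp add: avg_def sum_product)
  also have "\<dots> = (\<Sum>k\<in>{1..m}. \<Sum>l\<in>{1..n}. expectation (\<lambda>\<omega>. indicator B (X k \<omega>) * indicator B (X l \<omega>))) / (real m * real n)"
  proof -
    have i: "integrable M (\<lambda>\<omega>. indicator B (X k \<omega>) * indicator B (X l \<omega>) :: real)" for k l
      by (rule integrable_const_bound[where B=1]) (auto simp: indicator_def)
    show ?thesis
      by (simp only: integral_divide_zero) (simp only: Bochner_Integration.integral_sum Bochner_Integration.integrable_sum i)
  qed
  also have "(\<Sum>k\<in>{1..m}. \<Sum>l\<in>{1..n}. expectation (\<lambda>\<omega>. indicator B (X k \<omega>) * indicator B (X l \<omega>))) =
      (\<Sum>k\<in>{1..m}. \<Sum>l\<in>{1..n}. p2 + (if k = l then p1 - p2 else 0))"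
    by (intro sum.cong refl pair) auto
  also have "\<dots> = (\<Sum>k\<in>{1..m}. real n * p2 + (p1 - p2))"
    using mn by (intro sum.cong refl) (simp add: sum.distrib)
  also have "\<dots> / (real m * real n) = p2 + (p1 - p2) / real n"
    using mn by (simp add: field_simps)
  finally show ?thesis .
qed

text \<open>The second moment of the difference is
  \<open>(p1 - p2) * (1 / 4 ^ k - 1 / 4 ^ Suc k)\<close>, at most \<open>1 / 4 ^ k\<close>, and the
  first moment is bounded by its root.\<close>

lemma expectation_avg_diff:
  assumes B[measurable]: "B \<in> sets borel"
  shows "expectation (\<lambda>\<omega>. \<bar>avg B (4 ^ k) \<omega> - avg B (4 ^ Suc k) \<omega>\<bar>) \<le> (1 / 2) ^ k"
proof -
  define p1 p2 where "p1 = prob {\<omega> \<in> space M. X 1 \<omega> \<in> B}"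
    and "p2 = prob {\<omega> \<in> space M. X 1 \<omega> \<in> B \<and> X 2 \<omega> \<in> B}"
  have p: "p1 - p2 \<le> 1" using prob_le_1 measure_nonneg unfolding p1_def p2_def by (smt (verit))
  have p': "0 \<le> p1 - p2" unfolding p1_def p2_def by (auto intro!: finite_measure_mono)
  let ?d = "\<lambda>\<omega>. avg B (4 ^ k) \<omega> - avg B (4 ^ Suc k) \<omega>"
  have i: "integrable M (\<lambda>\<omega>. avg B m \<omega> * avg B n \<omega>)" for m n
    using mult_le_one[OF avg_bounds(2) avg_bounds(1,2)]
    by (intro integrable_const_bound[where B=1]) (auto simp: avg_bounds abs_mult)
  have "expectation (\<lambda>\<omega>. (?d \<omega>)\<^sup>2) = expectation (\<lambda>\<omega>. avg B (4 ^ k) \<omega> * avg B (4 ^ k) \<omega>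
      - 2 * (avg B (4 ^ k) \<omega> * avg B (4 ^ Suc k) \<omega>) + avg B (4 ^ Suc k) \<omega> * avg B (4 ^ Suc k) \<omega>)"
    by (intro Bochner_Integration.integral_cong) (auto simp: power2_eq_square algebra_simps)
  also have "\<dots> = (p2 + (p1 - p2) / 4 ^ k) - 2 * (p2 + (p1 - p2) / 4 ^ Suc k) + (p2 + (p1 - p2) / 4 ^ Suc k)"
    using expectation_avg_mult[OF B, of "4 ^ k" "4 ^ k"] expectation_avg_mult[OF B, of "4 ^ k" "4 ^ Suc k"]
      expectation_avg_mult[OF B, of "4 ^ Suc k" "4 ^ Suc k"] i
    by (simp add: p1_def p2_def)
  also have "\<dots> = (p1 - p2) / 4 ^ k - (p1 - p2) / 4 ^ Suc k" by (simp add: field_simps)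
  also have "\<dots> \<le> (p1 - p2) / 4 ^ k"
    using divide_nonneg_pos[OF p', of "4 ^ Suc k"] zero_less_power[of "4 :: real" "Suc k"] by linarith
  also have "\<dots> \<le> 1 / 4 ^ k" using p by (intro divide_right_mono) auto
  finally have sq: "expectation (\<lambda>\<omega>. (?d \<omega>)\<^sup>2) \<le> 1 / 4 ^ k" .
  have d1: "\<bar>?d \<omega>\<bar> \<le> 1" for \<omega> using avg_bounds[of B "4 ^ k" \<omega>] avg_bounds[of B "4 ^ Suc k" \<omega>] by linarith
  have isq: "integrable M (\<lambda>\<omega>. (?d \<omega>)\<^sup>2)"
    using d1 by (intro integrable_const_bound[where B=1]) (auto simp: abs_square_le_1)
  \<comment> \<open>A completed square does the work of the Cauchy-Schwarz inequality; the weight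
    \<open>2 ^ k\<close> balances both terms when the second moment is at most
    \<open>1 / 4 ^ k\<close>.\<close>
  have "\<bar>?d \<omega>\<bar> \<le> (2 ^ k * (?d \<omega>)\<^sup>2 + 1 / 2 ^ k) / 2" for \<omega>
  proof -
    have "0 \<le> (2 ^ k * \<bar>?d \<omega>\<bar> - 1)\<^sup>2 / 2 ^ k" by simp
    also have "\<dots> = 2 ^ k * (?d \<omega>)\<^sup>2 + 1 / 2 ^ k - 2 * \<bar>?d \<omega>\<bar>"
    proof -
      have *: "(c * \<bar>x\<bar> - 1)\<^sup>2 / c = c * x\<^sup>2 + 1 / c - 2 * \<bar>x\<bar>" if "c > 0" for c x :: real
        using that by (simp add: power2_eq_square field_simps)
      show ?thesis by (rule *) simp
    qed
    finally show ?thesis by simp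
  qed
  then have "expectation (\<lambda>\<omega>. \<bar>?d \<omega>\<bar>) \<le> expectation (\<lambda>\<omega>. (2 ^ k * (?d \<omega>)\<^sup>2 + 1 / 2 ^ k) / 2)"
    using d1 isq by (intro integral_mono integrable_const_bound[of "\<lambda>\<omega>. \<bar>?d \<omega>\<bar>" 1]) auto
  also have "\<dots> = (2 ^ k * expectation (\<lambda>\<omega>. (?d \<omega>)\<^sup>2) + 1 / 2 ^ k) / 2"
    using isq by (simp add: prob_space)
  also have "\<dots> \<le> (2 ^ k * (1 / 4 ^ k) + 1 / 2 ^ k) / 2"
    using sq by (intro divide_right_mono add_right_mono mult_left_mono) auto
  also have "2 ^ k * (1 / 4 ^ k) = (1 / 2 ^ k :: real)"
  proof -
    have "(4 :: real) ^ k = 2 ^ k * 2 ^ k" by (simp flip: power_mult_distrib)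
    then show ?thesis by simp
  qed
  finally show ?thesis by (simp add: power_divide)
qed

text \<open>Clamping forces values in [0, 1] at every \<open>\<omega>\<close>, also where the
  averages diverge, so products of frequencies are bounded without exceptional sets. Where the
  averages converge it changes nothing.\<close>

definition freq :: "real set \<Rightarrow> 'a \<Rightarrow> real" where
  "freq B \<omega> = max 0 (min 1 (lim (\<lambda>k. avg B (4 ^ k) \<omega>)))"

lemma freq_bounds: "0 \<le> freq B \<omega>" "freq B \<omega> \<le> 1"
  by (auto simp: freq_def)

text \<open>The expected sum of the absolute increments is dominated by a geometric series, so the
  sum is finite almost everywhere; telescoping then gives convergence.\<close>

lemma AE_avg_tendsto_freq:
  assumes [measurable]: "B \<in> sets borel"
  shows "AE \<omega> in M. (\<lambda>k. avg B (4 ^ k) \<omega>) \<longlonglongrightarrow> freq B \<omega>"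
proof -
  let ?d = "\<lambda>k \<omega>. \<bar>avg B (4 ^ k) \<omega> - avg B (4 ^ Suc k) \<omega>\<bar>"
  have d1: "?d k \<omega> \<le> 1" for k \<omega> using avg_bounds[of B "4 ^ k" \<omega>] avg_bounds[of B "4 ^ Suc k" \<omega>] by linarith
  have i: "integrable M (?d k)" for k using d1 by (intro integrable_const_bound[where B=1]) auto
  have "(\<integral>\<^sup>+\<omega>. (\<Sum>k. ennreal (?d k \<omega>)) \<partial>M) = (\<Sum>k. \<integral>\<^sup>+\<omega>. ennreal (?d k \<omega>) \<partial>M)"
    by (rule nn_integral_suminf) measurable
  also have "\<dots> = (\<Sum>k. ennreal (expectation (?d k)))"
    by (intro suminf_cong nn_integral_eq_integral i) simp
  also have "\<dots> \<le> (\<Sum>k. ennreal ((1 / 2) ^ k))"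
    by (intro suminf_le summableI ennreal_leI expectation_avg_diff) fact
  also have "\<dots> < top"
    by (subst suminf_ennreal2) (auto intro: summable_geometric)
  finally have "AE \<omega> in M. (\<Sum>k. ennreal (?d k \<omega>)) \<noteq> \<infinity>"
    by (intro nn_integral_PInf_AE) auto
  then show ?thesis
  proof eventually_elim
    case (elim \<omega>)
    have "summable (\<lambda>k. ?d k \<omega>)" using elim by (intro summable_suminf_not_top) auto
    then have "summable (\<lambda>k. avg B (4 ^ k) \<omega> - avg B (4 ^ Suc k) \<omega>)" by (rule summable_rabs_cancel)
    then have "convergent (\<lambda>n. \<Sum>k<n. avg B (4 ^ k) \<omega> - avg B (4 ^ Suc k) \<omega>)"
      by (simp add: summable_iff_convergent)
    then have "convergent (\<lambda>n. avg B (4 ^ 0) \<omega> - avg B (4 ^ n) \<omega>)"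
      using sum_lessThan_telescope'[of "\<lambda>k. avg B (4 ^ k) \<omega>"] by simp
    from convergent_diff[OF convergent_const[of "avg B (4 ^ 0) \<omega>"] this]
    have lim: "(\<lambda>k. avg B (4 ^ k) \<omega>) \<longlonglongrightarrow> lim (\<lambda>k. avg B (4 ^ k) \<omega>)"
      by (simp add: convergent_LIMSEQ_iff)
    have "0 \<le> lim (\<lambda>k. avg B (4 ^ k) \<omega>)" "lim (\<lambda>k. avg B (4 ^ k) \<omega>) \<le> 1"
      using LIMSEQ_le_const[OF lim] LIMSEQ_le_const2[OF lim] avg_bounds by auto
    then show ?case using lim by (simp add: freq_def)
  qed
qed

text \<open>Changing finitely many terms of the sequence does not affect \<open>freq\<close>; this holds for every
  \<open>\<omega>\<close>, as \<open>lim\<close> is the same arbitrary value for all divergent sequences.\<close>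

lemma measurable_freq_future:
  assumes [measurable]: "B \<in> sets borel"
  shows "freq B \<in> borel_measurable (future n)"
proof -
  \<comment> \<open>The terms up to \<open>n\<close> are dropped while the denominator stays
    \<open>4 ^ k\<close>, so the error is at most \<open>n / 4 ^ k\<close>.\<close>
  define Y where "Y k \<omega> = (\<Sum>j\<in>{n<..4 ^ k}. indicator B (X j \<omega>)) / real (4 ^ k)" for k \<omega>
  have "lim (\<lambda>k. avg B (4 ^ k) \<omega>) = lim (\<lambda>k. Y k \<omega>)" for \<omega>
  proof -
    have bound: "\<bar>avg B (4 ^ k) \<omega> - Y k \<omega>\<bar> \<le> real n * (1 / 4) ^ k" for k
    proof -
      have "(\<Sum>j\<in>{1..4 ^ k}. indicator B (X j \<omega>)) =
          (\<Sum>j\<in>{n<..4 ^ k}. indicator B (X j \<omega>)) + (\<Sum>j\<in>{1..4 ^ k} \<inter> {..n}. indicator B (X j \<omega>) :: real)"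
        by (subst sum.union_disjoint[symmetric]) (auto intro!: sum.cong)
      then have "avg B (4 ^ k) \<omega> - Y k \<omega> = (\<Sum>j\<in>{1..4 ^ k} \<inter> {..n}. indicator B (X j \<omega>)) / 4 ^ k"
        by (simp add: avg_def Y_def add_divide_distrib)
      moreover have "\<bar>\<Sum>j\<in>{1..4 ^ k} \<inter> {..n}. indicator B (X j \<omega>) :: real\<bar> \<le> real n"
      proof -
        have "\<bar>\<Sum>j\<in>{1..4 ^ k} \<inter> {..n}. indicator B (X j \<omega>) :: real\<bar> \<le> real (card ({1..4 ^ k} \<inter> {..n})) * 1"
          by (intro order_trans[OF sum_abs] sum_bounded_above) (auto simp: indicator_def)
        also have "card ({1..4 ^ k} \<inter> {..n}) \<le> card {1..n}" by (intro card_mono) auto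
        finally show ?thesis by simp
      qed
      ultimately show ?thesis by (simp add: power_divide divide_right_mono)
    qed
    have "(\<lambda>k. real n * (1 / 4) ^ k) \<longlonglongrightarrow> real n * 0"
      by (intro tendsto_mult tendsto_const LIMSEQ_power_zero) simp
    then have lim0: "(\<lambda>k. real n * (1 / 4) ^ k) \<longlonglongrightarrow> 0" by (simp only: mult_zero_right)
    have "(\<lambda>k. avg B (4 ^ k) \<omega> - Y k \<omega>) \<longlonglongrightarrow> 0"
      by (rule Lim_null_comparison[OF _ lim0]) (simp only: bound real_norm_def eventually_True)
    from Lim_transform_eq[OF this] show ?thesis unfolding lim_def by simp
  qed
  moreover have "(\<lambda>\<omega>. max 0 (min 1 (lim (\<lambda>k. Y k \<omega>)))) \<in> borel_measurable (future n)"
  proof -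
    have [measurable]: "Y k \<in> borel_measurable (future n)" for k
      unfolding Y_def
      by (intro borel_measurable_divide borel_measurable_sum borel_measurable_const
          measurable_compose[OF measurable_future borel_measurable_indicator]) auto
    show ?thesis by measurable
  qed
  ultimately show ?thesis unfolding freq_def[abs_def] by simp
qed

lemma sets_future: "sets (future 0) \<subseteq> events"
proof -
  have "(\<lambda>\<omega>. \<lambda>k\<in>{0<..}. X k \<omega>) \<in> M \<rightarrow>\<^sub>M Pi\<^sub>M {0<..} (\<lambda>_. borel)" by (intro measurable_restrict X)
  then show ?thesis unfolding future_def by (auto simp: sets_vimage_algebra2 space_PiM intro: measurable_sets)
qed

lemma measurable_freq [measurable]: "B \<in> sets borel \<Longrightarrow> freq B \<in> borel_measurable M"
  using measurable_freq_future[of B 0] sets_future by (auto simp: measurable_def)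

end

subsection \<open>Mixtures of product measures\<close>

text \<open>Otherwise \<open>simp\<close> turns the index set \<open>{1..}\<close> into \<open>{Suc 0..}\<close>, and rules stated for \<open>{1..}\<close> no longer match.\<close>

declare One_nat_def [simp del]

text \<open>Only initial segments of coordinates are constrained because that is all the defining
  equation of a mixed process (assertion (vi)) provides.\<close>

definition lower_box :: "nat \<Rightarrow> (nat \<Rightarrow> real) \<Rightarrow> (nat \<Rightarrow> real) set" where
  "lower_box r w = {x \<in> space (Pi\<^sub>M {1..} (\<lambda>_. borel)). \<forall>k\<in>{1..r}. x k \<le> w k}"

lemma sets_lower_box [measurable]: "lower_box r w \<in> sets (Pi\<^sub>M {1..} (\<lambda>_. borel :: real measure))"
  unfolding lower_box_def by measurable

lemma lower_box_Int:
  "lower_box r w \<inter> lower_box r' w' =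
    lower_box (max r r') (\<lambda>k. if k \<le> r \<and> k \<le> r' then min (w k) (w' k) else if k \<le> r then w k else w' k)"
  by (auto simp: lower_box_def split: if_splits; fastforce)

text \<open>Almost sure identities can be collected over countably many sets only. This family is
  countable, since a box depends on \<open>w\<close> only through its values at \<open>1\<close> to
  \<open>r\<close>.\<close>

definition rat_boxes :: "(nat \<Rightarrow> real) set set" where
  "rat_boxes = {lower_box r (\<lambda>k. real_of_rat (w k)) | r w. 1 \<le> r}"

lemma Int_stable_rat_boxes: "Int_stable rat_boxes"
proof (rule Int_stableI)
  fix a b assume "a \<in> rat_boxes" "b \<in> rat_boxes"
  then obtain r w r' w' where ab: "a = lower_box r (\<lambda>k. real_of_rat (w k))" "1 \<le> r"
      "b = lower_box r' (\<lambda>k. real_of_rat (w' k))" "1 \<le> r'"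
    by (auto simp: rat_boxes_def)
  have "a \<inter> b = lower_box (max r r') (\<lambda>k. real_of_rat
      (if k \<le> r \<and> k \<le> r' then min (w k) (w' k) else if k \<le> r then w k else w' k))"
    unfolding ab lower_box_Int
    by (intro arg_cong[where f="lower_box _"] ext) (simp add: min_def of_rat_less_eq)
  then show "a \<inter> b \<in> rat_boxes" using ab by (auto simp: rat_boxes_def)
qed

text \<open>A bound on coordinate \<open>k\<close> alone is not a box, because boxes bound the
  earlier coordinates as well; it is the union over \<open>n\<close> of the boxes that bound those
  coordinates by \<open>n\<close>.\<close>

lemma sets_PiM_rat_boxes:
  "sets (Pi\<^sub>M {1..} (\<lambda>_. borel :: real measure)) = sigma_sets (space (Pi\<^sub>M {1..} (\<lambda>_. borel))) rat_boxes"
    (is "sets ?P = sigma_sets ?\<Omega> _")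
proof
  have Pow: "rat_boxes \<subseteq> Pow ?\<Omega>" by (auto simp: rat_boxes_def lower_box_def)
  show "sigma_sets ?\<Omega> rat_boxes \<subseteq> sets ?P"
    by (rule sets.sigma_sets_subset) (auto simp: rat_boxes_def)
  define S where "S = sigma ?\<Omega> rat_boxes"
  have spS: "space S = ?\<Omega>" and setsS: "sets S = sigma_sets ?\<Omega> rat_boxes"
    unfolding S_def using Pow by auto
  have coord: "(\<lambda>x. x k) \<in> borel_measurable S" if k: "k \<in> {1..}" for k
  proof (rule borel_measurableI_le)
    fix a :: real
    have rat: "{x \<in> space S. x k \<le> real_of_rat q} \<in> sets S" for q
    proof -
      let ?B = "\<lambda>n::nat. lower_box k (\<lambda>j. real_of_rat (if j = k then q else of_nat n))"
      have "{x \<in> space S. x k \<le> real_of_rat q} = (\<Union>n. ?B n)"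
      proof (intro set_eqI iffI)
        fix x assume x: "x \<in> {x \<in> space S. x k \<le> real_of_rat q}"
        obtain n where n: "\<And>j. j \<in> {1..k} \<Longrightarrow> x j \<le> real (n::nat)"
        proof -
          obtain n where "Max (x ` {1..k}) \<le> real n" using real_arch_simple by blast
          moreover have "x j \<le> Max (x ` {1..k})" if "j \<in> {1..k}" for j using that by simp
          ultimately show ?thesis using that by (meson order_trans)
        qed
        show "x \<in> (\<Union>n. ?B n)" using x n by (auto simp: lower_box_def spS intro!: exI[of _ n])
      qed (use k in \<open>force simp: lower_box_def spS\<close>)
      moreover have "?B n \<in> sets S" for n
        unfolding setsS using k by (intro sigma_sets.Basic) (auto simp: rat_boxes_def)
      ultimately show ?thesis by auto
    qed
    have "{x \<in> space S. x k \<le> a} = (\<Inter>q\<in>{q. a < real_of_rat q}. {x \<in> space S. x k \<le> real_of_rat q})"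
    proof (intro set_eqI iffI)
      fix x assume x: "x \<in> (\<Inter>q\<in>{q. a < real_of_rat q}. {x \<in> space S. x k \<le> real_of_rat q})"
      obtain q0 where "a < real_of_rat q0" using of_rat_dense[of a "a + 1"] by auto
      then have "x \<in> space S" using x by auto
      moreover have "x k \<le> a"
      proof (rule ccontr)
        assume "\<not> x k \<le> a"
        then obtain q where "a < real_of_rat q" "real_of_rat q < x k"
          using of_rat_dense[of a "x k"] by auto
        then show False using x by fastforce
      qed
      ultimately show "x \<in> {x \<in> space S. x k \<le> a}" by simp
    qed auto
    also have "\<dots> \<in> sets S"
    proof (rule sets.countable_INT')
      show "{q. a < real_of_rat q} \<noteq> {}" using of_rat_dense[of a "a + 1"] by auto
    qed (auto intro: rat)
    finally show "{x \<in> space S. x k \<le> a} \<in> sets S" .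
  qed
  \<comment> \<open>Measurable coordinates make the identity measurable from \<open>S\<close> to the
    product space, which is the remaining inclusion of \<sigma>-algebras.\<close>
  have "(\<lambda>x. \<lambda>k\<in>{1..}. x k) \<in> S \<rightarrow>\<^sub>M ?P"
    by (intro measurable_restrict coord)
  also have "?this \<longleftrightarrow> (\<lambda>x. x) \<in> S \<rightarrow>\<^sub>M ?P"
    by (intro measurable_cong) (auto simp: spS space_PiM PiE_def extensional_restrict)
  finally have m: "(\<lambda>x. x) \<in> S \<rightarrow>\<^sub>M ?P" .
  show "sets ?P \<subseteq> sigma_sets ?\<Omega> rat_boxes"
  proof
    fix A assume A: "A \<in> sets ?P"
    then have "A \<subseteq> space S" using sets.sets_into_space[OF A] spS by simp
    then show "A \<in> sigma_sets ?\<Omega> rat_boxes"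
      using measurable_sets[OF m A] setsS by (simp add: Int_absorb2)
  qed
qed

text \<open>The exhaustion by generator sets that the uniqueness theorem for measures asks
  for.\<close>

lemma UN_lower_box: "(\<Union>n::nat. lower_box 1 (\<lambda>_. real_of_rat (of_nat n))) = space (Pi\<^sub>M {1..} (\<lambda>_. borel))"
  by (auto simp: lower_box_def intro: real_arch_simple)

lemma measure_eqI_lower_box:
  fixes \<mu> \<nu> :: "(nat \<Rightarrow> real) measure"
  assumes s: "sets \<mu> = sets (Pi\<^sub>M {1..} (\<lambda>_. borel))" "sets \<nu> = sets (Pi\<^sub>M {1..} (\<lambda>_. borel))"
    and fin: "finite_measure \<mu>"
    and eq: "\<And>r (w :: nat \<Rightarrow> rat). 1 \<le> r \<Longrightarrow>
      emeasure \<mu> (lower_box r (\<lambda>k. real_of_rat (w k))) = emeasure \<nu> (lower_box r (\<lambda>k. real_of_rat (w k)))"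
  shows "\<mu> = \<nu>"
proof (rule measure_eqI_generator_eq[OF Int_stable_rat_boxes])
  show "rat_boxes \<subseteq> Pow (space (Pi\<^sub>M {1..} (\<lambda>_. borel)))" by (auto simp: rat_boxes_def lower_box_def)
  show "range (\<lambda>n::nat. lower_box 1 (\<lambda>_. real_of_rat (of_nat n))) \<subseteq> rat_boxes"
    unfolding rat_boxes_def by (auto intro!: exI[of _ 1] exI[of _ "\<lambda>_. rat_of_nat _"])
qed (use s eq UN_lower_box finite_measure.emeasure_finite[OF fin] in
      \<open>auto simp: sets_PiM_rat_boxes rat_boxes_def\<close>)

lemma emeasure_PiM_iid:
  assumes "prob_space \<kappa>" "sets \<kappa> = sets borel" "finite J" "J \<subseteq> I" "\<And>j. j \<in> J \<Longrightarrow> B j \<in> sets borel"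
  shows "emeasure (Pi\<^sub>M I (\<lambda>_. \<kappa>)) {x \<in> space (Pi\<^sub>M I (\<lambda>_. borel)). \<forall>j\<in>J. x j \<in> B j} =
    (\<Prod>j\<in>J. emeasure \<kappa> (B j))"
proof -
  interpret prob_space \<kappa> by fact
  interpret product_prob_space "\<lambda>_. \<kappa>" I by unfold_locales
  have "space (Pi\<^sub>M I (\<lambda>_. borel)) = space (Pi\<^sub>M I (\<lambda>_. \<kappa>))"
    using sets_eq_imp_space_eq[OF assms(2)] by (simp add: space_PiM)
  then show ?thesis using emeasure_PiM_Collect[of J B] assms by simp
qed

lemma sets_PiM_iid: "sets \<kappa> = sets borel \<Longrightarrow> sets (Pi\<^sub>M I (\<lambda>_. \<kappa>)) = sets (Pi\<^sub>M I (\<lambda>_. borel))"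
  by (rule sets_PiM_cong) auto

lemma emeasure_PiM_lower_box:
  assumes "prob_space \<kappa>" "sets \<kappa> = sets borel"
  shows "emeasure (Pi\<^sub>M {1..} (\<lambda>_. \<kappa>)) (lower_box r w) = (\<Prod>k\<in>{1..r}. emeasure \<kappa> {..w k})"
  using emeasure_PiM_iid[OF assms, of "{1..r}" "{1..}" "\<lambda>k. {..w k}"] by (simp add: lower_box_def)

lemma prob_kernelD:
  assumes "\<kappa> \<in> T \<rightarrow>\<^sub>M prob_algebra N" "y \<in> space T"
  shows "prob_space (\<kappa> y)" "sets (\<kappa> y) = sets N"
  using measurable_space[OF assms] by (auto simp: space_prob_algebra)

lemma measurable_emeasure_kernel':
  assumes "\<kappa> \<in> T \<rightarrow>\<^sub>M prob_algebra N" "B \<in> sets N"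
  shows "(\<lambda>y. emeasure (\<kappa> y) B) \<in> borel_measurable T"
  using measurable_compose[OF measurable_prob_algebraD[OF assms(1)] measurable_emeasure_subprob_algebra[OF assms(2)]] .

text \<open>On a rational box the product measure is a finite product of kernel values, and an
  intersection-stable generator suffices to test measurability of a family of probability
  measures.\<close>

lemma measurable_PiM_iid:
  assumes \<kappa>: "\<kappa> \<in> T \<rightarrow>\<^sub>M prob_algebra (borel :: real measure)"
  shows "(\<lambda>y. Pi\<^sub>M {1::nat..} (\<lambda>_. \<kappa> y)) \<in> T \<rightarrow>\<^sub>M prob_algebra (Pi\<^sub>M {1..} (\<lambda>_. borel))"
proof (rule measurable_prob_algebra_generated[OF sets_PiM_rat_boxes Int_stable_rat_boxes])
  show "rat_boxes \<subseteq> Pow (space (Pi\<^sub>M {1..} (\<lambda>_. borel)))" by (auto simp: rat_boxes_def lower_box_def)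
  fix y assume y: "y \<in> space T"
  note k = prob_kernelD[OF \<kappa> y]
  show "prob_space (Pi\<^sub>M {1..} (\<lambda>_. \<kappa> y))" by (intro prob_space_PiM k)
  show "sets (Pi\<^sub>M {1..} (\<lambda>_. \<kappa> y)) = sets (Pi\<^sub>M {1..} (\<lambda>_. borel))" by (intro sets_PiM_iid k)
next
  fix A assume "A \<in> rat_boxes"
  then obtain r w where A: "A = lower_box r (\<lambda>k. real_of_rat (w k))" by (auto simp: rat_boxes_def)
  have "(\<lambda>y. \<Prod>k\<in>{1..r}. emeasure (\<kappa> y) {..real_of_rat (w k)}) \<in> borel_measurable T"
    by (intro borel_measurable_prod_ennreal measurable_emeasure_kernel'[OF \<kappa>]) auto
  also have "?this \<longleftrightarrow> (\<lambda>y. emeasure (Pi\<^sub>M {1..} (\<lambda>_. \<kappa> y)) A) \<in> borel_measurable T"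
    unfolding A by (intro measurable_cong) (simp add: emeasure_PiM_lower_box prob_kernelD[OF \<kappa>])
  finally show "(\<lambda>y. emeasure (Pi\<^sub>M {1..} (\<lambda>_. \<kappa> y)) A) \<in> borel_measurable T" .
qed

text \<open>The right-hand side is the bind of \<open>\<nu>\<close> with the product kernel, hence a
  measure in \<open>H\<close>, and it agrees with \<open>\<mu>\<close> on the boxes. The measure
  \<open>\<nu>\<close> is general because it stands both for the mixing measure of (vi) and for the
  law of \<open>\<Theta>\<close> restricted to a Borel set.\<close>

lemma iid_mixtureI:
  assumes \<kappa>: "\<kappa> \<in> T \<rightarrow>\<^sub>M prob_algebra (borel :: real measure)"
    and T: "sets T = sets \<nu>" "space \<nu> \<noteq> {}"
    and \<mu>: "finite_measure \<mu>" "sets \<mu> = sets (Pi\<^sub>M {1..} (\<lambda>_. borel))"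
    and eq: "\<And>r (w :: nat \<Rightarrow> rat). 1 \<le> r \<Longrightarrow> emeasure \<mu> (lower_box r (\<lambda>k. real_of_rat (w k))) =
        (\<integral>\<^sup>+y. (\<Prod>k\<in>{1..r}. emeasure (\<kappa> y) {..real_of_rat (w k)}) \<partial>\<nu>)"
    and H: "H \<in> sets (Pi\<^sub>M {1..} (\<lambda>_. borel))"
  shows "emeasure \<mu> H = (\<integral>\<^sup>+y. emeasure (Pi\<^sub>M {1..} (\<lambda>_. \<kappa> y)) H \<partial>\<nu>)"
proof -
  have K: "(\<lambda>y. Pi\<^sub>M {1::nat..} (\<lambda>_. \<kappa> y)) \<in> \<nu> \<rightarrow>\<^sub>M subprob_algebra (Pi\<^sub>M {1..} (\<lambda>_. borel))"
    using measurable_prob_algebraD[OF measurable_PiM_iid[OF \<kappa>]] measurable_cong_sets[OF T(1) refl] by blast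
  have "\<mu> = \<nu> \<bind> (\<lambda>y. Pi\<^sub>M {1..} (\<lambda>_. \<kappa> y))"
  proof (rule measure_eqI_lower_box[OF \<mu>(2) _ \<mu>(1)])
    show "sets (\<nu> \<bind> (\<lambda>y. Pi\<^sub>M {1::nat..} (\<lambda>_. \<kappa> y))) = sets (Pi\<^sub>M {1..} (\<lambda>_. borel))"
      by (rule sets_bind) (use sets_kernel[OF K] T(2) in auto)
    fix r :: nat and w :: "nat \<Rightarrow> rat" assume "1 \<le> r"
    have "space \<nu> = space T" using sets_eq_imp_space_eq[OF T(1)] by simp
    then show "emeasure \<mu> (lower_box r (\<lambda>k. real_of_rat (w k))) =
      emeasure (\<nu> \<bind> (\<lambda>y. Pi\<^sub>M {1..} (\<lambda>_. \<kappa> y))) (lower_box r (\<lambda>k. real_of_rat (w k)))"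
      using emeasure_bind[OF T(2) K sets_lower_box] eq[OF \<open>1 \<le> r\<close>]
      by (auto intro!: nn_integral_cong simp: emeasure_PiM_lower_box prob_kernelD[OF \<kappa>])
  qed
  then show ?thesis using emeasure_bind[OF T(2) K H] by simp
qed

subsection \<open>De Finetti's theorem\<close>

text \<open>The exceptional terms change the centred sum by at most the constant \<open>D\<close>,
  which disappears after division by \<open>n\<close>.\<close>

lemma cesaro_eventually_const:
  fixes a :: "nat \<Rightarrow> real"
  assumes F: "finite F" and a: "\<And>k. 1 \<le> k \<Longrightarrow> k \<notin> F \<Longrightarrow> a k = c"
  shows "(\<lambda>n. (\<Sum>k\<in>{1..n}. a k) / real n) \<longlonglongrightarrow> c"
proof -
  define D where "D = (\<Sum>k\<in>F. \<bar>a k - c\<bar>)"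
  have "\<bar>(\<Sum>k\<in>{1..n}. a k) / real n - c\<bar> \<le> D / real n" if "1 \<le> n" for n
  proof -
    have "(\<Sum>k\<in>{1..n}. a k) / real n - c = (\<Sum>k\<in>{1..n}. a k - c) / real n"
      using that by (simp add: sum_subtractf field_simps)
    moreover have "\<bar>\<Sum>k\<in>{1..n}. a k - c\<bar> \<le> D"
    proof -
      have "\<bar>\<Sum>k\<in>{1..n}. a k - c\<bar> \<le> (\<Sum>k\<in>{1..n}. \<bar>a k - c\<bar>)" by (rule sum_abs)
      also have "\<dots> = (\<Sum>k\<in>{1..n} \<inter> F. \<bar>a k - c\<bar>)"
        using a by (intro sum.mono_neutral_right) auto
      also have "\<dots> \<le> D" unfolding D_def using F by (intro sum_mono2) auto
      finally show ?thesis .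
    qed
    ultimately show ?thesis by (simp add: divide_right_mono)
  qed
  then have "eventually (\<lambda>n. norm ((\<Sum>k\<in>{1..n}. a k) / real n - c) \<le> D / real n) sequentially"
    by (auto simp: eventually_sequentially)
  moreover have "(\<lambda>n. D / real n) \<longlonglongrightarrow> 0" by (rule lim_const_over_n)
  ultimately have "(\<lambda>n. (\<Sum>k\<in>{1..n}. a k) / real n - c) \<longlonglongrightarrow> 0" by (rule Lim_null_comparison)
  then show ?thesis by (rule LIM_zero_cancel)
qed

lemma prod_bounds_01:
  fixes f :: "'i \<Rightarrow> real"
  assumes "\<And>i. i \<in> I \<Longrightarrow> 0 \<le> f i \<and> f i \<le> 1"
  shows "0 \<le> prod f I" "prod f I \<le> 1"
  using assms by (auto intro: prod_nonneg prod_le_1)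

text \<open>In integrated form, this says that the powers of \<open>\<kappa> \<theta>\<close> are a
  regular conditional distribution of the whole sequence given \<open>\<Theta>\<close>. Testing
  against all \<open>C\<close> and \<open>H\<close> puts independence and equality of the marginals
  into one equation.\<close>

definition iid_given :: "'a measure \<Rightarrow> (nat \<Rightarrow> 'a \<Rightarrow> real) \<Rightarrow> 'b measure \<Rightarrow> ('a \<Rightarrow> 'b) \<Rightarrow> ('b \<Rightarrow> real measure) \<Rightarrow> bool" where
  "iid_given M X T \<Theta> \<kappa> \<longleftrightarrow> \<Theta> \<in> M \<rightarrow>\<^sub>M T \<and> \<kappa> \<in> T \<rightarrow>\<^sub>M prob_algebra borel \<and>
    (\<forall>C\<in>sets T. \<forall>H\<in>sets (Pi\<^sub>M {1..} (\<lambda>_. borel)).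
      (\<integral>\<^sup>+\<theta>\<in>C. emeasure (Pi\<^sub>M {1..} (\<lambda>_. \<kappa> \<theta>)) H \<partial>distr M T \<Theta>) =
      emeasure M {\<omega> \<in> space M. \<Theta> \<omega> \<in> C \<and> (\<lambda>n\<in>{1..}. X n \<omega>) \<in> H})"

context exchangeable_seq begin

text \<open>Inductively replace each factor \<open>freq (B i)\<close> by an average over late observations;
  since \<open>A\<close> is a tail event, exchangeability makes all but finitely many terms of that average equal.\<close>

lemma expectation_freq_prod:
  assumes A: "\<And>n. A \<in> sets (future n)"
    and I: "finite I" and J: "finite J" "I \<inter> J = {}" "I \<union> J \<subseteq> {1..}"
    and B: "\<And>j. j \<in> I \<union> J \<Longrightarrow> B j \<in> sets borel"
  shows "expectation (\<lambda>\<omega>. indicator A \<omega> * (\<Prod>i\<in>I. freq (B i) \<omega>) * (\<Prod>j\<in>J. indicator (B j) (X j \<omega>))) =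
    prob {\<omega> \<in> A. \<forall>j\<in>I \<union> J. X j \<omega> \<in> B j}"
  using I J B
proof (induction I arbitrary: J B)
  case empty
  have A': "A \<in> events" using A[of 0] sets_future by auto
  have ind: "indicator A \<omega> * (\<Prod>i\<in>{}. freq (B i) \<omega>) * (\<Prod>j\<in>J. indicator (B j) (X j \<omega>)) =
      (indicator {\<omega> \<in> A. \<forall>j\<in>J. X j \<omega> \<in> B j} \<omega> :: real)" for \<omega>
    using empty.prems(1) by (auto simp: indicator_def)
  have "{\<omega> \<in> A. \<forall>j\<in>J. X j \<omega> \<in> B j} = A \<inter> {\<omega> \<in> space M. \<forall>j\<in>J. X j \<omega> \<in> B j}"
    using sets.sets_into_space[OF A'] by auto
  also have "\<dots> \<in> events"
    using A' empty.prems(1,4) by (intro sets.Int sets.sets_Collect_finite_All) auto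
  finally show ?case by (simp only: ind Un_empty_left) (simp add: Int_absorb2 sets.sets_into_space)
next
  case (insert i I)
  have A': "A \<in> events" using A[of 0] sets_future by auto
  define Z where "Z \<omega> = indicator A \<omega> * (\<Prod>i\<in>I. freq (B i) \<omega>) * (\<Prod>j\<in>J. indicator (B j) (X j \<omega>) :: real)" for \<omega>
  have Bi [measurable]: "B i \<in> sets borel" using insert.prems(4) by simp
  have [measurable]: "Z \<in> borel_measurable M"
    unfolding Z_def using A' insert.prems(4)
    by (intro borel_measurable_times borel_measurable_prod borel_measurable_indicator measurable_freq
        measurable_compose[OF X borel_measurable_indicator]) auto
  have Z01: "0 \<le> Z \<omega>" "Z \<omega> \<le> 1" for \<omega>
    unfolding Z_def using prod_bounds_01[of I "\<lambda>i. freq (B i) \<omega>"] prod_bounds_01[of J "\<lambda>j. indicator (B j) (X j \<omega>)"] freq_bounds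
    by (auto intro!: mult_nonneg_nonneg mult_le_one simp: indicator_def)
  define c where "c = prob {\<omega> \<in> A. \<forall>j\<in>insert i I \<union> J. X j \<omega> \<in> B j}"
  define a where "a k = expectation (\<lambda>\<omega>. indicator (B i) (X k \<omega>) * Z \<omega>)" for k
  have a_eq: "a k = c" if k: "1 \<le> k" "k \<notin> I \<union> J" for k
  proof -
    \<comment> \<open>Index \<open>k\<close> takes over the constraint of \<open>i\<close>. With
      \<open>k\<close> added to \<open>J\<close> the induction hypothesis evaluates
      \<open>a k\<close>, and \<open>future_reindex\<close> along \<open>?h\<close> moves the
      constraint back to \<open>i\<close>, so the value is the same for all such
      \<open>k\<close>.\<close>
    let ?B = "B(k := B i)" and ?h = "(\<lambda>x. x)(i := k)"
    have iIJ: "i \<notin> I" "i \<notin> J" "1 \<le> i" using insert.hyps insert.prems by auto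
    have "indicator (B i) (X k \<omega>) * Z \<omega> =
        indicator A \<omega> * (\<Prod>i\<in>I. freq (?B i) \<omega>) * (\<Prod>j\<in>insert k J. indicator (?B j) (X j \<omega>))" for \<omega>
    proof -
      have "(\<Prod>i\<in>I. freq (?B i) \<omega>) = (\<Prod>i\<in>I. freq (B i) \<omega>)" using k by (intro prod.cong) auto
      moreover have "(\<Prod>j\<in>J. indicator (?B j) (X j \<omega>)) = (\<Prod>j\<in>J. indicator (B j) (X j \<omega>) :: real)"
        using k by (intro prod.cong) auto
      ultimately show ?thesis using k insert.prems(1) by (simp add: Z_def)
    qed
    then have "a k = prob {\<omega> \<in> A. \<forall>j\<in>I \<union> insert k J. X j \<omega> \<in> ?B j}"
      unfolding a_def using insert.prems k by (simp only:, intro insert.IH) (auto split: if_splits)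
    also have "{\<omega> \<in> A. \<forall>j\<in>I \<union> insert k J. X j \<omega> \<in> ?B j} = {\<omega> \<in> A. \<forall>j\<in>insert i I \<union> J. X (?h j) \<omega> \<in> B j}"
      using k iIJ by (auto split: if_splits)
    also have "prob \<dots> = c"
      unfolding c_def
    proof (rule future_reindex[OF A])
      show "inj_on ?h (insert i I \<union> J)" using k iIJ by (auto simp: inj_on_def)
    qed (use insert.hyps insert.prems k in auto)
    finally show ?thesis .
  qed
  have avg: "expectation (\<lambda>\<omega>. avg (B i) n \<omega> * Z \<omega>) = (\<Sum>k\<in>{1..n}. a k) / real n" for n
  proof -
    have i: "integrable M (\<lambda>\<omega>. indicator (B i) (X k \<omega>) * Z \<omega>)" for k
      using Z01 by (intro integrable_const_bound[where B=1]) (auto simp: indicator_def)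
    have "(\<lambda>\<omega>. avg (B i) n \<omega> * Z \<omega>) = (\<lambda>\<omega>. (\<Sum>k\<in>{1..n}. indicator (B i) (X k \<omega>) * Z \<omega>) / real n)"
      by (simp add: avg_def sum_distrib_right)
    then show ?thesis
      by (simp only: integral_divide_zero a_def Bochner_Integration.integral_sum i)
  qed
  have "(\<lambda>k. expectation (\<lambda>\<omega>. avg (B i) (4 ^ k) \<omega> * Z \<omega>)) \<longlonglongrightarrow> expectation (\<lambda>\<omega>. freq (B i) \<omega> * Z \<omega>)"
  proof (rule integral_dominated_convergence[where w="\<lambda>_. 1"])
    show "AE \<omega> in M. (\<lambda>k. avg (B i) (4 ^ k) \<omega> * Z \<omega>) \<longlonglongrightarrow> freq (B i) \<omega> * Z \<omega>"
      using AE_avg_tendsto_freq[OF Bi] by eventually_elim (intro tendsto_mult tendsto_const)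
    show "AE \<omega> in M. norm (avg (B i) (4 ^ k) \<omega> * Z \<omega>) \<le> 1" for k
      using Z01 avg_bounds by (auto simp: abs_mult intro!: mult_le_one)
  qed auto
  moreover have "(\<lambda>k. expectation (\<lambda>\<omega>. avg (B i) (4 ^ k) \<omega> * Z \<omega>)) \<longlonglongrightarrow> c"
  proof -
    have "(\<lambda>n. (\<Sum>k\<in>{1..n}. a k) / real n) \<longlonglongrightarrow> c"
      using insert.hyps insert.prems by (intro cesaro_eventually_const[of "I \<union> J"] a_eq) auto
    \<comment> \<open>The limit is needed along the subsequence that defines
      \<open>freq\<close>.\<close>
    from LIMSEQ_subseq_LIMSEQ[OF this, of "\<lambda>k. 4 ^ k"] show ?thesis
      by (simp add: avg comp_def strict_mono_def)
  qed
  ultimately have "expectation (\<lambda>\<omega>. freq (B i) \<omega> * Z \<omega>) = c" by (rule LIMSEQ_unique)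
  then show ?case
    using insert.hyps by (simp add: Z_def c_def mult_ac)
qed

text \<open>The kernel is a conditional distribution of \<open>X 1\<close> given
  \<open>\<Theta>\<close>, so it consists of genuine measures; on each rational half line it agrees
  almost surely with the limiting frequency. Hence \<open>expectation_freq_prod\<close> with empty
  \<open>J\<close> becomes the product formula on rational boxes, which settles all measurable
  \<open>H\<close>.\<close>

lemma de_Finetti: "\<exists>(\<Theta> :: 'a \<Rightarrow> real) \<kappa>. iid_given M X borel \<Theta> \<kappa>"
proof -
  define q :: "nat \<Rightarrow> real" where "q n = real_of_rat (from_nat n)" for n
  obtain \<Theta> :: "'a \<Rightarrow> real" where
    \<Theta>': "\<forall>F. space F = space M \<longrightarrow> (\<forall>n. freq {..q n} \<in> borel_measurable F) \<longrightarrow> \<Theta> \<in> borel_measurable F"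
    and freq: "\<forall>n. freq {..q n} \<in> borel_measurable (vimage_algebra (space M) \<Theta> borel)"
    using ex_real_encoding[where f="\<lambda>n. freq {..q n}" and \<Omega>="space M"] by (elim exE conjE)
  note \<Theta> = \<Theta>'[rule_format] and freq = freq[rule_format]
  have \<Theta>m [measurable]: "\<Theta> \<in> borel_measurable M" by (rule \<Theta>) auto
  define G where "G = vimage_algebra (space M) \<Theta> borel"
  have setsG: "sets G = {\<Theta> -` C \<inter> space M | C. C \<in> sets borel}"
    by (simp add: G_def sets_vimage_algebra2)
  \<comment> \<open>The frequencies are measurable for every \<open>future n\<close>, hence so is
    their code: every event about \<open>\<Theta>\<close> is a tail event.\<close>
  have future: "\<Theta> -` C \<inter> space M \<in> sets (future n)" if "C \<in> sets borel" for C n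
  proof -
    have "\<Theta> \<in> borel_measurable (future n)" by (rule \<Theta>) (auto intro: measurable_freq_future)
    from measurable_sets[OF this that] show ?thesis by simp
  qed
  have "subalgebra M G"
    using space_vimage_algebra[of "space M" \<Theta> borel] by (auto simp: subalgebra_def setsG G_def[symmetric])
  then interpret G: finite_measure_subalgebra M G by unfold_locales
  obtain \<kappa> where \<kappa>: "\<kappa> \<in> borel \<rightarrow>\<^sub>M prob_algebra borel"
    and \<kappa>_eq: "\<forall>C\<in>sets borel. \<forall>B\<in>sets borel. (\<integral>\<^sup>+\<theta>\<in>C. emeasure (\<kappa> \<theta>) B \<partial>distr M borel \<Theta>) =
       emeasure M {\<omega> \<in> space M. \<Theta> \<omega> \<in> C \<and> X 1 \<omega> \<in> B}"
    using ex_conditional_distribution[OF prob_space_axioms \<Theta>m X[of 1]] by blast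
  have \<kappa>prob: "prob_space (\<kappa> \<theta>)" and \<kappa>sets: "sets (\<kappa> \<theta>) = sets borel" for \<theta>
    using prob_kernelD[OF \<kappa>, of \<theta>] by simp_all
  have \<kappa>meas: "(\<lambda>\<theta>. measure (\<kappa> \<theta>) B) \<in> borel_measurable borel" if "B \<in> sets borel" for B
    unfolding measure_def using measurable_emeasure_kernel'[OF \<kappa> that] by measurable
  have \<kappa>01: "0 \<le> measure (\<kappa> \<theta>) B" "measure (\<kappa> \<theta>) B \<le> 1" for \<theta> B
    using prob_space.prob_le_1[OF \<kappa>prob] by auto
  \<comment> \<open>Both sides are versions of the conditional probability of
    \<open>X 1 \<le> q n\<close> given \<open>G\<close>: the kernel by construction, the frequency
    by \<open>expectation_freq_prod\<close> with \<open>I = {1}\<close> and empty \<open>J\<close>.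
    Measurability of the frequency with respect to \<open>G\<close> is what the encoding
    provides.\<close>
  have AE_freq: "AE \<omega> in M. measure (\<kappa> (\<Theta> \<omega>)) {..q n} = freq {..q n} \<omega>" for n
  proof -
    let ?X = "\<lambda>\<omega>. indicator {..q n} (X 1 \<omega>) :: real"
    let ?K = "\<lambda>\<omega>. measure (\<kappa> (\<Theta> \<omega>)) {..q n}"
    have K [measurable]: "?K \<in> borel_measurable M"
      using measurable_compose[OF \<Theta>m \<kappa>meas] by simp
    have KG: "?K \<in> borel_measurable G"
      using measurable_compose[OF _ \<kappa>meas, of \<Theta> G] measurable_vimage_algebra1[of \<Theta> "space M" borel]
      by (simp add: G_def)
    have iX: "integrable M ?X" by (rule integrable_const_bound[where B=1]) (auto simp: indicator_def)
    have iK: "integrable M ?K" using \<kappa>01 by (intro integrable_const_bound[where B=1]) auto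
    have iF: "integrable M (freq {..q n})" using freq_bounds by (intro integrable_const_bound[where B=1]) auto
    have X_int: "(\<integral>\<omega>\<in>\<Theta> -` C \<inter> space M. ?X \<omega> \<partial>M) = prob {\<omega> \<in> space M. \<Theta> \<omega> \<in> C \<and> X 1 \<omega> \<in> {..q n}}"
      if [measurable]: "C \<in> sets borel" for C
    proof -
      have "(\<integral>\<omega>\<in>\<Theta> -` C \<inter> space M. ?X \<omega> \<partial>M) = expectation (indicator {\<omega> \<in> space M. \<Theta> \<omega> \<in> C \<and> X 1 \<omega> \<in> {..q n}})"
        unfolding set_lebesgue_integral_def
        by (intro Bochner_Integration.integral_cong) (auto simp: indicator_def)
      then show ?thesis by simp
    qed
    have "AE \<omega> in M. real_cond_exp M G ?X \<omega> = freq {..q n} \<omega>"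
    proof (rule G.real_cond_exp_charact[OF _ iX iF freq[folded G_def]])
      fix A assume "A \<in> sets G"
      then obtain C where C [measurable]: "C \<in> sets borel" and A: "A = \<Theta> -` C \<inter> space M" by (auto simp: setsG)
      have "(\<integral>\<omega>\<in>A. freq {..q n} \<omega> \<partial>M) = prob {\<omega> \<in> A. X 1 \<omega> \<in> {..q n}}"
        using expectation_freq_prod[of A "{1}" "{}" "\<lambda>_. {..q n}"] future[OF C]
        by (simp add: set_lebesgue_integral_def A)
      also have "{\<omega> \<in> A. X 1 \<omega> \<in> {..q n}} = {\<omega> \<in> space M. \<Theta> \<omega> \<in> C \<and> X 1 \<omega> \<in> {..q n}}" by (auto simp: A)
      finally show "(\<integral>\<omega>\<in>A. ?X \<omega> \<partial>M) = (\<integral>\<omega>\<in>A. freq {..q n} \<omega> \<partial>M)"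
        unfolding A X_int[OF C] by simp
    qed
    moreover have "AE \<omega> in M. real_cond_exp M G ?X \<omega> = ?K \<omega>"
    proof (rule G.real_cond_exp_charact[OF _ iX iK KG])
      fix A assume "A \<in> sets G"
      then obtain C where C [measurable]: "C \<in> sets borel" and A: "A = \<Theta> -` C \<inter> space M" by (auto simp: setsG)
      have "ennreal (\<integral>\<omega>\<in>A. ?K \<omega> \<partial>M) = (\<integral>\<^sup>+\<omega>. ennreal (indicator A \<omega> * ?K \<omega>) \<partial>M)"
        unfolding set_lebesgue_integral_def real_scaleR_def A
        using \<kappa>01 by (intro nn_integral_eq_integral[symmetric] integrable_const_bound[where B=1])
          (auto simp: indicator_def)
      also have "\<dots> = (\<integral>\<^sup>+\<omega>. emeasure (\<kappa> (\<Theta> \<omega>)) {..q n} * indicator C (\<Theta> \<omega>) \<partial>M)"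
        by (intro nn_integral_cong)
          (auto simp: A indicator_def finite_measure.emeasure_eq_measure[OF prob_space.finite_measure[OF \<kappa>prob]])
      also have "\<dots> = (\<integral>\<^sup>+\<theta>\<in>C. emeasure (\<kappa> \<theta>) {..q n} \<partial>distr M borel \<Theta>)"
        using measurable_emeasure_kernel'[OF \<kappa>, of "{..q n}"] by (subst nn_integral_distr) auto
      also have "\<dots> = ennreal (\<integral>\<omega>\<in>A. ?X \<omega> \<partial>M)"
        unfolding A X_int[OF C] using \<kappa>_eq by (simp add: emeasure_eq_measure)
      finally show "(\<integral>\<omega>\<in>A. ?X \<omega> \<partial>M) = (\<integral>\<omega>\<in>A. ?K \<omega> \<partial>M)"
        using \<kappa>01 by (subst (asm) ennreal_inj)
          (auto simp: set_lebesgue_integral_def indicator_def intro!: integral_nonneg_AE)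
    qed
    ultimately show ?thesis by eventually_elim simp
  qed
  have "(\<integral>\<^sup>+\<theta>\<in>C. emeasure (Pi\<^sub>M {1..} (\<lambda>_. \<kappa> \<theta>)) H \<partial>distr M borel \<Theta>) =
      emeasure M {\<omega> \<in> space M. \<Theta> \<omega> \<in> C \<and> (\<lambda>n\<in>{1..}. X n \<omega>) \<in> H}"
    if C [measurable]: "C \<in> sets borel" and H: "H \<in> sets (Pi\<^sub>M {1..} (\<lambda>_. borel))" for C H
  proof -
    let ?P = "Pi\<^sub>M {1..} (\<lambda>_. borel) :: (nat \<Rightarrow> real) measure" and ?Y = "\<lambda>\<omega>. \<lambda>n\<in>{1..}. X n \<omega>"
    let ?A = "\<Theta> -` C \<inter> space M"
    have A [measurable]: "?A \<in> events" by measurable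
    have Y [measurable]: "?Y \<in> M \<rightarrow>\<^sub>M ?P" by (intro measurable_restrict X)
    \<comment> \<open>For fixed \<open>C\<close> the restriction to the event
      \<open>\<Theta> \<in> C\<close> is absorbed into the measures, so the claim for all
      \<open>H\<close> is an instance of \<open>iid_mixtureI\<close>.\<close>
    define \<mu> where "\<mu> = distr (density M (indicator ?A)) ?P ?Y"
    define \<nu> where "\<nu> = density (distr M borel \<Theta>) (indicator C)"
    have \<mu>: "emeasure \<mu> S = emeasure M {\<omega> \<in> space M. \<Theta> \<omega> \<in> C \<and> ?Y \<omega> \<in> S}" if S: "S \<in> sets ?P" for S
    proof -
      have "emeasure \<mu> S = emeasure (density M (indicator ?A)) (?Y -` S \<inter> space M)"
        unfolding \<mu>_def using S Y by (subst emeasure_distr) (simp_all cong: measurable_cong_sets)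
      also have "\<dots> = emeasure M (?A \<inter> (?Y -` S \<inter> space M))"
        by (rule emeasure_restricted[OF A]) (rule measurable_sets[OF Y S])
      also have "?A \<inter> (?Y -` S \<inter> space M) = {\<omega> \<in> space M. \<Theta> \<omega> \<in> C \<and> ?Y \<omega> \<in> S}" by auto
      finally show ?thesis .
    qed
    have \<nu>: "(\<integral>\<^sup>+\<theta>. f \<theta> \<partial>\<nu>) = (\<integral>\<^sup>+\<theta>\<in>C. f \<theta> \<partial>distr M borel \<Theta>)" if "f \<in> borel_measurable borel" for f
      unfolding \<nu>_def using that by (subst nn_integral_density) (auto simp: mult.commute)
    have "emeasure \<mu> H = (\<integral>\<^sup>+\<theta>. emeasure (Pi\<^sub>M {1..} (\<lambda>_. \<kappa> \<theta>)) H \<partial>\<nu>)"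
    proof (rule iid_mixtureI[OF \<kappa> _ _ _ _ _ H])
      show "sets borel = sets \<nu>" "space \<nu> \<noteq> {}" by (simp_all add: \<nu>_def)
      show s: "sets \<mu> = sets ?P" by (simp add: \<mu>_def)
      show "finite_measure \<mu>"
        using \<mu>[OF sets.top] sets_eq_imp_space_eq[OF s] by (intro finite_measureI) simp
      fix r :: nat and w :: "nat \<Rightarrow> rat" assume r: "1 \<le> r"
      let ?w = "\<lambda>k. real_of_rat (w k)"
      have w: "?w k = q (to_nat (w k))" for k by (simp add: q_def)
      have AEw: "AE \<omega> in M. \<forall>k\<in>{1..r}. measure (\<kappa> (\<Theta> \<omega>)) {..?w k} = freq {..?w k} \<omega>"
        unfolding w using AE_freq by (intro AE_finite_allI) auto
      \<comment> \<open>The empty index set is written out to fit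
        \<open>expectation_freq_prod\<close>: every indicator becomes a frequency.\<close>
      have "emeasure \<mu> (lower_box r ?w) = emeasure M {\<omega> \<in> ?A. \<forall>j\<in>{1..r} \<union> {}. X j \<omega> \<in> {..?w j}}"
        unfolding \<mu>[OF sets_lower_box]
        by (intro arg_cong[where f="emeasure M"]) (auto simp: lower_box_def space_PiM)
      also have "\<dots> = ennreal (expectation (\<lambda>\<omega>. indicator ?A \<omega> * (\<Prod>i\<in>{1..r}. freq {..?w i} \<omega>) * (\<Prod>j\<in>{}. indicator {..?w j} (X j \<omega>))))"
        by (subst expectation_freq_prod) (auto intro: future C simp: emeasure_eq_measure)
      also have "\<dots> = (\<integral>\<^sup>+\<omega>. ennreal (indicator ?A \<omega> * (\<Prod>i\<in>{1..r}. freq {..?w i} \<omega>) * (\<Prod>j\<in>{}. indicator {..?w j} (X j \<omega>))) \<partial>M)"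
      proof (intro nn_integral_eq_integral[symmetric] integrable_const_bound[where B=1])
        show "AE \<omega> in M. norm (indicator ?A \<omega> * (\<Prod>i\<in>{1..r}. freq {..?w i} \<omega>) * (\<Prod>j\<in>{}. indicator {..?w j} (X j \<omega>)) :: real) \<le> 1"
          using prod_bounds_01[of "{1..r}" "\<lambda>i. freq {..?w i} _"] freq_bounds
          by (auto simp: indicator_def abs_mult intro!: mult_le_one)
        show "AE \<omega> in M. 0 \<le> indicator ?A \<omega> * (\<Prod>i\<in>{1..r}. freq {..?w i} \<omega>) * (\<Prod>j\<in>{}. indicator {..?w j} (X j \<omega>) :: real)"
          using freq_bounds by (auto simp: indicator_def intro!: prod_nonneg)
      qed measurable
      also have "\<dots> = (\<integral>\<^sup>+\<omega>. (\<Prod>k\<in>{1..r}. emeasure (\<kappa> (\<Theta> \<omega>)) {..?w k}) * indicator C (\<Theta> \<omega>) \<partial>M)"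
      proof (rule nn_integral_cong_AE)
        show "AE \<omega> in M. ennreal (indicator ?A \<omega> * (\<Prod>i\<in>{1..r}. freq {..?w i} \<omega>) * (\<Prod>j\<in>{}. indicator {..?w j} (X j \<omega>))) =
            (\<Prod>k\<in>{1..r}. emeasure (\<kappa> (\<Theta> \<omega>)) {..?w k}) * indicator C (\<Theta> \<omega>)"
          using AEw AE_space
        proof eventually_elim
          case (elim \<omega>)
          have "(\<Prod>k\<in>{1..r}. emeasure (\<kappa> (\<Theta> \<omega>)) {..?w k}) = (\<Prod>k\<in>{1..r}. ennreal (freq {..?w k} \<omega>))"
            using elim(1) by (intro prod.cong refl)
              (simp add: finite_measure.emeasure_eq_measure[OF prob_space.finite_measure[OF \<kappa>prob]])
          also have "\<dots> = ennreal (\<Prod>k\<in>{1..r}. freq {..?w k} \<omega>)"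
            using freq_bounds by (intro prod_ennreal) auto
          finally show ?case using elim(2) by (auto simp: indicator_def)
        qed
      qed
      also have "\<dots> = (\<integral>\<^sup>+\<theta>\<in>C. (\<Prod>k\<in>{1..r}. emeasure (\<kappa> \<theta>) {..?w k}) \<partial>distr M borel \<Theta>)"
        using measurable_emeasure_kernel'[OF \<kappa>]
        by (subst nn_integral_distr) (auto intro!: borel_measurable_times_ennreal borel_measurable_prod_ennreal)
      also have "\<dots> = (\<integral>\<^sup>+\<theta>. (\<Prod>k\<in>{1..r}. emeasure (\<kappa> \<theta>) {..?w k}) \<partial>\<nu>)"
        using measurable_emeasure_kernel'[OF \<kappa>]
        by (intro \<nu>[symmetric] borel_measurable_prod_ennreal) auto
      finally show "emeasure \<mu> (lower_box r ?w) = (\<integral>\<^sup>+\<theta>. (\<Prod>k\<in>{1..r}. emeasure (\<kappa> \<theta>) {..?w k}) \<partial>\<nu>)" .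
    qed
    also have "\<dots> = (\<integral>\<^sup>+\<theta>\<in>C. emeasure (Pi\<^sub>M {1..} (\<lambda>_. \<kappa> \<theta>)) H \<partial>distr M borel \<Theta>)"
      by (intro \<nu> measurable_emeasure_kernel'[OF measurable_PiM_iid[OF \<kappa>] H])
    finally show ?thesis using \<mu>[OF H] by simp
  qed
  then show ?thesis using \<kappa> \<Theta>m unfolding iid_given_def by blast
qed

end

subsection \<open>The six assertions\<close>

text \<open>Under a product of equal factors the probability of finitely many constraints depends on
  the sets \<open>B k\<close> but not on the distinct coordinates that carry them, and integration
  over \<open>y\<close> preserves this.\<close>

lemma exchangeable_iid_mixture:
  assumes "prob_space M"
    and X [measurable]: "\<And>n. X n \<in> borel_measurable M"
    and \<kappa>: "\<And>y. y \<in> space \<nu> \<Longrightarrow> prob_space (\<kappa> y) \<and> sets (\<kappa> y) = sets borel"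
    and eq: "\<And>H. H \<in> sets (Pi\<^sub>M {1..} (\<lambda>_. borel)) \<Longrightarrow>
      emeasure M {\<omega> \<in> space M. (\<lambda>n\<in>{1..}. X n \<omega>) \<in> H} = (\<integral>\<^sup>+y. emeasure (Pi\<^sub>M {1..} (\<lambda>_. \<kappa> y)) H \<partial>\<nu>)"
  shows "exchangeable M X {1..}"
proof -
  interpret prob_space M by fact
  have law: "emeasure M (\<Inter>k\<in>{1..r}. X (i k) -` B k \<inter> space M) = (\<integral>\<^sup>+y. (\<Prod>k\<in>{1..r}. emeasure (\<kappa> y) (B k)) \<partial>\<nu>)"
    if r: "1 \<le> r" and i: "i ` {1..r} \<subseteq> {1..}" "inj_on i {1..r}" and B: "\<forall>k\<in>{1..r}. B k \<in> sets borel"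
    for r :: nat and i :: "nat \<Rightarrow> nat" and B
  proof -
    \<comment> \<open>The constraints are re-indexed by coordinate, which is unambiguous because
      \<open>i\<close> is injective.\<close>
    define D where "D = (\<lambda>j. B (inv_into {1..r} i j))"
    have Di: "D (i k) = B k" if "k \<in> {1..r}" for k using that i(2) by (simp add: D_def)
    have Db: "D j \<in> sets borel" if "j \<in> i ` {1..r}" for j using that B Di by auto
    let ?H = "{x \<in> space (Pi\<^sub>M {1..} (\<lambda>_. borel :: real measure)). \<forall>j\<in>i ` {1..r}. x j \<in> D j}"
    have H: "?H \<in> sets (Pi\<^sub>M {1..} (\<lambda>_. borel))"
      using Db i(1) by (intro sets.sets_Collect_finite_All sets_Collect_single') auto
    have "(\<Inter>k\<in>{1..r}. X (i k) -` B k \<inter> space M) = {\<omega> \<in> space M. (\<lambda>n\<in>{1..}. X n \<omega>) \<in> ?H}"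
      using r i(1) by (auto simp: Di space_PiM)
    then have "emeasure M (\<Inter>k\<in>{1..r}. X (i k) -` B k \<inter> space M) = (\<integral>\<^sup>+y. emeasure (Pi\<^sub>M {1..} (\<lambda>_. \<kappa> y)) ?H \<partial>\<nu>)"
      using eq[OF H] by simp
    also have "\<dots> = (\<integral>\<^sup>+y. (\<Prod>k\<in>{1..r}. emeasure (\<kappa> y) (B k)) \<partial>\<nu>)"
    proof (rule nn_integral_cong)
      fix y assume y: "y \<in> space \<nu>"
      have "emeasure (Pi\<^sub>M {1..} (\<lambda>_. \<kappa> y)) ?H = (\<Prod>j\<in>i ` {1..r}. emeasure (\<kappa> y) (D j))"
        using \<kappa>[OF y] i(1) Db by (intro emeasure_PiM_iid) auto
      also have "\<dots> = (\<Prod>k\<in>{1..r}. emeasure (\<kappa> y) (B k))"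
        using i(2) Di by (subst prod.reindex) auto
      finally show "emeasure (Pi\<^sub>M {1..} (\<lambda>_. \<kappa> y)) ?H = (\<Prod>k\<in>{1..r}. emeasure (\<kappa> y) (B k))" .
    qed
    finally show ?thesis .
  qed
  show ?thesis
    unfolding exchangeable_def measure_def by (intro allI impI) (simp only: law)
qed

lemma distr_PiM_iid_component:
  assumes "prob_space K" "n \<in> I"
  shows "distr (Pi\<^sub>M I (\<lambda>_. K)) K (\<lambda>x. x n) = K"
proof -
  interpret prob_space K by fact
  interpret product_prob_space "\<lambda>_. K" I by unfold_locales
  show ?thesis by (rule PiM_component) fact
qed

text \<open>Turns equality of laws into countably many numerical conditions, so that it can be
  handled as a measurable event in a parameter.\<close>

lemma real_measure_eqI_rat:
  fixes M N :: "real measure"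
  assumes M: "finite_measure M" "sets M = sets borel" and N: "sets N = sets borel"
    and eq: "\<And>q. emeasure M {real_of_rat q <..} = emeasure N {real_of_rat q <..}"
  shows "M = N"
proof (rule measure_eqI_lessThan[OF M(2) N])
  fix x :: real
  show "emeasure M {x<..} < \<infinity>" using finite_measure.emeasure_finite[OF M(1)] by (simp add: less_top)
  obtain q where q: "decseq q" "\<And>n. x < real_of_rat (q n)" "\<And>y. x < y \<Longrightarrow> \<exists>n. real_of_rat (q n) < y"
    using ex_decseq_rat[of x] by blast
  have U: "{x<..} = (\<Union>n. {real_of_rat (q n) <..})" using q(2,3) by (auto intro: less_trans)
  have "real_of_rat (q n) \<le> real_of_rat (q m)" if "m \<le> n" for m n
    using q(1) that by (simp add: decseq_def of_rat_less_eq)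
  then have inc: "incseq (\<lambda>n. {real_of_rat (q n) <..})" by (auto simp: incseq_def intro: le_less_trans)
  have "range (\<lambda>n. {real_of_rat (q n) <..}) \<subseteq> sets M" "range (\<lambda>n. {real_of_rat (q n) <..}) \<subseteq> sets N"
    unfolding M(2) N by (rule image_subsetI, rule borel_open, rule open_greaterThan)+
  note SUP = this[THEN SUP_emeasure_incseq, OF inc, folded U]
  have "emeasure M {x<..} = (SUP n. emeasure M {real_of_rat (q n) <..})" by (rule SUP(1)[symmetric])
  also have "\<dots> = (SUP n. emeasure N {real_of_rat (q n) <..})" by (simp add: eq)
  also have "\<dots> = emeasure N {x<..}" by (rule SUP(2))
  finally show "emeasure M {x<..} = emeasure N {x<..}" .
qed

section \<open>Conditioning on the directing variable\<close>

lemma iid_given_nn_integral: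
  assumes "iid_given M X T \<Theta> \<kappa>" and C: "C \<in> sets T" and H: "H \<in> sets (Pi\<^sub>M {1..} (\<lambda>_. borel))"
  shows "(\<integral>\<^sup>+\<omega>. emeasure (Pi\<^sub>M {1..} (\<lambda>_. \<kappa> (\<Theta> \<omega>))) H * indicator C (\<Theta> \<omega>) \<partial>M) =
    emeasure M {\<omega> \<in> space M. \<Theta> \<omega> \<in> C \<and> (\<lambda>n\<in>{1..}. X n \<omega>) \<in> H}"
proof -
  have \<Theta>: "\<Theta> \<in> M \<rightarrow>\<^sub>M T" and \<kappa>: "\<kappa> \<in> T \<rightarrow>\<^sub>M prob_algebra borel"
    and eq: "(\<integral>\<^sup>+\<theta>\<in>C. emeasure (Pi\<^sub>M {1..} (\<lambda>_. \<kappa> \<theta>)) H \<partial>distr M T \<Theta>) =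
      emeasure M {\<omega> \<in> space M. \<Theta> \<omega> \<in> C \<and> (\<lambda>n\<in>{1..}. X n \<omega>) \<in> H}"
    using assms by (auto simp: iid_given_def)
  show ?thesis
    unfolding eq[symmetric] using \<Theta> C measurable_emeasure_kernel'[OF measurable_PiM_iid[OF \<kappa>] H]
    by (subst nn_integral_distr) auto
qed

text \<open>A real variable is embedded diagonally. All components of the vector coincide, so the
  arbitrary component \<open>undefined\<close> recovers it.\<close>

lemma iid_given_real_vec:
  fixes \<Theta> :: "'a \<Rightarrow> real"
  assumes iid: "iid_given M X borel \<Theta> \<kappa>"
  shows "iid_given M X borel (\<lambda>\<omega>. (\<chi> i. \<Theta> \<omega>) :: real ^ 'd) (\<lambda>\<theta>. \<kappa> (\<theta> $ (undefined :: 'd::finite)))"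
proof -
  have \<Theta> [measurable]: "\<Theta> \<in> borel_measurable M" and \<kappa>: "\<kappa> \<in> borel \<rightarrow>\<^sub>M prob_algebra borel"
    using iid by (auto simp: iid_given_def)
  have v [measurable]: "(\<lambda>x::real. (\<chi> i. x) :: real ^ 'd) \<in> borel_measurable borel"
    by (intro borel_measurable_continuous_onI continuous_on_vec_lambda continuous_on_id)
  have c [measurable]: "(\<lambda>\<theta> :: real ^ 'd. \<theta> $ undefined) \<in> borel_measurable borel"
    by (intro borel_measurable_continuous_onI continuous_on_component continuous_on_id)
  have \<kappa>': "(\<lambda>\<theta> :: real ^ 'd. \<kappa> (\<theta> $ undefined)) \<in> borel \<rightarrow>\<^sub>M prob_algebra borel"
    by (rule measurable_compose[OF c \<kappa>])
  show ?thesis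
    unfolding iid_given_def
  proof (intro conjI ballI \<kappa>')
    show "(\<lambda>\<omega>. (\<chi> i. \<Theta> \<omega>) :: real ^ 'd) \<in> borel_measurable M" by measurable
    fix C :: "(real ^ 'd) set" and H assume C [measurable]: "C \<in> sets borel" and H: "H \<in> sets (Pi\<^sub>M {1::nat..} (\<lambda>_. borel :: real measure))"
    have C': "(\<lambda>x. (\<chi> i. x)) -` C \<in> sets borel" using measurable_sets[OF v C] by simp
    have "(\<integral>\<^sup>+\<theta>\<in>C. emeasure (Pi\<^sub>M {1..} (\<lambda>_. \<kappa> (\<theta> $ undefined))) H \<partial>distr M borel (\<lambda>\<omega>. \<chi> i. \<Theta> \<omega>)) =
        (\<integral>\<^sup>+\<omega>. emeasure (Pi\<^sub>M {1..} (\<lambda>_. \<kappa> (\<Theta> \<omega>))) H * indicator ((\<lambda>x. (\<chi> i. x)) -` C) (\<Theta> \<omega>) \<partial>M)"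
      using measurable_emeasure_kernel'[OF measurable_PiM_iid[OF \<kappa>'] H]
      by (subst nn_integral_distr) (auto simp: indicator_def)
    also have "\<dots> = emeasure M {\<omega> \<in> space M. (\<chi> i. \<Theta> \<omega>) \<in> C \<and> (\<lambda>n\<in>{1..}. X n \<omega>) \<in> H}"
      using iid_given_nn_integral[OF iid C' H] by simp
    finally show "(\<integral>\<^sup>+\<theta>\<in>C. emeasure (Pi\<^sub>M {1..} (\<lambda>_. \<kappa> (\<theta> $ undefined))) H \<partial>distr M borel (\<lambda>\<omega>. \<chi> i. \<Theta> \<omega>)) =
        emeasure M {\<omega> \<in> space M. (\<chi> i. \<Theta> \<omega>) \<in> C \<and> (\<lambda>n\<in>{1..}. X n \<omega>) \<in> H}" .
  qed
qed

lemma sets_sigma_gen: "sets (sigma_gen M X) = {X -` B \<inter> space M | B. B \<in> sets borel}"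
  by (simp add: sigma_gen_def sets_vimage_algebra2)

lemma space_sigma_gen [simp]: "space (sigma_gen M X) = space M"
  by (simp add: sigma_gen_def)

lemma measurable_sigma_gen: "X \<in> borel_measurable (sigma_gen M X)"
  unfolding sigma_gen_def by (rule measurable_vimage_algebra1) simp

lemma subalgebra_sigma_gen: "X \<in> borel_measurable M \<Longrightarrow> subalgebra M (sigma_gen M X)"
  by (auto simp: subalgebra_def sets_sigma_gen)

text \<open>The product on the right is a function of \<open>\<Theta>\<close>, and by
  \<open>iid_given\<close> its integral over an event \<open>\<Theta> \<in> C\<close> is the joint
  probability; this characterises the conditional expectation. One index yields the conditional
  distributions, several yield the factorisation.\<close>

lemma (in prob_space) cond_prob_iid_given:
  fixes \<Theta> :: "'a \<Rightarrow> 't::topological_space"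
  assumes iid: "iid_given M X borel \<Theta> K" and X: "\<And>n. X n \<in> borel_measurable M"
    and J: "finite J" "J \<subseteq> {1..}" and B: "\<And>j. j \<in> J \<Longrightarrow> B j \<in> sets borel"
  shows "AE \<omega> in M. cond_prob_given M (sigma_gen M \<Theta>) {\<omega> \<in> space M. \<forall>j\<in>J. X j \<omega> \<in> B j} \<omega> =
    (\<Prod>j\<in>J. measure (K (\<Theta> \<omega>)) (B j))"
proof -
  have \<Theta> [measurable]: "\<Theta> \<in> borel_measurable M" and K: "K \<in> borel \<rightarrow>\<^sub>M prob_algebra borel"
    using iid by (auto simp: iid_given_def)
  interpret G: finite_measure_subalgebra M "sigma_gen M \<Theta>"
    by unfold_locales (rule subalgebra_sigma_gen[OF \<Theta>])
  note K' = prob_kernelD[OF K]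
  let ?E = "{\<omega> \<in> space M. \<forall>j\<in>J. X j \<omega> \<in> B j}" and ?g = "\<lambda>\<omega>. \<Prod>j\<in>J. measure (K (\<Theta> \<omega>)) (B j)"
  have E [measurable]: "?E \<in> events"
    using J B X by (intro sets.sets_Collect_finite_All) auto
  have g01: "0 \<le> ?g \<omega>" "?g \<omega> \<le> 1" for \<omega>
    using prob_space.prob_le_1[OF K'(1)] by (auto intro!: prod_bounds_01)
  have gT: "(\<lambda>\<theta>. \<Prod>j\<in>J. measure (K \<theta>) (B j)) \<in> borel_measurable borel"
    unfolding measure_def using measurable_emeasure_kernel'[OF K B] by measurable
  have g [measurable]: "?g \<in> borel_measurable M" and gG: "?g \<in> borel_measurable (sigma_gen M \<Theta>)"
    using measurable_compose[OF \<Theta> gT] measurable_compose[OF measurable_sigma_gen gT] by auto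
  show ?thesis
    unfolding cond_prob_given_def
  proof (rule G.real_cond_exp_charact[OF _ _ _ gG])
    show "integrable M (indicator ?E :: 'a \<Rightarrow> real)"
      by (intro integrable_real_indicator E) (simp add: less_top[symmetric])
    show "integrable M ?g" using g01 by (intro integrable_const_bound[where B=1]) auto
    fix A assume "A \<in> sets (sigma_gen M \<Theta>)"
    then obtain C where C [measurable]: "C \<in> sets borel" and A: "A = \<Theta> -` C \<inter> space M"
      by (auto simp: sets_sigma_gen)
    have [measurable]: "A \<in> events" unfolding A by measurable
    let ?H = "{x \<in> space (Pi\<^sub>M {1..} (\<lambda>_. borel :: real measure)). \<forall>j\<in>J. x j \<in> B j}"
    have H: "?H \<in> sets (Pi\<^sub>M {1..} (\<lambda>_. borel))"
      using J B by (intro sets.sets_Collect_finite_All sets_Collect_single') auto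
    have "ennreal (\<integral>\<omega>\<in>A. ?g \<omega> \<partial>M) = (\<integral>\<^sup>+\<omega>. ennreal (indicator A \<omega> * ?g \<omega>) \<partial>M)"
      unfolding set_lebesgue_integral_def real_scaleR_def using g01
      by (intro nn_integral_eq_integral[symmetric] integrable_const_bound[where B=1])
        (auto simp: indicator_def)
    also have "\<dots> = (\<integral>\<^sup>+\<omega>. emeasure (Pi\<^sub>M {1..} (\<lambda>_. K (\<Theta> \<omega>))) ?H * indicator C (\<Theta> \<omega>) \<partial>M)"
    proof (rule nn_integral_cong)
      fix \<omega> assume \<omega>: "\<omega> \<in> space M"
      interpret K: prob_space "K (\<Theta> \<omega>)" by (rule K') simp
      have "emeasure (Pi\<^sub>M {1..} (\<lambda>_. K (\<Theta> \<omega>))) ?H = (\<Prod>j\<in>J. emeasure (K (\<Theta> \<omega>)) (B j))"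
        using J B K' by (intro emeasure_PiM_iid) auto
      also have "\<dots> = ennreal (?g \<omega>)" by (simp add: K.emeasure_eq_measure prod_ennreal)
      finally show "ennreal (indicator A \<omega> * ?g \<omega>) = emeasure (Pi\<^sub>M {1..} (\<lambda>_. K (\<Theta> \<omega>))) ?H * indicator C (\<Theta> \<omega>)"
        using \<omega> by (auto simp: A indicator_def)
    qed
    also have "\<dots> = emeasure M {\<omega> \<in> space M. \<Theta> \<omega> \<in> C \<and> (\<lambda>n\<in>{1..}. X n \<omega>) \<in> ?H}"
      by (rule iid_given_nn_integral[OF iid C H])
    also have "{\<omega> \<in> space M. \<Theta> \<omega> \<in> C \<and> (\<lambda>n\<in>{1..}. X n \<omega>) \<in> ?H} = A \<inter> ?E"
      using J(2) by (auto simp: A space_PiM)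
    also have "emeasure M (A \<inter> ?E) = ennreal (\<integral>\<omega>\<in>A. indicator ?E \<omega> \<partial>M)"
      by (simp add: set_lebesgue_integral_def emeasure_eq_measure indicator_inter_arith[symmetric])
    finally show "(\<integral>\<omega>\<in>A. indicator ?E \<omega> \<partial>M) = (\<integral>\<omega>\<in>A. ?g \<omega> \<partial>M)"
      using g01 by (subst (asm) ennreal_inj)
        (auto simp: set_lebesgue_integral_def indicator_def intro!: integral_nonneg_AE)
  qed
qed

section \<open>Implications among assertions (i) to (iv)\<close>

locale counting = prob_space M for M :: "'a measure" +
  fixes N :: "real \<Rightarrow> 'a \<Rightarrow> enat"
  assumes counting: "counting_process M N"
begin

abbreviation "X \<equiv> interarrival_time N"
abbreviation "Seq \<equiv> Pi\<^sub>M {1..} (\<lambda>_. borel) :: (nat \<Rightarrow> real) measure"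

lemma X [measurable]: "X n \<in> borel_measurable M"
  by (rule borel_measurable_interarrival_time[OF counting])

lemma measurable_seq: "interarrival_seq N \<in> M \<rightarrow>\<^sub>M Seq"
  unfolding interarrival_seq_def by (intro measurable_restrict X)

text \<open>Independence and equal marginals together are a single equation between laws on sequence
  space, which can be integrated over a parameter and checked on boxes.\<close>

lemma renewal_process_iff:
  assumes P: "prob_space P" "sets P = sets M" and K: "prob_space K" "sets K = sets borel"
  shows "renewal_process P K N \<longleftrightarrow> distr P Seq (interarrival_seq N) = Pi\<^sub>M {1..} (\<lambda>_. K)"
proof -
  interpret P: prob_space P by fact
  have XP [measurable]: "X n \<in> borel_measurable P" for n
    using X[of n] measurable_cong_sets[OF P(2) refl] by blast
  have seqP: "interarrival_seq N \<in> P \<rightarrow>\<^sub>M Seq"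
    using measurable_seq measurable_cong_sets[OF P(2) refl] by blast
  have indep: "P.indep_vars (\<lambda>_. borel) X {1..} \<longleftrightarrow>
      distr P Seq (interarrival_seq N) = Pi\<^sub>M {1..} (\<lambda>n. distr P borel (X n))"
    unfolding interarrival_seq_def[abs_def] by (rule P.indep_vars_iff_distr_eq_PiM') auto
  show ?thesis
  proof
    assume r: "renewal_process P K N"
    then have "Pi\<^sub>M {1..} (\<lambda>n. distr P borel (X n)) = Pi\<^sub>M {1..} (\<lambda>_. K)"
      by (intro PiM_cong) (auto simp: renewal_process_def)
    then show "distr P Seq (interarrival_seq N) = Pi\<^sub>M {1..} (\<lambda>_. K)"
      using r indep by (simp add: renewal_process_def)
  next
    assume eq: "distr P Seq (interarrival_seq N) = Pi\<^sub>M {1..} (\<lambda>_. K)"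
    have XK: "distr P borel (X n) = K" if "1 \<le> n" for n
    proof -
      have "distr P borel (X n) = distr P borel ((\<lambda>x. x n) \<circ> interarrival_seq N)"
        using that by (intro distr_cong) (auto simp: interarrival_seq_def)
      also have "\<dots> = distr (distr P Seq (interarrival_seq N)) borel (\<lambda>x. x n)"
        using that by (intro distr_distr[symmetric] seqP measurable_component_singleton) auto
      also have "\<dots> = distr (Pi\<^sub>M {1..} (\<lambda>_. K)) K (\<lambda>x. x n)"
        unfolding eq using K(2) by (intro distr_cong) auto
      also have "\<dots> = K" using that by (intro distr_PiM_iid_component K) simp
      finally show ?thesis .
    qed
    then have "Pi\<^sub>M {1..} (\<lambda>n. distr P borel (X n)) = Pi\<^sub>M {1..} (\<lambda>_. K)" by (intro PiM_cong) auto
    then show "renewal_process P K N" using XK eq indep by (simp add: renewal_process_def)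
  qed
qed

lemma iii_if_iid_mixture:
  assumes "\<And>y. y \<in> space \<nu> \<Longrightarrow> prob_space (\<kappa> y) \<and> sets (\<kappa> y) = sets borel"
    and "\<And>H. H \<in> sets Seq \<Longrightarrow>
      emeasure M (interarrival_seq N -` H \<inter> space M) = (\<integral>\<^sup>+y. emeasure (Pi\<^sub>M {1..} (\<lambda>_. \<kappa> y)) H \<partial>\<nu>)"
  shows "assertion_iii M N"
  unfolding assertion_iii_def
proof (rule exchangeable_iid_mixture[OF prob_space_axioms X assms(1)])
  fix H assume "H \<in> sets Seq"
  moreover have "{\<omega> \<in> space M. (\<lambda>n\<in>{1..}. X n \<omega>) \<in> H} = interarrival_seq N -` H \<inter> space M"
    by (auto simp: interarrival_seq_def)
  ultimately show "emeasure M {\<omega> \<in> space M. (\<lambda>n\<in>{1..}. X n \<omega>) \<in> H} = (\<integral>\<^sup>+y. emeasure (Pi\<^sub>M {1..} (\<lambda>_. \<kappa> y)) H \<partial>\<nu>)"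
    using assms(2) by simp
qed

text \<open>Over the whole space the integral equation presents the law of the sequence as a mixture
  of product laws.\<close>

lemma iv_imp_iii: "assertion_iv M N \<Longrightarrow> assertion_iii M N"
proof -
  assume "assertion_iv M N"
  then obtain F Q where F: "subalgebra M F" and Q: "Q \<in> F \<rightarrow>\<^sub>M prob_algebra borel"
    and eq: "\<And>H A. H \<in> sets Seq \<Longrightarrow> A \<in> sets F \<Longrightarrow>
      (\<integral>\<^sup>+\<omega>\<in>A. emeasure (Pi\<^sub>M {1..} (\<lambda>_. Q \<omega>)) H \<partial>restr_to_subalg M F) = emeasure M (A \<inter> (interarrival_seq N -` H \<inter> space M))"
    unfolding assertion_iv_def by blast
  have sp: "space F = space M" using F by (simp add: subalgebra_def)
  show ?thesis
  proof (rule iii_if_iid_mixture)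
    show "prob_space (Q y) \<and> sets (Q y) = sets borel" if "y \<in> space (restr_to_subalg M F)" for y
      using prob_kernelD[OF Q] that sp by (simp add: space_restr_to_subalg)
    show "emeasure M (interarrival_seq N -` H \<inter> space M) = (\<integral>\<^sup>+y. emeasure (Pi\<^sub>M {1..} (\<lambda>_. Q y)) H \<partial>restr_to_subalg M F)"
      if "H \<in> sets Seq" for H
    proof -
      have "emeasure M (space F \<inter> (interarrival_seq N -` H \<inter> space M)) =
          (\<integral>\<^sup>+\<omega>\<in>space F. emeasure (Pi\<^sub>M {1..} (\<lambda>_. Q \<omega>)) H \<partial>restr_to_subalg M F)"
        using eq[OF that sets.top] by simp
      also have "\<dots> = (\<integral>\<^sup>+y. emeasure (Pi\<^sub>M {1..} (\<lambda>_. Q y)) H \<partial>restr_to_subalg M F)"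
        by (intro nn_integral_cong) (simp add: space_restr_to_subalg sp)
      finally show ?thesis by (simp add: sp Int_absorb1)
    qed
  qed
qed

lemma ii_imp_iii: "assertion_ii TYPE('d::finite) M N \<Longrightarrow> assertion_iii M N"
proof -
  assume "assertion_ii TYPE('d) M N"
  then obtain \<Theta> :: "'a \<Rightarrow> real ^ 'd" and Pt K where
    \<Theta>: "\<Theta> \<in> borel_measurable M" and dis: "consistent_disintegration M \<Theta> Pt"
    and K: "K \<in> borel \<rightarrow>\<^sub>M prob_algebra borel"
    and ren: "AE \<theta> in distr M borel \<Theta>. renewal_process (Pt \<theta>) (K \<theta>) N"
    unfolding assertion_ii_def by blast
  have Pt: "Pt \<in> borel \<rightarrow>\<^sub>M prob_algebra M" using dis by (simp add: consistent_disintegration_def)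
  show ?thesis
  proof (rule iii_if_iid_mixture)
    show "prob_space (K y) \<and> sets (K y) = sets borel" for y using prob_kernelD[OF K, of y] by simp
    fix H assume H: "H \<in> sets Seq"
    have "emeasure M (interarrival_seq N -` H \<inter> space M) =
        (\<integral>\<^sup>+\<theta>. emeasure (Pt \<theta>) (interarrival_seq N -` H \<inter> space M) \<partial>distr M borel \<Theta>)"
      using dis measurable_sets[OF measurable_seq H] by (simp add: consistent_disintegration_def)
    also have "\<dots> = (\<integral>\<^sup>+\<theta>. emeasure (Pi\<^sub>M {1..} (\<lambda>_. K \<theta>)) H \<partial>distr M borel \<Theta>)"
    proof (rule nn_integral_cong_AE)
      show "AE \<theta> in distr M borel \<Theta>. emeasure (Pt \<theta>) (interarrival_seq N -` H \<inter> space M) = emeasure (Pi\<^sub>M {1..} (\<lambda>_. K \<theta>)) H"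
        using ren
      proof eventually_elim
        case (elim \<theta>)
        have P: "prob_space (Pt \<theta>)" "sets (Pt \<theta>) = sets M" using prob_kernelD[OF Pt, of \<theta>] by simp_all
        have "distr (Pt \<theta>) Seq (interarrival_seq N) = Pi\<^sub>M {1..} (\<lambda>_. K \<theta>)"
          using elim renewal_process_iff[OF P] prob_kernelD[OF K, of \<theta>] by simp
        moreover have "interarrival_seq N \<in> Pt \<theta> \<rightarrow>\<^sub>M Seq"
          using measurable_seq measurable_cong_sets[OF P(2) refl] by blast
        ultimately show ?case
          using emeasure_distr[of "interarrival_seq N" "Pt \<theta>" Seq H] H sets_eq_imp_space_eq[OF P(2)] by simp
      qed
    qed
    finally show "emeasure M (interarrival_seq N -` H \<inter> space M) = (\<integral>\<^sup>+y. emeasure (Pi\<^sub>M {1..} (\<lambda>_. K y)) H \<partial>distr M borel \<Theta>)" .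
  qed
qed

lemma iii_imp_iid_given:
  assumes "assertion_iii M N"
  obtains \<Theta> :: "'a \<Rightarrow> real" and \<kappa> where "iid_given M X borel \<Theta> \<kappa>"
proof -
  interpret exchangeable_seq M X
    using assms by unfold_locales (auto simp: assertion_iii_def)
  show ?thesis using de_Finetti that by blast
qed

text \<open>By \<open>cond_prob_iid_given\<close> products of kernel values are versions of the
  joint conditional probabilities; replacing each factor by its one-index version gives conditional
  independence.\<close>

lemma iii_imp_i: "assertion_iii M N \<Longrightarrow> assertion_i TYPE('d::finite) M N"
proof -
  assume "assertion_iii M N"
  then obtain \<Theta>0 :: "'a \<Rightarrow> real" and \<kappa>0 where "iid_given M X borel \<Theta>0 \<kappa>0" by (rule iii_imp_iid_given)
  from iid_given_real_vec[OF this] obtain \<Theta> :: "'a \<Rightarrow> real ^ 'd" and K where iid: "iid_given M X borel \<Theta> K" by blast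
  have \<Theta>: "\<Theta> \<in> borel_measurable M" and K: "K \<in> borel \<rightarrow>\<^sub>M prob_algebra borel"
    using iid by (auto simp: iid_given_def)
  note cp = cond_prob_iid_given[OF iid X]
  have single: "AE \<omega> in M. cond_prob_given M (sigma_gen M \<Theta>) (X n -` B \<inter> space M) \<omega> = measure (K (\<Theta> \<omega>)) B"
    if "1 \<le> n" "B \<in> sets borel" for n B
  proof -
    have "{\<omega> \<in> space M. \<forall>j\<in>{n}. X j \<omega> \<in> B} = X n -` B \<inter> space M" by auto
    then show ?thesis using cp[of "{n}" "\<lambda>_. B"] that by simp
  qed
  have "cond_indep_given M (sigma_gen M \<Theta>) X {1..}"
    unfolding cond_indep_given_def
  proof (intro allI impI)
    fix J :: "nat set" and E assume J: "J \<subseteq> {1..}" "finite J" "2 \<le> card J"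
      and E: "\<forall>j\<in>J. E j \<in> sets (sigma_gen M (X j))"
    from E have "\<exists>B. \<forall>j\<in>J. B j \<in> sets borel \<and> E j = X j -` B j \<inter> space M"
      by (intro bchoice) (auto simp: sets_sigma_gen)
    then obtain B where B: "\<And>j. j \<in> J \<Longrightarrow> B j \<in> sets borel" and EB: "\<And>j. j \<in> J \<Longrightarrow> E j = X j -` B j \<inter> space M" by blast
    have "J \<noteq> {}" using J(3) by auto
    then have "(\<Inter>j\<in>J. E j) = {\<omega> \<in> space M. \<forall>j\<in>J. X j \<omega> \<in> B j}" using EB by auto
    then have "AE \<omega> in M. cond_prob_given M (sigma_gen M \<Theta>) (\<Inter>j\<in>J. E j) \<omega> = (\<Prod>j\<in>J. measure (K (\<Theta> \<omega>)) (B j))"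
      using cp[OF J(2,1) B] by simp
    moreover have "AE \<omega> in M. \<forall>j\<in>J. cond_prob_given M (sigma_gen M \<Theta>) (E j) \<omega> = measure (K (\<Theta> \<omega>)) (B j)"
    proof (rule AE_finite_allI[OF J(2)])
      fix j assume "j \<in> J"
      then show "AE \<omega> in M. cond_prob_given M (sigma_gen M \<Theta>) (E j) \<omega> = measure (K (\<Theta> \<omega>)) (B j)"
        using single[of j "B j"] J(1) B EB by auto
    qed
    ultimately show "AE \<omega> in M. cond_prob_given M (sigma_gen M \<Theta>) (\<Inter>j\<in>J. E j) \<omega> = (\<Prod>j\<in>J. cond_prob_given M (sigma_gen M \<Theta>) (E j) \<omega>)"
      by eventually_elim simp
  qed
  moreover have "is_cond_distribution M (sigma_gen M \<Theta>) (X n) (\<lambda>\<omega>. K (\<Theta> \<omega>))" if "1 \<le> n" for n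
    unfolding is_cond_distribution_def
  proof (intro conjI ballI)
    show "(\<lambda>\<omega>. K (\<Theta> \<omega>)) \<in> sigma_gen M \<Theta> \<rightarrow>\<^sub>M prob_algebra borel"
      by (rule measurable_compose[OF measurable_sigma_gen K])
    show "AE \<omega> in M. measure (K (\<Theta> \<omega>)) B = cond_prob_given M (sigma_gen M \<Theta>) (X n -` B \<inter> space M) \<omega>"
      if "B \<in> sets borel" for B
      using single[OF \<open>1 \<le> n\<close> that] by eventually_elim simp
  qed
  \<comment> \<open>The kernel composed with \<open>\<Theta>\<close> is itself a version of the
    conditional distribution, so the exceptional set is empty.\<close>
  moreover have "kernels_eq_as M (sigma_gen M \<Theta>) (\<lambda>\<omega>. K (\<Theta> \<omega>)) (\<lambda>\<omega>. K (\<Theta> \<omega>))"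
    unfolding kernels_eq_as_def by (intro bexI[of _ "{}"]) auto
  ultimately have "mixed_renewal_process M K \<Theta> N" unfolding mixed_renewal_process_def by blast
  then show ?thesis using \<Theta> K unfolding assertion_i_def by blast
qed

text \<open>Each event of the \<sigma>-algebra generated by \<open>\<Theta>\<close> has the form
  \<open>\<Theta> \<in> C\<close>, so \<open>iid_given\<close> covers all of them.\<close>

lemma iii_imp_iv: "assertion_iii M N \<Longrightarrow> assertion_iv M N"
proof -
  assume "assertion_iii M N"
  then obtain \<Theta> :: "'a \<Rightarrow> real" and \<kappa> where iid: "iid_given M X borel \<Theta> \<kappa>" by (rule iii_imp_iid_given)
  have \<Theta>: "\<Theta> \<in> borel_measurable M" and \<kappa>: "\<kappa> \<in> borel \<rightarrow>\<^sub>M prob_algebra borel"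
    using iid by (auto simp: iid_given_def)
  let ?F = "sigma_gen M \<Theta>"
  have F: "subalgebra M ?F" by (rule subalgebra_sigma_gen[OF \<Theta>])
  have Q: "(\<lambda>\<omega>. \<kappa> (\<Theta> \<omega>)) \<in> ?F \<rightarrow>\<^sub>M prob_algebra borel"
    by (rule measurable_compose[OF measurable_sigma_gen \<kappa>])
  have "(\<integral>\<^sup>+\<omega>\<in>A. emeasure (Pi\<^sub>M {1..} (\<lambda>_. \<kappa> (\<Theta> \<omega>))) H \<partial>restr_to_subalg M ?F) =
      emeasure M (A \<inter> (interarrival_seq N -` H \<inter> space M))" if H: "H \<in> sets Seq" and A: "A \<in> sets ?F" for H A
  proof -
    obtain C where C: "C \<in> sets borel" "A = \<Theta> -` C \<inter> space M" using A by (auto simp: sets_sigma_gen)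
    have "(\<integral>\<^sup>+\<omega>\<in>A. emeasure (Pi\<^sub>M {1..} (\<lambda>_. \<kappa> (\<Theta> \<omega>))) H \<partial>restr_to_subalg M ?F) =
        (\<integral>\<^sup>+\<omega>\<in>A. emeasure (Pi\<^sub>M {1..} (\<lambda>_. \<kappa> (\<Theta> \<omega>))) H \<partial>M)"
      using measurable_emeasure_kernel'[OF measurable_PiM_iid[OF Q] H] A
      by (intro nn_integral_subalgebra2[OF F] borel_measurable_times_ennreal borel_measurable_indicator) auto
    also have "\<dots> = (\<integral>\<^sup>+\<omega>. emeasure (Pi\<^sub>M {1..} (\<lambda>_. \<kappa> (\<Theta> \<omega>))) H * indicator C (\<Theta> \<omega>) \<partial>M)"
      by (intro nn_integral_cong) (auto simp: C(2) indicator_def)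
    also have "\<dots> = emeasure M {\<omega> \<in> space M. \<Theta> \<omega> \<in> C \<and> (\<lambda>n\<in>{1..}. X n \<omega>) \<in> H}"
      by (rule iid_given_nn_integral[OF iid C(1) H])
    also have "{\<omega> \<in> space M. \<Theta> \<omega> \<in> C \<and> (\<lambda>n\<in>{1..}. X n \<omega>) \<in> H} = A \<inter> (interarrival_seq N -` H \<inter> space M)"
      by (auto simp: C(2) interarrival_seq_def)
    finally show ?thesis .
  qed
  then show ?thesis unfolding assertion_iv_def using F Q by blast
qed

text \<open>Taking expectations of the conditional probabilities leaves the mean of the product of
  \<open>measure (K (\<Theta> \<omega>)) (B k)\<close>, in which the chosen indices no longer
  occur.\<close>

lemma i_imp_iii: "assertion_i TYPE('d::finite) M N \<Longrightarrow> assertion_iii M N"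
proof -
  assume "assertion_i TYPE('d) M N"
  then obtain \<Theta> :: "'a \<Rightarrow> real ^ 'd" and K where \<Theta>: "\<Theta> \<in> borel_measurable M"
    and K: "K \<in> borel \<rightarrow>\<^sub>M prob_algebra borel" and mixed: "mixed_renewal_process M K \<Theta> N"
    unfolding assertion_i_def by blast
  let ?G = "sigma_gen M \<Theta>"
  interpret G: finite_measure_subalgebra M ?G
    by unfold_locales (rule subalgebra_sigma_gen[OF \<Theta>])
  have single: "AE \<omega> in M. cond_prob_given M ?G (X n -` B \<inter> space M) \<omega> = measure (K (\<Theta> \<omega>)) B"
    if n: "1 \<le> n" and B: "B \<in> sets borel" for n B
  proof -
    obtain \<kappa> where \<kappa>: "is_cond_distribution M ?G (X n) \<kappa>" "kernels_eq_as M ?G \<kappa> (\<lambda>\<omega>. K (\<Theta> \<omega>))"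
      using mixed n unfolding mixed_renewal_process_def by blast
    from \<kappa>(2) obtain Z where Z: "Z \<in> null_sets M" "\<forall>\<omega> \<in> space M - Z. \<forall>B\<in>sets borel. measure (\<kappa> \<omega>) B = measure (K (\<Theta> \<omega>)) B"
      unfolding kernels_eq_as_def by blast
    have "AE \<omega> in M. measure (\<kappa> \<omega>) B = cond_prob_given M ?G (X n -` B \<inter> space M) \<omega>"
      using \<kappa>(1) B unfolding is_cond_distribution_def by blast
    then show ?thesis using AE_not_in[OF Z(1)] AE_space
      by eventually_elim (use Z(2) B in auto)
  qed
  have law: "prob (\<Inter>k\<in>{1..r}. X (i k) -` B k \<inter> space M) = expectation (\<lambda>\<omega>. \<Prod>k\<in>{1..r}. measure (K (\<Theta> \<omega>)) (B k))"
    if r: "1 \<le> r" and i: "i ` {1..r} \<subseteq> {1..}" "inj_on i {1..r}" and B: "\<forall>k\<in>{1..r}. B k \<in> sets borel"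
    for r :: nat and i :: "nat \<Rightarrow> nat" and B
  proof -
    define D where "D j = X j -` B (inv_into {1..r} i j) \<inter> space M" for j
    have Di: "D (i k) = X (i k) -` B k \<inter> space M" if "k \<in> {1..r}" for k using that i(2) by (simp add: D_def)
    let ?E = "\<Inter>j\<in>i ` {1..r}. D j"
    have E: "?E = (\<Inter>k\<in>{1..r}. X (i k) -` B k \<inter> space M)" using Di by simp
    have Em: "?E \<in> events" unfolding E using r B by (intro sets.finite_INT) auto
    have card: "card (i ` {1..r}) = r" using i(2) by (simp add: card_image)
    have "AE \<omega> in M. cond_prob_given M ?G ?E \<omega> = (\<Prod>j\<in>i ` {1..r}. cond_prob_given M ?G (D j) \<omega>)"
    \<comment> \<open>Conditional independence speaks about two or more indices; for one index both
      sides coincide.\<close>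
    proof (cases "r = 1")
      case False
      then have "2 \<le> card (i ` {1..r})" using r card by simp
      moreover have "\<forall>j\<in>i ` {1..r}. D j \<in> sets (sigma_gen M (X j))" using Di B by (auto simp: sets_sigma_gen)
      ultimately show ?thesis
        using mixed i(1) unfolding mixed_renewal_process_def cond_indep_given_def by blast
    qed simp
    moreover have "AE \<omega> in M. \<forall>k\<in>{1..r}. cond_prob_given M ?G (D (i k)) \<omega> = measure (K (\<Theta> \<omega>)) (B k)"
      using i(1) B by (intro AE_finite_allI) (auto simp: Di image_subset_iff intro!: single)
    ultimately have AE: "AE \<omega> in M. cond_prob_given M ?G ?E \<omega> = (\<Prod>k\<in>{1..r}. measure (K (\<Theta> \<omega>)) (B k))"
      by eventually_elim (use i(2) in \<open>simp add: prod.reindex\<close>)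
    have gm: "(\<lambda>\<omega>. \<Prod>k\<in>{1..r}. measure (K (\<Theta> \<omega>)) (B k)) \<in> borel_measurable M"
      using B measurable_compose[OF \<Theta> measurable_emeasure_kernel'[OF K]]
      unfolding measure_def by (intro borel_measurable_prod borel_measurable_enn2real) auto
    have "prob ?E = expectation (indicator ?E)" using Em by simp
    also have "\<dots> = expectation (cond_prob_given M ?G ?E)"
      unfolding cond_prob_given_def
      by (intro G.real_cond_exp_int(2)[symmetric] integrable_real_indicator Em) (simp add: less_top[symmetric])
    also have "\<dots> = expectation (\<lambda>\<omega>. \<Prod>k\<in>{1..r}. measure (K (\<Theta> \<omega>)) (B k))"
      by (rule integral_cong_AE) (use AE gm in \<open>auto simp: cond_prob_given_def\<close>)
    finally show ?thesis unfolding E .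
  qed
  show ?thesis unfolding assertion_iii_def exchangeable_def by (intro allI impI) (simp only: law)
qed

end

section \<open>Assertions (v) and (vi)\<close>

lemma measurable_eval_algebra:
  assumes \<nu>: "space \<nu> = Y" "sets \<nu> = sets (eval_algebra M Y S)" and E: "E \<in> sets M"
  shows "(\<lambda>y. measure (S y) E) \<in> borel_measurable \<nu>"
proof (rule measurableI)
  fix B :: "real set" assume "B \<in> sets borel"
  then have "(\<lambda>y. measure (S y) E) -` B \<inter> Y \<in> {(\<lambda>y. measure (S y) E) -` B \<inter> Y | E B. E \<in> sets M \<and> B \<in> sets borel}"
    using E by blast
  moreover have "{(\<lambda>y. measure (S y) E) -` B \<inter> Y | E B. E \<in> sets M \<and> B \<in> sets borel} \<subseteq> Pow Y" by auto
  ultimately show "(\<lambda>y. measure (S y) E) -` B \<inter> space \<nu> \<in> sets \<nu>"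
    unfolding \<nu> eval_algebra_def by simp
qed simp

text \<open>With all probability measures as parameters and the identity as family, a kernel becomes
  a measurable map into the evaluation algebra, so laws can be pushed forward along it.\<close>

lemma measurable_into_eval_algebra:
  assumes S: "S \<in> F \<rightarrow>\<^sub>M prob_algebra M"
  shows "S \<in> F \<rightarrow>\<^sub>M eval_algebra M (space (prob_algebra M)) (\<lambda>y. y)"
  unfolding eval_algebra_def
proof (rule measurable_measure_of)
  show "S \<in> space F \<rightarrow> space (prob_algebra M)" using measurable_space[OF S] by auto
  fix A assume "A \<in> {(\<lambda>y. measure y E) -` B \<inter> space (prob_algebra M) | E B. E \<in> sets M \<and> B \<in> sets borel}"
  then obtain E B where A: "A = (\<lambda>y. measure y E) -` B \<inter> space (prob_algebra M)" "E \<in> sets M" "B \<in> sets borel" by blast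
  have "(\<lambda>\<omega>. measure (S \<omega>) E) \<in> borel_measurable F"
    unfolding measure_def by (intro borel_measurable_enn2real measurable_emeasure_kernel'[OF S A(2)])
  from measurable_sets[OF this A(3)] show "S -` A \<inter> space F \<in> sets F"
    using measurable_space[OF S] by (auto simp: A(1) Int_def vimage_def elim!: back_subst[where P="\<lambda>A. A \<in> sets F"])
qed auto

context counting begin

text \<open>Composing the disintegration with \<open>\<Theta>\<close> gives the regular conditional
  probability. Consistency is what turns the factor \<open>indicator C \<theta>\<close> outside
  \<open>Pt \<theta>\<close> into intersection with the event \<open>\<Theta> \<in> C\<close> inside
  it.\<close>

lemma ii_imp_v: "assertion_ii TYPE('d::finite) M N \<Longrightarrow> assertion_v M N"
proof -
  assume "assertion_ii TYPE('d) M N"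
  then obtain \<Theta> :: "'a \<Rightarrow> real ^ 'd" and Pt K where
    \<Theta>: "\<Theta> \<in> borel_measurable M" and dis: "consistent_disintegration M \<Theta> Pt"
    and K: "K \<in> borel \<rightarrow>\<^sub>M prob_algebra borel"
    and ren: "AE \<theta> in distr M borel \<Theta>. renewal_process (Pt \<theta>) (K \<theta>) N"
    unfolding assertion_ii_def by blast
  have Pt: "Pt \<in> borel \<rightarrow>\<^sub>M prob_algebra M"
    and int: "\<And>D. D \<in> sets M \<Longrightarrow> (\<integral>\<^sup>+\<theta>. emeasure (Pt \<theta>) D \<partial>distr M borel \<Theta>) = emeasure M D"
    and cons: "\<And>B. B \<in> sets borel \<Longrightarrow> AE \<theta> in distr M borel \<Theta>. \<theta> \<in> B \<longrightarrow> emeasure (Pt \<theta>) (\<Theta> -` B \<inter> space M) = 1"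
    using dis unfolding consistent_disintegration_def by blast+
  let ?F = "sigma_gen M \<Theta>" and ?R = "restr_to_subalg M (sigma_gen M \<Theta>)"
  have F: "subalgebra M ?F" by (rule subalgebra_sigma_gen[OF \<Theta>])
  have \<Theta>R: "\<Theta> \<in> borel_measurable ?R"
    by (rule measurable_in_subalg[OF F measurable_sigma_gen])
  have distr: "distr ?R borel \<Theta> = distr M borel \<Theta>"
  proof (rule measure_eqI)
    fix A assume "A \<in> sets (distr ?R borel \<Theta>)"
    then have A: "A \<in> sets borel" by simp
    then show "emeasure (distr ?R borel \<Theta>) A = emeasure (distr M borel \<Theta>) A"
      using \<Theta> \<Theta>R by (simp add: emeasure_distr space_restr_to_subalg emeasure_restr_to_subalg[OF F] sets_sigma_gen)
        (metis (mono_tags, lifting) F emeasure_restr_to_subalg mem_Collect_eq sets_sigma_gen)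
  qed simp
  have S: "(\<lambda>\<omega>. Pt (\<Theta> \<omega>)) \<in> ?F \<rightarrow>\<^sub>M prob_algebra M"
    by (rule measurable_compose[OF measurable_sigma_gen Pt])
  have rcp: "subfield_rcp M ?F (\<lambda>\<omega>. Pt (\<Theta> \<omega>))"
    unfolding subfield_rcp_def
  proof (intro conjI S ballI)
    fix A E assume "A \<in> sets ?F" and E: "E \<in> sets M"
    then obtain C where C: "C \<in> sets borel" and A: "A = \<Theta> -` C \<inter> space M" by (auto simp: sets_sigma_gen)
    have Am: "A \<in> sets M" unfolding A by (rule measurable_sets[OF \<Theta> C])
    have "(\<integral>\<^sup>+\<omega>\<in>A. emeasure (Pt (\<Theta> \<omega>)) E \<partial>?R) = (\<integral>\<^sup>+\<omega>. emeasure (Pt (\<Theta> \<omega>)) E * indicator C (\<Theta> \<omega>) \<partial>?R)"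
      by (intro nn_integral_cong) (auto simp: A space_restr_to_subalg indicator_def)
    also have "\<dots> = (\<integral>\<^sup>+\<theta>. emeasure (Pt \<theta>) E * indicator C \<theta> \<partial>distr M borel \<Theta>)"
      unfolding distr[symmetric] using measurable_emeasure_kernel'[OF Pt E] C
      by (intro nn_integral_distr[OF \<Theta>R, symmetric]) auto
    also have "\<dots> = (\<integral>\<^sup>+\<theta>. emeasure (Pt \<theta>) (E \<inter> A) \<partial>distr M borel \<Theta>)"
    proof (rule nn_integral_cong_AE)
      \<comment> \<open>Consistency for the complement makes the event \<open>A\<close> null under
        \<open>Pt \<theta>\<close> when \<open>\<theta>\<close> lies outside
        \<open>C\<close>.\<close>
      have C': "- C \<in> sets borel" using C by auto
      show "AE \<theta> in distr M borel \<Theta>. emeasure (Pt \<theta>) E * indicator C \<theta> = emeasure (Pt \<theta>) (E \<inter> A)"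
        using cons[OF C] cons[OF C']
      proof eventually_elim
        case (elim \<theta>)
        have P: "prob_space (Pt \<theta>)" "sets (Pt \<theta>) = sets M" using prob_kernelD[OF Pt, of \<theta>] by simp_all
        interpret P: prob_space "Pt \<theta>" by fact
        have spP: "space (Pt \<theta>) = space M" by (rule sets_eq_imp_space_eq[OF P(2)])
        show ?case
        proof (cases "\<theta> \<in> C")
          case True
          then have "AE \<omega> in Pt \<theta>. \<omega> \<in> A"
            using elim(1) P(2) Am by (intro P.AE_prob_1) (simp add: A P.emeasure_eq_measure)
          then have "emeasure (Pt \<theta>) E = emeasure (Pt \<theta>) (E \<inter> A)"
            using E Am P(2) by (intro emeasure_eq_AE) auto
          then show ?thesis using True by simp
        next
          case False
          then have "AE \<omega> in Pt \<theta>. \<omega> \<in> \<Theta> -` (- C) \<inter> space M"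
            using elim(2) by (intro P.AE_prob_1) (simp add: P.emeasure_eq_measure)
          then have "emeasure (Pt \<theta>) (E \<inter> A) = emeasure (Pt \<theta>) {}"
            using E Am P(2) by (intro emeasure_eq_AE) (auto simp: A)
          then show ?thesis using False by simp
        qed
      qed
    qed
    also have "\<dots> = emeasure M (E \<inter> A)" using E Am by (intro int) auto
    finally show "(\<integral>\<^sup>+\<omega>\<in>A. emeasure (Pt (\<Theta> \<omega>)) E \<partial>?R) = emeasure M (E \<inter> A)" .
  qed
  have "AE \<theta> in distr ?R borel \<Theta>. renewal_process (Pt \<theta>) (K \<theta>) N" unfolding distr by (rule ren)
  then have "AE \<omega> in ?R. renewal_process (Pt (\<Theta> \<omega>)) (K (\<Theta> \<omega>)) N" by (rule AE_distrD[OF \<Theta>R])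
  then have "AE \<omega> in ?R. prob_space.indep_vars (Pt (\<Theta> \<omega>)) (\<lambda>_. borel) X {1..} \<and>
      (\<forall>n\<ge>1. distr (Pt (\<Theta> \<omega>)) borel (X n) = K (\<Theta> \<omega>))"
    unfolding renewal_process_def .
  moreover have "(\<lambda>\<omega>. K (\<Theta> \<omega>)) \<in> ?F \<rightarrow>\<^sub>M prob_algebra borel"
    by (rule measurable_compose[OF measurable_sigma_gen K])
  ultimately show ?thesis using F rcp unfolding assertion_v_def by blast
qed

lemma emeasure_distr_X:
  assumes "sets P = sets M" "B \<in> sets borel"
  shows "emeasure (distr P borel (X n)) B = emeasure P (X n -` B \<inter> space M)"
    and "measure (distr P borel (X n)) B = measure P (X n -` B \<inter> space M)"
proof -
  have "X n \<in> borel_measurable P" using X[of n] measurable_cong_sets[OF assms(1) refl] by blast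
  then show "emeasure (distr P borel (X n)) B = emeasure P (X n -` B \<inter> space M)"
      "measure (distr P borel (X n)) B = measure P (X n -` B \<inter> space M)"
    using assms(2) sets_eq_imp_space_eq[OF assms(1)] by (simp_all add: emeasure_distr measure_distr)
qed

lemma vimage_X_atMost: "X k -` {..a} \<inter> space M = {\<omega> \<in> space M. X k \<omega> \<le> a}"
  by auto

lemma sets_Inter_X_le [measurable]: "1 \<le> r \<Longrightarrow> (\<Inter>k\<in>{1..r}. {\<omega> \<in> space M. X k \<omega> \<le> w k}) \<in> sets M"
  by (intro sets.finite_INT) auto

lemma seq_vimage_lower_box:
  "1 \<le> r \<Longrightarrow> interarrival_seq N -` lower_box r w \<inter> space M = (\<Inter>k\<in>{1..r}. {\<omega> \<in> space M. X k \<omega> \<le> w k})"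
  by (auto simp: lower_box_def interarrival_seq_def space_PiM)

lemma renewal_Inter_le:
  assumes P: "prob_space P" "sets P = sets M" and K: "prob_space K" "sets K = sets borel"
    and ren: "renewal_process P K N" and r: "1 \<le> r"
  shows "measure P (\<Inter>k\<in>{1..r}. {\<omega> \<in> space M. X k \<omega> \<le> w k}) =
    (\<Prod>k\<in>{1..r}. measure P {\<omega> \<in> space M. X k \<omega> \<le> w k})"
proof -
  interpret P: prob_space P by fact
  interpret K: prob_space K by fact
  have single: "emeasure P {\<omega> \<in> space M. X k \<omega> \<le> w k} = emeasure K {..w k}" if "k \<in> {1..r}" for k
  proof -
    have "distr P borel (X k) = K" using ren that by (simp add: renewal_process_def)
    then show ?thesis using emeasure_distr_X(1)[OF P(2), of "{..w k}" k] by (simp add: vimage_X_atMost)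
  qed
  have seqP: "interarrival_seq N \<in> P \<rightarrow>\<^sub>M Seq"
    using measurable_seq measurable_cong_sets[OF P(2) refl] by blast
  have "emeasure P (\<Inter>k\<in>{1..r}. {\<omega> \<in> space M. X k \<omega> \<le> w k}) = emeasure (distr P Seq (interarrival_seq N)) (lower_box r w)"
    using emeasure_distr[OF seqP sets_lower_box] seq_vimage_lower_box[OF r] sets_eq_imp_space_eq[OF P(2)] by simp
  also have "\<dots> = (\<Prod>k\<in>{1..r}. emeasure K {..w k})"
    using ren renewal_process_iff[OF P K] emeasure_PiM_lower_box[OF K] by simp
  also have "\<dots> = (\<Prod>k\<in>{1..r}. emeasure P {\<omega> \<in> space M. X k \<omega> \<le> w k})"
    by (intro prod.cong) (simp_all add: single)
  finally show ?thesis
    by (simp add: P.emeasure_eq_measure prod_ennreal) (simp add: prod_nonneg)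
qed

text \<open>The parameters are all probability measures on the space, the family is the identity,
  and the mixing measure is the image of the restricted measure under \<open>S\<close>.\<close>

lemma v_imp_vi: "assertion_v M N \<Longrightarrow> assertion_vi TYPE('a measure) M N"
proof -
  assume "assertion_v M N"
  then obtain F S K where F: "subalgebra M F" and rcp: "subfield_rcp M F S" and K: "K \<in> F \<rightarrow>\<^sub>M prob_algebra borel"
    and AE: "AE \<omega> in restr_to_subalg M F. prob_space.indep_vars (S \<omega>) (\<lambda>_. borel) X {1..} \<and>
           (\<forall>n\<ge>1. distr (S \<omega>) borel (X n) = K \<omega>)"
    unfolding assertion_v_def by blast
  let ?R = "restr_to_subalg M F" and ?Y = "space (prob_algebra M)" and ?E = "eval_algebra M (space (prob_algebra M)) (\<lambda>y. y)"
  interpret R: prob_space ?R by (rule prob_space_restr_to_subalg[OF F prob_space_axioms])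
  have spF: "space F = space M" using F by (simp add: subalgebra_def)
  have S: "S \<in> F \<rightarrow>\<^sub>M prob_algebra M"
    and int: "\<And>A E. A \<in> sets F \<Longrightarrow> E \<in> sets M \<Longrightarrow> (\<integral>\<^sup>+\<omega>\<in>A. emeasure (S \<omega>) E \<partial>?R) = emeasure M (E \<inter> A)"
    using rcp unfolding subfield_rcp_def by blast+
  have SR: "S \<in> ?R \<rightarrow>\<^sub>M ?E"
    by (rule measurable_in_subalg[OF F measurable_into_eval_algebra[OF S]])
  have spE: "space ?E = ?Y" unfolding eval_algebra_def by (rule space_measure_of) auto
  define \<nu> where "\<nu> = distr ?R ?E S"
  have sp\<nu>: "space \<nu> = ?Y" and sets\<nu>: "sets \<nu> = sets ?E" by (simp_all add: \<nu>_def spE)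
  have Y: "prob_space y" "sets y = sets M" if "y \<in> ?Y" for y using that by (auto simp: space_prob_algebra)
  have ren: "AE \<omega> in ?R. renewal_process (S \<omega>) (K \<omega>) N" using AE unfolding renewal_process_def .
  have meas: "(\<lambda>y. measure y A) \<in> borel_measurable \<nu>" if "A \<in> sets M" for A
    by (rule measurable_eval_algebra[OF sp\<nu> sets\<nu> that])
  have measE: "(\<lambda>y. measure y A) \<in> borel_measurable ?E" if "A \<in> sets M" for A
    by (rule measurable_eval_algebra[OF spE refl that])
  have Xm: "{\<omega> \<in> space M. real_of_rat q < X m \<omega>} \<in> sets M" "{\<omega> \<in> space M. X m \<omega> \<le> a} \<in> sets M" for m q a
    by measurable
  have "nu_mixed_renewal_process M ?Y (\<lambda>y. y) \<nu> N"
    unfolding nu_mixed_renewal_process_def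
  proof (intro conjI allI impI)
    have same: "measure y {\<omega> \<in> space M. real_of_rat q < X m \<omega>} = measure (distr y borel (X m)) {real_of_rat q <..}"
      if "y \<in> ?Y" for y q m
    proof -
      have "X m -` {real_of_rat q <..} \<inter> space M = {\<omega> \<in> space M. real_of_rat q < X m \<omega>}" by auto
      then show ?thesis using emeasure_distr_X(2)[OF Y(2)[OF that], of "{real_of_rat q <..}" m] by simp
    qed
    \<comment> \<open>An almost sure statement passes through the image measure when it describes a
      measurable set of \<open>y\<close>; equality of laws is therefore expressed by countably many
      evaluations.\<close>
    have "AE y in \<nu>. \<forall>m\<in>{1..}. \<forall>n\<in>{1..}. \<forall>q. measure y {\<omega> \<in> space M. real_of_rat q < X m \<omega>} = measure y {\<omega> \<in> space M. real_of_rat q < X n \<omega>}"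
      unfolding \<nu>_def
    proof (subst AE_distr_iff[OF SR])
      have "{y \<in> space \<nu>. \<forall>m\<in>{1..}. \<forall>n\<in>{1..}. \<forall>q. measure y {\<omega> \<in> space M. real_of_rat q < X m \<omega>} = measure y {\<omega> \<in> space M. real_of_rat q < X n \<omega>}} \<in> sets \<nu>"
        by (intro sets.sets_Collect_countable_Ball sets.sets_Collect_countable_All borel_measurable_eq meas Xm)
      then show "{y \<in> space ?E. \<forall>m\<in>{1..}. \<forall>n\<in>{1..}. \<forall>q. measure y {\<omega> \<in> space M. real_of_rat q < X m \<omega>} = measure y {\<omega> \<in> space M. real_of_rat q < X n \<omega>}} \<in> sets ?E"
        unfolding sets\<nu> sp\<nu> spE .
      show "AE \<omega> in ?R. \<forall>m\<in>{1..}. \<forall>n\<in>{1..}. \<forall>q. measure (S \<omega>) {\<omega> \<in> space M. real_of_rat q < X m \<omega>} = measure (S \<omega>) {\<omega> \<in> space M. real_of_rat q < X n \<omega>}"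
        using ren AE_space
      proof eventually_elim
        case (elim \<omega>)
        then have "S \<omega> \<in> ?Y" using measurable_space[OF S] by (simp add: spF space_restr_to_subalg)
        then show ?case using elim(1) by (simp add: same renewal_process_def)
      qed
    qed
    then show "AE y in \<nu>. \<forall>m\<ge>1. \<forall>n\<ge>1. distr y borel (X m) = distr y borel (X n)"
      using AE_space
    proof eventually_elim
      case (elim y)
      then have y: "y \<in> ?Y" by (simp add: sp\<nu>)
      interpret y: prob_space y by (rule Y(1)[OF y])
      have Xy: "X n \<in> borel_measurable y" for n
        using X[of n] measurable_cong_sets[OF Y(2)[OF y] refl] by blast
      show ?case
      proof (intro allI impI)
        fix m n :: nat assume mn: "1 \<le> m" "1 \<le> n"
        interpret m: prob_space "distr y borel (X m)" by (rule y.prob_space_distr[OF Xy])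
        interpret n: prob_space "distr y borel (X n)" by (rule y.prob_space_distr[OF Xy])
        show "distr y borel (X m) = distr y borel (X n)"
        proof (rule real_measure_eqI_rat)
          show "finite_measure (distr y borel (X m))" by (rule m.finite_measure_axioms)
          show "emeasure (distr y borel (X m)) {real_of_rat q <..} = emeasure (distr y borel (X n)) {real_of_rat q <..}" for q
          proof -
            have "measure y {\<omega> \<in> space M. real_of_rat q < X m \<omega>} = measure y {\<omega> \<in> space M. real_of_rat q < X n \<omega>}"
              using elim(1) mn by blast
            then show ?thesis unfolding same[OF y] m.emeasure_eq_measure n.emeasure_eq_measure by (rule arg_cong)
          qed
        qed simp_all
      qed
    qed
    fix r :: nat and w :: "nat \<Rightarrow> real" assume r: "1 \<le> r"
    let ?A = "\<Inter>k\<in>{1..r}. {\<omega> \<in> space M. X k \<omega> \<le> w k}"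
    have A: "?A \<in> sets M" by (rule sets_Inter_X_le[OF r])
    have SA: "(\<lambda>\<omega>. measure (S \<omega>) ?A) \<in> borel_measurable ?R"
      by (rule measurable_compose[OF SR measE[OF A]])
    have PS: "prob_space (S \<omega>)" "sets (S \<omega>) = sets M" if "\<omega> \<in> space ?R" for \<omega>
      using prob_kernelD[OF S, of \<omega>] that by (auto simp: spF space_restr_to_subalg)
    have "ennreal (measure M ?A) = (\<integral>\<^sup>+\<omega>\<in>space F. emeasure (S \<omega>) ?A \<partial>?R)"
      using int[OF sets.top A] A sets.sets_into_space[OF A] by (simp add: spF emeasure_eq_measure Int_absorb2)
    also have "\<dots> = (\<integral>\<^sup>+\<omega>. ennreal (measure (S \<omega>) ?A) \<partial>?R)"
      using PS by (intro nn_integral_cong)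
        (simp add: space_restr_to_subalg spF finite_measure.emeasure_eq_measure[OF prob_space.finite_measure])
    also have "\<dots> = ennreal (\<integral>\<omega>. measure (S \<omega>) ?A \<partial>?R)"
      using SA prob_space.prob_le_1[OF PS(1)]
      by (intro nn_integral_eq_integral R.integrable_const_bound[where B=1] AE_I2) auto
    finally have "measure M ?A = (\<integral>\<omega>. measure (S \<omega>) ?A \<partial>?R)"
      by (simp add: integral_nonneg_AE)
    also have "\<dots> = (\<integral>\<omega>. (\<Prod>k\<in>{1..r}. measure (S \<omega>) {\<omega> \<in> space M. X k \<omega> \<le> w k}) \<partial>?R)"
    proof (rule integral_cong_AE[OF SA])
      show "(\<lambda>\<omega>. \<Prod>k\<in>{1..r}. measure (S \<omega>) {\<omega> \<in> space M. X k \<omega> \<le> w k}) \<in> borel_measurable ?R"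
        by (intro borel_measurable_prod measurable_compose[OF SR measE] Xm)
      show "AE \<omega> in ?R. measure (S \<omega>) ?A = (\<Prod>k\<in>{1..r}. measure (S \<omega>) {\<omega> \<in> space M. X k \<omega> \<le> w k})"
        using ren AE_space
      proof eventually_elim
        case (elim \<omega>)
        then have "prob_space (K \<omega>)" "sets (K \<omega>) = sets borel"
          using prob_kernelD[OF K, of \<omega>] by (auto simp: spF space_restr_to_subalg)
        then show ?case using elim PS r by (intro renewal_Inter_le) auto
      qed
    qed
    also have "\<dots> = (\<integral>y. (\<Prod>k\<in>{1..r}. measure y {\<omega> \<in> space M. X k \<omega> \<le> w k}) \<partial>\<nu>)"
      unfolding \<nu>_def
    proof (rule integral_distr[OF SR, symmetric])
      show "(\<lambda>y. \<Prod>k\<in>{1..r}. measure y {\<omega> \<in> space M. X k \<omega> \<le> w k}) \<in> borel_measurable ?E"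
        by (intro borel_measurable_prod measE Xm)
    qed
    finally show "measure M ?A = (\<integral>y. (\<Prod>k\<in>{1..r}. measure y {\<omega> \<in> space M. X k \<omega> \<le> w k}) \<partial>\<nu>)" .
  qed
  moreover have "prob_space \<nu>" unfolding \<nu>_def by (rule R.prob_space_distr[OF SR])
  ultimately have "(\<forall>y\<in>?Y. prob_space y \<and> sets y = sets M) \<and> prob_space \<nu> \<and> space \<nu> = ?Y \<and>
      sets \<nu> = sets ?E \<and> nu_mixed_renewal_process M ?Y (\<lambda>y. y) \<nu> N"
    using Y sp\<nu> sets\<nu> by blast
  then show ?thesis unfolding assertion_vi_def by (intro exI)
qed

text \<open>The terms need not be independent under \<open>S y\<close>. The product laws are built
  instead from \<open>\<kappa> y\<close>, the law of \<open>X 1\<close> under \<open>S y\<close>: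
  almost surely it is the law of every term, so the integrand in (vi) is the mass of a box under the
  power of \<open>\<kappa> y\<close>.\<close>

lemma vi_imp_iii: "assertion_vi TYPE('y) M N \<Longrightarrow> assertion_iii M N"
proof -
  assume "assertion_vi TYPE('y) M N"
  then obtain Y :: "'y set" and S \<nu> where S': "\<forall>y\<in>Y. prob_space (S y) \<and> sets (S y) = sets M"
    and \<nu>: "prob_space \<nu>" "space \<nu> = Y" "sets \<nu> = sets (eval_algebra M Y S)"
    and mix: "nu_mixed_renewal_process M Y S \<nu> N"
    unfolding assertion_vi_def by (elim exE conjE)
  have S: "prob_space (S y)" "sets (S y) = sets M" if "y \<in> Y" for y using S' that by auto
  interpret \<nu>: prob_space \<nu> by fact
  note meas = measurable_eval_algebra[OF \<nu>(2,3)]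
  define \<kappa> where "\<kappa> y = distr (S y) borel (X 1)" for y
  have \<kappa>y: "prob_space (\<kappa> y)" "sets (\<kappa> y) = sets borel" if "y \<in> Y" for y
  proof -
    have "X 1 \<in> borel_measurable (S y)" using X[of 1] measurable_cong_sets[OF S(2)[OF that] refl] by blast
    then show "prob_space (\<kappa> y)" unfolding \<kappa>_def by (rule prob_space.prob_space_distr[OF S(1)[OF that]])
  qed (simp add: \<kappa>_def)
  have \<kappa>: "\<kappa> \<in> \<nu> \<rightarrow>\<^sub>M prob_algebra borel"
    unfolding prob_algebra_def
  proof (rule measurable_restrict_space2)
    show "\<kappa> \<in> space \<nu> \<rightarrow> Collect prob_space" using \<kappa>y by (simp add: \<nu>(2))
    show "\<kappa> \<in> \<nu> \<rightarrow>\<^sub>M subprob_algebra borel"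
    proof (rule measurable_subprob_algebra)
      fix B :: "real set" assume B: "B \<in> sets borel"
      have "(\<lambda>y. ennreal (measure (S y) (X 1 -` B \<inter> space M))) \<in> borel_measurable \<nu>"
        using meas[OF measurable_sets[OF X B]] by measurable
      also have "?this \<longleftrightarrow> (\<lambda>y. emeasure (\<kappa> y) B) \<in> borel_measurable \<nu>"
        using S B unfolding \<kappa>_def
        by (intro measurable_cong)
          (simp add: \<nu>(2) emeasure_distr_X finite_measure.emeasure_eq_measure[OF prob_space.finite_measure])
      finally show "(\<lambda>y. emeasure (\<kappa> y) B) \<in> borel_measurable \<nu>" .
    qed (use \<kappa>y in \<open>auto simp: \<nu>(2) intro: prob_space_imp_subprob_space\<close>)
  qed
  have mixAE: "AE y in \<nu>. \<forall>m\<ge>1. \<forall>n\<ge>1. distr (S y) borel (X m) = distr (S y) borel (X n)"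
    and mixint: "\<And>r w. 1 \<le> r \<Longrightarrow> measure M (\<Inter>k\<in>{1..r}. {\<omega> \<in> space M. X k \<omega> \<le> w k}) =
        (\<integral>y. (\<Prod>k\<in>{1..r}. measure (S y) {\<omega> \<in> space M. X k \<omega> \<le> w k}) \<partial>\<nu>)"
    using mix unfolding nu_mixed_renewal_process_def by blast+
  have ident: "AE y in \<nu>. \<forall>k\<in>{1..}. distr (S y) borel (X k) = \<kappa> y"
    using mixAE unfolding \<kappa>_def by eventually_elim blast
  show ?thesis
  proof (rule iii_if_iid_mixture)
    show "prob_space (\<kappa> y) \<and> sets (\<kappa> y) = sets borel" if "y \<in> space \<nu>" for y
      using \<kappa>y that \<nu>(2) by simp
    fix H assume H: "H \<in> sets Seq"
    have "emeasure (distr M Seq (interarrival_seq N)) H = (\<integral>\<^sup>+y. emeasure (Pi\<^sub>M {1..} (\<lambda>_. \<kappa> y)) H \<partial>\<nu>)"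
    proof (rule iid_mixtureI[OF \<kappa> refl \<nu>.not_empty _ _ _ H])
      interpret D: prob_space "distr M Seq (interarrival_seq N)" by (rule prob_space_distr[OF measurable_seq])
      show "finite_measure (distr M Seq (interarrival_seq N))" by (rule D.finite_measure_axioms)
      fix r :: nat and w :: "nat \<Rightarrow> rat" assume r: "1 \<le> r"
      let ?w = "\<lambda>k. real_of_rat (w k)" and ?E = "\<lambda>k. {\<omega> \<in> space M. X k \<omega> \<le> real_of_rat (w k)}"
      have E: "?E k \<in> sets M" for k by measurable
      have "emeasure (distr M Seq (interarrival_seq N)) (lower_box r ?w) = emeasure M (\<Inter>k\<in>{1..r}. ?E k)"
        using emeasure_distr[OF measurable_seq sets_lower_box] seq_vimage_lower_box[OF r] by simp
      also have "\<dots> = ennreal (\<integral>y. (\<Prod>k\<in>{1..r}. measure (S y) (?E k)) \<partial>\<nu>)"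
        using mixint[OF r, of ?w] by (simp add: emeasure_eq_measure)
      also have "\<dots> = (\<integral>\<^sup>+y. ennreal (\<Prod>k\<in>{1..r}. measure (S y) (?E k)) \<partial>\<nu>)"
      proof (intro nn_integral_eq_integral[symmetric] \<nu>.integrable_const_bound[where B=1])
        show "AE y in \<nu>. norm (\<Prod>k\<in>{1..r}. measure (S y) (?E k)) \<le> 1"
        proof (rule AE_I2)
          fix y assume "y \<in> space \<nu>"
          then show "norm (\<Prod>k\<in>{1..r}. measure (S y) (?E k)) \<le> 1"
            using prod_bounds_01[of "{1..r}" "\<lambda>k. measure (S y) (?E k)"] prob_space.prob_le_1[OF S(1)] \<nu>(2) by auto
        qed
      qed (auto intro!: borel_measurable_prod meas E prod_nonneg)
      also have "\<dots> = (\<integral>\<^sup>+y. (\<Prod>k\<in>{1..r}. emeasure (\<kappa> y) {..?w k}) \<partial>\<nu>)"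
      proof (rule nn_integral_cong_AE)
        show "AE y in \<nu>. ennreal (\<Prod>k\<in>{1..r}. measure (S y) (?E k)) = (\<Prod>k\<in>{1..r}. emeasure (\<kappa> y) {..?w k})"
          using ident AE_space
        proof eventually_elim
          case (elim y)
          then have y: "y \<in> Y" by (simp add: \<nu>(2))
          have "emeasure (\<kappa> y) {..?w k} = ennreal (measure (S y) (?E k))" if "k \<in> {1..r}" for k
          proof -
            have "emeasure (\<kappa> y) {..?w k} = emeasure (distr (S y) borel (X k)) {..?w k}" using elim(1) that by simp
            also have "\<dots> = emeasure (S y) (?E k)"
              using emeasure_distr_X(1)[OF S(2)[OF y], of "{..?w k}" k] by (simp add: vimage_X_atMost)
            finally show ?thesis
              by (simp add: finite_measure.emeasure_eq_measure[OF prob_space.finite_measure[OF S(1)[OF y]]])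
          qed
          then show ?case by (simp add: prod_ennreal)
        qed
      qed
      finally show "emeasure (distr M Seq (interarrival_seq N)) (lower_box r ?w) = (\<integral>\<^sup>+y. (\<Prod>k\<in>{1..r}. emeasure (\<kappa> y) {..?w k}) \<partial>\<nu>)" .
    qed simp
    then show "emeasure M (interarrival_seq N -` H \<inter> space M) = (\<integral>\<^sup>+y. emeasure (Pi\<^sub>M {1..} (\<lambda>_. \<kappa> y)) H \<partial>\<nu>)"
      using emeasure_distr[OF measurable_seq H] by simp
  qed
qed

end

text \<open>A perfect measure on a countably generated space is carried by a Borel subset \<open>B\<close> of the
  real line, via a generating function \<open>\<phi>\<close>; conditional distributions of \<open>\<phi>\<close> are transported back along a
  right inverse \<open>\<psi>\<close> of \<open>\<phi>\<close> on \<open>B\<close>.\<close>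

lemma ex_disintegration:
  assumes M: "prob_space M" and cg: "countably_generated M" and perf: "perfect_measure M"
    and \<Theta>: "\<Theta> \<in> M \<rightarrow>\<^sub>M T"
  shows "\<exists>Pt \<in> T \<rightarrow>\<^sub>M prob_algebra M. \<forall>C\<in>sets T. \<forall>D\<in>sets M.
    (\<integral>\<^sup>+\<theta>\<in>C. emeasure (Pt \<theta>) D \<partial>distr M T \<Theta>) = emeasure M {\<omega> \<in> space M. \<Theta> \<omega> \<in> C \<and> \<omega> \<in> D}"
proof -
  interpret prob_space M by fact
  obtain \<A> where \<A>: "countable \<A>" "sets M = sigma_sets (space M) \<A>"
    using cg unfolding countably_generated_def by blast
  \<comment> \<open>The empty set is adjoined so that the enumeration has a nonempty range.\<close>
  define A where "A = from_nat_into (insert {} \<A>)"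
  have rA: "range A = insert {} \<A>" unfolding A_def using \<A>(1) by (intro range_from_nat_into) auto
  have AM: "A n \<in> sets M" for n
  proof -
    have "A n \<in> insert {} \<A>" using rA by blast
    then show ?thesis by (auto simp: \<A>(2) intro: sigma_sets.intros)
  qed
  obtain \<phi> :: "'a \<Rightarrow> real" where
    \<phi>1: "\<forall>F. space F = space M \<longrightarrow> (\<forall>n. (indicator (A n) :: 'a \<Rightarrow> real) \<in> borel_measurable F) \<longrightarrow> \<phi> \<in> borel_measurable F"
    and \<phi>2: "\<forall>n. (indicator (A n) :: 'a \<Rightarrow> real) \<in> borel_measurable (vimage_algebra (space M) \<phi> borel)"
    using ex_real_encoding[where f="\<lambda>n. indicator (A n)" and \<Omega>="space M"] by (elim exE conjE)
  have \<phi> [measurable]: "\<phi> \<in> borel_measurable M" using AM by (intro \<phi>1[rule_format]) auto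
  \<comment> \<open>Since \<open>\<phi>\<close> codes all generators, every measurable set is a
    preimage of a Borel set under it.\<close>
  have gen: "\<exists>C\<in>sets borel. D = \<phi> -` C \<inter> space M" if D: "D \<in> sets M" for D
  proof -
    let ?V = "vimage_algebra (space M) \<phi> borel"
    have "a \<in> sets ?V" if "a \<in> \<A>" for a
    proof -
      have "a \<in> range A" using rA that by simp
      then obtain n where n: "a = A n" by auto
      have "A n \<subseteq> space ?V" using sets.sets_into_space[OF AM] by simp
      then have "A n \<inter> space ?V = A n" by blast
      then show ?thesis using \<phi>2[rule_format, of n] unfolding n borel_measurable_indicator_iff by simp
    qed
    then have "sigma_sets (space ?V) \<A> \<subseteq> sets ?V" by (intro sets.sigma_sets_subset) auto
    then have "D \<in> sets ?V" using D \<A>(2) by auto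
    then show ?thesis by (auto simp: sets_vimage_algebra2)
  qed
  \<comment> \<open>The range of \<open>\<phi>\<close> may fail to be Borel. Perfectness provides a
    Borel subset of full measure, and a right inverse on it extends measurably by a
    constant.\<close>
  obtain B where B [measurable]: "B \<in> sets borel" and B\<phi>: "B \<subseteq> \<phi> ` space M" and B1: "emeasure M (\<phi> -` B \<inter> space M) = 1"
    using perf \<phi> unfolding perfect_measure_def by blast
  have AEB: "AE \<omega> in M. \<phi> \<omega> \<in> B"
  proof -
    have "AE \<omega> in M. \<omega> \<in> \<phi> -` B \<inter> space M" using B1 by (intro AE_prob_1) (simp add: emeasure_eq_measure)
    then show ?thesis by eventually_elim simp
  qed
  obtain \<omega>0 where \<omega>0: "\<omega>0 \<in> space M" using not_empty by blast
  define \<psi> where "\<psi> y = (if y \<in> B then inv_into (space M) \<phi> y else \<omega>0)" for y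
  have \<psi>B: "\<psi> y \<in> space M" "\<phi> (\<psi> y) = y" if "y \<in> B" for y
    using that B\<phi> inv_into_into[of y \<phi> "space M"] f_inv_into_f[of y \<phi> "space M"] by (auto simp: \<psi>_def)
  have \<psi> [measurable]: "\<psi> \<in> borel \<rightarrow>\<^sub>M M"
  proof (rule measurableI)
    show "\<psi> y \<in> space M" for y using \<psi>B(1)[of y] \<omega>0 by (cases "y \<in> B") (auto simp: \<psi>_def)
    fix D assume "D \<in> sets M"
    then obtain C where C [measurable]: "C \<in> sets borel" and D: "D = \<phi> -` C \<inter> space M" using gen by blast
    have "\<psi> -` D \<inter> space borel = (if \<omega>0 \<in> D then (B \<inter> C) \<union> - B else B \<inter> C)"
      using \<psi>B \<omega>0 by (auto simp: D \<psi>_def split: if_splits)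
    then show "\<psi> -` D \<inter> space borel \<in> sets borel" using B C by (auto intro: sets.Int sets.Un borel_comp)
  qed
  obtain \<kappa> where \<kappa>: "\<kappa> \<in> T \<rightarrow>\<^sub>M prob_algebra borel"
    and \<kappa>_eq: "\<forall>C\<in>sets T. \<forall>B\<in>sets borel. (\<integral>\<^sup>+\<theta>\<in>C. emeasure (\<kappa> \<theta>) B \<partial>distr M T \<Theta>) =
       emeasure M {\<omega> \<in> space M. \<Theta> \<omega> \<in> C \<and> \<phi> \<omega> \<in> B}"
    using ex_conditional_distribution[OF prob_space_axioms \<Theta> \<phi>] by blast
  show ?thesis
  proof (intro bexI ballI)
    show "(\<lambda>\<theta>. distr (\<kappa> \<theta>) M \<psi>) \<in> T \<rightarrow>\<^sub>M prob_algebra M"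
      using measurable_compose[OF \<kappa> measurable_distr_prob_space[OF \<psi>]] .
    fix C D assume C: "C \<in> sets T" and D: "D \<in> sets M"
    obtain C' where C': "C' \<in> sets borel" "D = \<phi> -` C' \<inter> space M" using gen[OF D] by blast
    have \<psi>D: "\<psi> -` D \<in> sets borel" using measurable_sets[OF \<psi> D] by simp
    have "emeasure (distr (\<kappa> \<theta>) M \<psi>) D = emeasure (\<kappa> \<theta>) (\<psi> -` D)" if "\<theta> \<in> space T" for \<theta>
    proof -
      have s: "sets (\<kappa> \<theta>) = sets borel" using prob_kernelD[OF \<kappa> that] by simp
      have "\<psi> \<in> \<kappa> \<theta> \<rightarrow>\<^sub>M M" using \<psi> by (simp only: measurable_cong_sets[OF s refl])
      then show ?thesis using D sets_eq_imp_space_eq[OF s] by (simp add: emeasure_distr)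
    qed
    then have "(\<integral>\<^sup>+\<theta>\<in>C. emeasure (distr (\<kappa> \<theta>) M \<psi>) D \<partial>distr M T \<Theta>) =
        (\<integral>\<^sup>+\<theta>\<in>C. emeasure (\<kappa> \<theta>) (\<psi> -` D) \<partial>distr M T \<Theta>)"
      by (intro nn_integral_cong) simp
    also have "\<dots> = emeasure M {\<omega> \<in> space M. \<Theta> \<omega> \<in> C \<and> \<phi> \<omega> \<in> \<psi> -` D}"
      using \<kappa>_eq C \<psi>D by blast
    also have "\<dots> = emeasure M {\<omega> \<in> space M. \<Theta> \<omega> \<in> C \<and> \<omega> \<in> D}"
    proof (rule emeasure_eq_AE)
      have "\<Theta> -` C \<inter> space M \<in> sets M" by (rule measurable_sets[OF \<Theta> C])
      moreover have "\<phi> -` (\<psi> -` D) \<inter> space M \<in> sets M" by (rule measurable_sets[OF \<phi> \<psi>D])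
      ultimately have "(\<Theta> -` C \<inter> space M) \<inter> (\<phi> -` (\<psi> -` D) \<inter> space M) \<in> sets M" "(\<Theta> -` C \<inter> space M) \<inter> D \<in> sets M"
        using D by blast+
      moreover have "(\<Theta> -` C \<inter> space M) \<inter> (\<phi> -` (\<psi> -` D) \<inter> space M) = {\<omega> \<in> space M. \<Theta> \<omega> \<in> C \<and> \<phi> \<omega> \<in> \<psi> -` D}"
          "(\<Theta> -` C \<inter> space M) \<inter> D = {\<omega> \<in> space M. \<Theta> \<omega> \<in> C \<and> \<omega> \<in> D}" by blast+
      ultimately show "{\<omega> \<in> space M. \<Theta> \<omega> \<in> C \<and> \<phi> \<omega> \<in> \<psi> -` D} \<in> sets M" "{\<omega> \<in> space M. \<Theta> \<omega> \<in> C \<and> \<omega> \<in> D} \<in> sets M"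
        by simp_all
      show "AE \<omega> in M. \<omega> \<in> {\<omega> \<in> space M. \<Theta> \<omega> \<in> C \<and> \<phi> \<omega> \<in> \<psi> -` D} \<longleftrightarrow> \<omega> \<in> {\<omega> \<in> space M. \<Theta> \<omega> \<in> C \<and> \<omega> \<in> D}"
        using AEB
      proof eventually_elim
        case (elim \<omega>)
        \<comment> \<open>The point \<open>\<psi> (\<phi> \<omega>)\<close> may differ from
          \<open>\<omega>\<close>, but both have the same value under \<open>\<phi>\<close>, and
          \<open>D\<close> is a preimage under \<open>\<phi>\<close>.\<close>
        show ?case using \<psi>B[OF elim] by (auto simp: C'(2))
      qed
    qed
    finally show "(\<integral>\<^sup>+\<theta>\<in>C. emeasure (distr (\<kappa> \<theta>) M \<psi>) D \<partial>distr M T \<Theta>) = emeasure M {\<omega> \<in> space M. \<Theta> \<omega> \<in> C \<and> \<omega> \<in> D}" .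
  qed
qed

section \<open>From exchangeability to a consistent disintegration\<close>

lemma (in prob_space) nn_integral_prob_kernel_finite:
  assumes "\<And>x. x \<in> space M \<Longrightarrow> prob_space (\<kappa> x)"
  shows "(\<integral>\<^sup>+x. emeasure (\<kappa> x) B \<partial>M) < \<infinity>"
proof -
  have "(\<integral>\<^sup>+x. emeasure (\<kappa> x) B \<partial>M) \<le> (\<integral>\<^sup>+x. 1 \<partial>M)"
  proof (rule nn_integral_mono)
    fix x assume "x \<in> space M"
    then interpret \<kappa>: prob_space "\<kappa> x" by (rule assms)
    show "emeasure (\<kappa> x) B \<le> 1" by (rule \<kappa>.subprob_emeasure_le_1)
  qed
  also have "\<dots> < \<infinity>" by (simp add: emeasure_space_1)
  finally show ?thesis .
qed

lemma lower_box_cong: "(\<And>k. k \<in> {1..r} \<Longrightarrow> w k = w' k) \<Longrightarrow> lower_box r w = lower_box r w'"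
  by (auto simp: lower_box_def)

context counting begin

lemma iii_imp_ii:
  assumes iii: "assertion_iii M N" and cg: "countably_generated M" and perf: "perfect_measure M"
  shows "assertion_ii TYPE('d::finite) M N"
proof -
  obtain \<Theta>0 :: "'a \<Rightarrow> real" and \<kappa>0 where "iid_given M X borel \<Theta>0 \<kappa>0" by (rule iii_imp_iid_given[OF iii])
  from iid_given_real_vec[OF this] obtain \<Theta> :: "'a \<Rightarrow> real ^ 'd" and K where iid: "iid_given M X borel \<Theta> K" by blast
  have \<Theta>: "\<Theta> \<in> borel_measurable M" and K: "K \<in> borel \<rightarrow>\<^sub>M prob_algebra borel"
    and iid_eq: "\<forall>C\<in>sets borel. \<forall>H\<in>sets Seq. (\<integral>\<^sup>+\<theta>\<in>C. emeasure (Pi\<^sub>M {1..} (\<lambda>_. K \<theta>)) H \<partial>distr M borel \<Theta>) =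
      emeasure M {\<omega> \<in> space M. \<Theta> \<omega> \<in> C \<and> (\<lambda>n\<in>{1..}. X n \<omega>) \<in> H}"
    using iid unfolding iid_given_def by blast+
  obtain Pt where Pt: "Pt \<in> borel \<rightarrow>\<^sub>M prob_algebra M"
    and Pt_eq: "\<forall>C\<in>sets borel. \<forall>D\<in>sets M. (\<integral>\<^sup>+\<theta>\<in>C. emeasure (Pt \<theta>) D \<partial>distr M borel \<Theta>) =
      emeasure M {\<omega> \<in> space M. \<Theta> \<omega> \<in> C \<and> \<omega> \<in> D}"
    using ex_disintegration[OF prob_space_axioms cg perf \<Theta>] by blast
  let ?\<nu> = "distr M borel \<Theta>"
  interpret \<nu>: prob_space ?\<nu> by (rule prob_space_distr[OF \<Theta>])
  have P: "prob_space (Pt \<theta>)" "sets (Pt \<theta>) = sets M" for \<theta> using prob_kernelD[OF Pt, of \<theta>] by simp_all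
  have PK: "prob_space (K \<theta>)" "sets (K \<theta>) = sets borel" for \<theta> using prob_kernelD[OF K, of \<theta>] by simp_all
  have Pm: "(\<lambda>\<theta>. emeasure (Pt \<theta>) D) \<in> borel_measurable ?\<nu>" if "D \<in> sets M" for D
    using measurable_emeasure_kernel'[OF Pt that] by simp
  have "consistent_disintegration M \<Theta> Pt"
    unfolding consistent_disintegration_def
  proof (intro conjI Pt ballI)
    fix D assume D: "D \<in> sets M"
    have "(\<integral>\<^sup>+\<theta>. emeasure (Pt \<theta>) D \<partial>?\<nu>) = (\<integral>\<^sup>+\<theta>\<in>UNIV. emeasure (Pt \<theta>) D \<partial>?\<nu>)" by simp
    also have "\<dots> = emeasure M {\<omega> \<in> space M. \<Theta> \<omega> \<in> UNIV \<and> \<omega> \<in> D}"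
      by (rule Pt_eq[rule_format]) (use D in auto)
    also have "{\<omega> \<in> space M. \<Theta> \<omega> \<in> UNIV \<and> \<omega> \<in> D} = D" using sets.sets_into_space[OF D] by auto
    finally show "(\<integral>\<^sup>+\<theta>. emeasure (Pt \<theta>) D \<partial>?\<nu>) = emeasure M D" .
  next
    fix B :: "(real ^ 'd) set" assume B: "B \<in> sets borel"
    have D: "\<Theta> -` B \<inter> space M \<in> sets M" by (rule measurable_sets[OF \<Theta> B])
    have ind: "(indicator B :: real ^ 'd \<Rightarrow> ennreal) \<in> borel_measurable ?\<nu>" using B by simp
    \<comment> \<open>Consistency as equality of densities: over any \<open>A\<close> both sides
      integrate to the probability of \<open>\<Theta> \<in> B \<inter> A\<close>.\<close>
    have "AE \<theta> in ?\<nu>. emeasure (Pt \<theta>) (\<Theta> -` B \<inter> space M) * indicator B \<theta> = indicator B \<theta>"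
    proof (rule AE_eq_if_set_nn_integral_eq)
      show "(\<lambda>\<theta>. emeasure (Pt \<theta>) (\<Theta> -` B \<inter> space M) * indicator B \<theta>) \<in> borel_measurable ?\<nu>"
        by (intro borel_measurable_times_ennreal Pm D ind)
      have *: "(\<integral>\<^sup>+\<theta>\<in>A. (emeasure (Pt \<theta>) (\<Theta> -` B \<inter> space M) * indicator B \<theta>) \<partial>?\<nu>) = (\<integral>\<^sup>+\<theta>\<in>A. indicator B \<theta> \<partial>?\<nu>)"
        if A: "A \<in> sets borel" for A
      proof -
        have "(\<integral>\<^sup>+\<theta>\<in>A. (emeasure (Pt \<theta>) (\<Theta> -` B \<inter> space M) * indicator B \<theta>) \<partial>?\<nu>) =
            (\<integral>\<^sup>+\<theta>\<in>B \<inter> A. emeasure (Pt \<theta>) (\<Theta> -` B \<inter> space M) \<partial>?\<nu>)"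
          by (intro nn_integral_cong) (simp add: indicator_inter_arith mult.assoc)
        also have "\<dots> = emeasure M {\<omega> \<in> space M. \<Theta> \<omega> \<in> B \<inter> A \<and> \<omega> \<in> \<Theta> -` B \<inter> space M}"
          using Pt_eq D sets.Int[OF B A] by blast
        also have "{\<omega> \<in> space M. \<Theta> \<omega> \<in> B \<inter> A \<and> \<omega> \<in> \<Theta> -` B \<inter> space M} = \<Theta> -` (B \<inter> A) \<inter> space M" by auto
        also have "emeasure M (\<Theta> -` (B \<inter> A) \<inter> space M) = (\<integral>\<^sup>+\<theta>. indicator (B \<inter> A) \<theta> \<partial>?\<nu>)"
          using emeasure_distr[OF \<Theta> sets.Int[OF B A]] sets.Int[OF B A] by simp
        also have "\<dots> = (\<integral>\<^sup>+\<theta>\<in>A. indicator B \<theta> \<partial>?\<nu>)"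
          by (intro nn_integral_cong) (simp add: indicator_inter_arith)
        finally show ?thesis .
      qed
      then show "(\<integral>\<^sup>+\<theta>\<in>A. (emeasure (Pt \<theta>) (\<Theta> -` B \<inter> space M) * indicator B \<theta>) \<partial>?\<nu>) = (\<integral>\<^sup>+\<theta>\<in>A. indicator B \<theta> \<partial>?\<nu>)"
        if "A \<in> sets ?\<nu>" for A using that by simp
      show fin: "(\<integral>\<^sup>+\<theta>. indicator B \<theta> \<partial>?\<nu>) < \<infinity>" using B by (simp add: less_top[symmetric])
      show "(\<integral>\<^sup>+\<theta>. emeasure (Pt \<theta>) (\<Theta> -` B \<inter> space M) * indicator B \<theta> \<partial>?\<nu>) < \<infinity>"
        using *[of UNIV] fin by simp
    qed (rule ind)
    then show "AE \<theta> in ?\<nu>. \<theta> \<in> B \<longrightarrow> emeasure (Pt \<theta>) (\<Theta> -` B \<inter> space M) = 1"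
      by eventually_elim (auto simp: indicator_def)
  qed
  moreover have "AE \<theta> in ?\<nu>. renewal_process (Pt \<theta>) (K \<theta>) N"
  proof -
    \<comment> \<open>Bounds are given by lists because \<open>rat list\<close> is countable, unlike
      \<open>nat \<Rightarrow> rat\<close>, so the null sets can be united.\<close>
    let ?W = "\<lambda>l k. real_of_rat (l ! k)"
    \<comment> \<open>For fixed \<open>H\<close> both kernels are densities of one measure, the
      probability that \<open>\<Theta> \<in> A\<close> and the sequence lies in \<open>H\<close>.
      The null set depends on \<open>H\<close>.\<close>
    have law: "AE \<theta> in ?\<nu>. emeasure (Pt \<theta>) (interarrival_seq N -` H \<inter> space M) = emeasure (Pi\<^sub>M {1..} (\<lambda>_. K \<theta>)) H"
      if H: "H \<in> sets Seq" for H
    proof (rule AE_eq_if_set_nn_integral_eq)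
      have D: "interarrival_seq N -` H \<inter> space M \<in> sets M" by (rule measurable_sets[OF measurable_seq H])
      show "(\<lambda>\<theta>. emeasure (Pt \<theta>) (interarrival_seq N -` H \<inter> space M)) \<in> borel_measurable ?\<nu>" by (rule Pm[OF D])
      show "(\<lambda>\<theta>. emeasure (Pi\<^sub>M {1..} (\<lambda>_. K \<theta>)) H) \<in> borel_measurable ?\<nu>"
        using measurable_emeasure_kernel'[OF measurable_PiM_iid[OF K] H] by simp
      show "(\<integral>\<^sup>+\<theta>. emeasure (Pt \<theta>) (interarrival_seq N -` H \<inter> space M) \<partial>?\<nu>) < \<infinity>"
        by (rule \<nu>.nn_integral_prob_kernel_finite) (rule P)
      show "(\<integral>\<^sup>+\<theta>. emeasure (Pi\<^sub>M {1..} (\<lambda>_. K \<theta>)) H \<partial>?\<nu>) < \<infinity>"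
        by (rule \<nu>.nn_integral_prob_kernel_finite) (intro prob_space_PiM PK)
      fix A assume "A \<in> sets ?\<nu>"
      then have A: "A \<in> sets borel" by simp
      have "(\<integral>\<^sup>+\<theta>\<in>A. emeasure (Pt \<theta>) (interarrival_seq N -` H \<inter> space M) \<partial>?\<nu>) =
          emeasure M {\<omega> \<in> space M. \<Theta> \<omega> \<in> A \<and> \<omega> \<in> interarrival_seq N -` H \<inter> space M}"
        using Pt_eq A D by blast
      also have "{\<omega> \<in> space M. \<Theta> \<omega> \<in> A \<and> \<omega> \<in> interarrival_seq N -` H \<inter> space M} =
          {\<omega> \<in> space M. \<Theta> \<omega> \<in> A \<and> (\<lambda>n\<in>{1..}. X n \<omega>) \<in> H}" by (auto simp: interarrival_seq_def)
      also have "emeasure M \<dots> = (\<integral>\<^sup>+\<theta>\<in>A. emeasure (Pi\<^sub>M {1..} (\<lambda>_. K \<theta>)) H \<partial>?\<nu>)"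
        using iid_eq A H by simp
      finally show "(\<integral>\<^sup>+\<theta>\<in>A. emeasure (Pt \<theta>) (interarrival_seq N -` H \<inter> space M) \<partial>?\<nu>) =
          (\<integral>\<^sup>+\<theta>\<in>A. emeasure (Pi\<^sub>M {1..} (\<lambda>_. K \<theta>)) H \<partial>?\<nu>)" .
    qed
    have "AE \<theta> in ?\<nu>. \<forall>r l. emeasure (Pt \<theta>) (interarrival_seq N -` lower_box r (?W l) \<inter> space M) =
        emeasure (Pi\<^sub>M {1..} (\<lambda>_. K \<theta>)) (lower_box r (?W l))"
      unfolding AE_all_countable by (intro allI law sets_lower_box)
    then show ?thesis
    proof eventually_elim
      case (elim \<theta>)
      have seqP: "interarrival_seq N \<in> Pt \<theta> \<rightarrow>\<^sub>M Seq"
        using measurable_seq measurable_cong_sets[OF P(2) refl] by blast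
      interpret D: prob_space "distr (Pt \<theta>) Seq (interarrival_seq N)"
        by (rule prob_space.prob_space_distr[OF P(1) seqP])
      have "distr (Pt \<theta>) Seq (interarrival_seq N) = Pi\<^sub>M {1..} (\<lambda>_. K \<theta>)"
      proof (rule measure_eqI_lower_box)
        show "sets (Pi\<^sub>M {1::nat..} (\<lambda>_. K \<theta>)) = sets Seq" by (rule sets_PiM_iid[OF PK(2)])
        show "finite_measure (distr (Pt \<theta>) Seq (interarrival_seq N))" by (rule D.finite_measure_axioms)
        fix r :: nat and w :: "nat \<Rightarrow> rat"
        \<comment> \<open>Coordinates start at 1 but list positions at 0, so the list needs
          \<open>Suc r\<close> entries.\<close>
        have box: "lower_box r (\<lambda>k. real_of_rat (w k)) = lower_box r (?W (map w [0..<Suc r]))"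
          by (rule lower_box_cong) (simp del: upt_Suc)
        show "emeasure (distr (Pt \<theta>) Seq (interarrival_seq N)) (lower_box r (\<lambda>k. real_of_rat (w k))) =
            emeasure (Pi\<^sub>M {1..} (\<lambda>_. K \<theta>)) (lower_box r (\<lambda>k. real_of_rat (w k)))"
          unfolding box emeasure_distr[OF seqP sets_lower_box] sets_eq_imp_space_eq[OF P(2)]
          using elim by blast
      qed simp
      then show ?case using renewal_process_iff[OF P PK] by simp
    qed
  qed
  ultimately show ?thesis unfolding assertion_ii_def using \<Theta> K by blast
qed

end

theorem theorem4p9:
  fixes M :: "'a measure" and N :: "real \<Rightarrow> 'a \<Rightarrow> enat"
  assumes "prob_space M" and "counting_process M N"
  shows
    "(assertion_ii TYPE('d::finite) M N \<longrightarrow> assertion_i TYPE('d) M N) \<and>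
     (assertion_ii TYPE('d) M N \<longrightarrow> assertion_v M N) \<and>
     (assertion_i TYPE('d) M N \<longleftrightarrow> assertion_iii M N) \<and>
     (assertion_ii TYPE('d) M N \<longrightarrow> assertion_iv M N) \<and>
     (assertion_v M N \<longrightarrow> assertion_vi TYPE('a measure) M N) \<and>
     (assertion_iii M N \<longleftrightarrow> assertion_iv M N) \<and>
     (assertion_vi TYPE('y) M N \<longrightarrow> assertion_iv M N) \<and>
     (assertion_vi TYPE('a measure) M N \<longrightarrow> assertion_iv M N) \<and>
     (countably_generated M \<and> perfect_measure M \<longrightarrow>
        (assertion_i TYPE('d) M N \<longleftrightarrow> assertion_ii TYPE('d) M N) \<and>
        (assertion_i TYPE('d) M N \<longleftrightarrow> assertion_iii M N) \<and>
        (assertion_i TYPE('d) M N \<longleftrightarrow> assertion_iv M N) \<and>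
        (assertion_i TYPE('d) M N \<longleftrightarrow> assertion_v M N) \<and>
        (assertion_i TYPE('d) M N \<longleftrightarrow> assertion_vi TYPE('a measure) M N))"
proof -
  interpret counting M N
    using assms by (simp add: counting_def counting_axioms_def)
  have i_iii: "assertion_i TYPE('d) M N \<longleftrightarrow> assertion_iii M N"
    using i_imp_iii[where ?'d='d] iii_imp_i[where ?'d='d] by blast
  have iii_iv: "assertion_iii M N \<longleftrightarrow> assertion_iv M N"
    using iii_imp_iv iv_imp_iii by blast
  have ii: "assertion_ii TYPE('d) M N \<Longrightarrow> assertion_iii M N" "assertion_ii TYPE('d) M N \<Longrightarrow> assertion_v M N"
    using ii_imp_iii[where ?'d='d] ii_imp_v[where ?'d='d] by blast+
  have vi: "assertion_vi TYPE('y) M N \<Longrightarrow> assertion_iii M N"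
      "assertion_vi TYPE('a measure) M N \<Longrightarrow> assertion_iii M N"
    using vi_imp_iii[where ?'y='y] vi_imp_iii[where ?'y="'a measure"] by blast+
  have iii_ii: "assertion_iii M N \<Longrightarrow> countably_generated M \<Longrightarrow> perfect_measure M \<Longrightarrow> assertion_ii TYPE('d) M N"
    by (rule iii_imp_ii)
  \<comment> \<open>Under the additional hypotheses \<open>iii_ii\<close> closes the cycle (iii),
    (ii), (v), (vi), (iii).\<close>
  show ?thesis using i_iii iii_iv ii vi v_imp_vi iii_ii by blast
qed

end
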